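(* Let $\Gamma=(V,E)$ be a finite simple undirected graph with $V=\{0,1,\dots,2n\}$, $n>0$. Edges are written as pairs $(i,j)$ with $i<j$. Then $\Gamma$ is a meander graph if and only if the following conditions hold: \begin{enumerate} \item $(0,i)\in E$ for any $1\le i\le 2n$; \item if $(i,j)\in E$, then $(i,k)\in E$ or $(k,j)\in E$ for all $k$ with $i<k<j$; \item if $(i,j)\in E$ and $(j,k)\in E$ then $(i,k)\in E$, for any $0\le i<j<k\le 2n$; \item the adjacency matrix $M$ of $\Gamma$ over $GF(2)$ is idempotent. \end{enumerate}
   Context: An open meander of order $2n$ is a configuration in the plane consisting of an oriented simple curve and a segment $L$ of a straight line that cross transversally at exactly $2n$ points; two open meanders are equivalent if a homeomorphism of the plane maps one to the other. It is drawn so that $L$ is horizontal and oriented from left to right, and the curve is oriented so that at the leftmost intersection point it is directed from top to bottom. The intersection points are labelled $1,2,\dots,2n$ from left to right along $L$. Standing assumption (closing construction): let $a$ and $b$ be the initial and final points of $L$ (left and right ends, not intersection points), and $m$ and $m'$ the start and finish points of the curve (not on $L$). The curve can be closed up by two simple arcs, one joining $b$ to $m$ and one joining $m'$ to $a$, which meet $L$ and the curve only at these endpoints and which cross each other transversally at exactly one point, labelled $0$; thus one obtains a closed planar curve with crossings $0,1,\dots,2n$. The meandric permutation $\pi\in\mathfrak S_{2n}$ is given by: $\pi(k)$ is the label of the $k$th intersection point met when travelling along the curve from its start to its finish. Put $R_\pi=\{(i,j): 1\le i<j\le 2n,\ \pi(i)>\pi(j)\}$ and $\neg R_\pi=\{(i,j):1\le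 i<j\le 2n,\ \pi(i)<\pi(j)\}$. The meander graph $\Gamma(\mathscr M)$ of the meander $\mathscr M$ is the simple undirected graph with vertex set $\{0,1,\dots,2n\}$ and edge set $\{(0,i): 1\le i\le 2n\}\cup\neg R_\pi$. A graph on $\{0,1,\dots,2n\}$ is a meander graph if it equals $\Gamma(\mathscr M)$ for some open meander $\mathscr M$ of order $2n$. *)

theory Defs
  imports "HOL-Analysis.Analysis" "HOL-Library.Z2" "Jordan_Normal_Form.Matrix"
begin

text \<open>
  The plane is \<^typ>\<open>complex\<close>. A configuration is given by the left end \<open>a\<close> and the right end \<open>b\<close>
  of the horizontal segment \<open>L\<close>, and by a parametrised arc \<open>\<gamma>\<close> on \<open>[0,1]\<close>, which is the oriented
  simple curve. The points \<open>m\<close> and \<open>m'\<close> are \<open>pathstart \<gamma>\<close> and \<open>pathfinish \<gamma>\<close>.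
\<close>

text \<open>
  The curves are merely continuous, so transversality is the topological one: near \<open>p\<close> the pair
  \<open>A\<close>, \<open>B\<close> looks like the two coordinate axes of a disc near its centre. In particular \<open>p\<close> is an
  interior point of both curves and no other strand of either passes through it.
\<close>

definition crosses_transversally_at :: "complex set \<Rightarrow> complex set \<Rightarrow> complex \<Rightarrow> bool" where
  "crosses_transversally_at A B p \<longleftrightarrow>
     (\<exists>U h h'. open U \<and> p \<in> U \<and> homeomorphism U (ball 0 1) h h' \<and> h p = 0 \<and>
        h ` (A \<inter> U) = {z \<in> ball 0 1. Im z = 0} \<and>
        h ` (B \<inter> U) = {z \<in> ball 0 1. Re z = 0})"

definition crossings :: "complex \<Rightarrow> complex \<Rightarrow> (real \<Rightarrow> complex) \<Rightarrow> complex set" where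
  "crossings a b \<gamma> = closed_segment a b \<inter> path_image \<gamma>"

definition crossing_times :: "complex \<Rightarrow> complex \<Rightarrow> (real \<Rightarrow> complex) \<Rightarrow> real set" where
  "crossing_times a b \<gamma> = {t \<in> {0..1}. \<gamma> t \<in> closed_segment a b}"

text \<open>The labels of the crossings are \<open>1, 2, \<dots>\<close> from left to right.\<close>

definition label :: "complex \<Rightarrow> complex \<Rightarrow> (real \<Rightarrow> complex) \<Rightarrow> complex \<Rightarrow> nat" where
  "label a b \<gamma> p = card {q \<in> crossings a b \<gamma>. Re q \<le> Re p}"

definition open_meander :: "nat \<Rightarrow> complex \<Rightarrow> complex \<Rightarrow> (real \<Rightarrow> complex) \<Rightarrow> bool" where
  "open_meander n a b \<gamma> \<longleftrightarrow>
     Im a = Im b \<and> Re a < Re b \<and> arc \<gamma> \<and>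
     a \<notin> path_image \<gamma> \<and> b \<notin> path_image \<gamma> \<and>
     pathstart \<gamma> \<notin> closed_segment a b \<and> pathfinish \<gamma> \<notin> closed_segment a b \<and>
     finite (crossings a b \<gamma>) \<and> card (crossings a b \<gamma>) = 2 * n \<and>
     (\<forall>p \<in> crossings a b \<gamma>. crosses_transversally_at (closed_segment a b) (path_image \<gamma>) p) \<and>
     (\<forall>t \<in> crossing_times a b \<gamma>. label a b \<gamma> (\<gamma> t) = 1 \<longrightarrow>
        (\<forall>\<^sub>F s in at_left t. Im (\<gamma> s) > Im a) \<and> (\<forall>\<^sub>F s in at_right t. Im (\<gamma> s) < Im a))"

text \<open>
  The closing arcs: \<open>\<alpha>\<close> from \<open>b\<close> to \<open>m\<close> and \<open>\<beta>\<close> from \<open>m'\<close> to \<open>a\<close>. Their common point \<open>c\<close> is the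
  crossing with label \<open>0\<close>.
\<close>

definition closable :: "complex \<Rightarrow> complex \<Rightarrow> (real \<Rightarrow> complex) \<Rightarrow> bool" where
  "closable a b \<gamma> \<longleftrightarrow>
     (\<exists>\<alpha> \<beta> c. arc \<alpha> \<and> pathstart \<alpha> = b \<and> pathfinish \<alpha> = pathstart \<gamma> \<and>
        arc \<beta> \<and> pathstart \<beta> = pathfinish \<gamma> \<and> pathfinish \<beta> = a \<and>
        path_image \<alpha> \<inter> (closed_segment a b \<union> path_image \<gamma>) = {b, pathstart \<gamma>} \<and>
        path_image \<beta> \<inter> (closed_segment a b \<union> path_image \<gamma>) = {pathfinish \<gamma>, a} \<and>
        path_image \<alpha> \<inter> path_image \<beta> = {c} \<and>
        crosses_transversally_at (path_image \<alpha>) (path_image \<beta>) c)"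

text \<open>
  \<open>\<pi>(k)\<close> is the label of the \<open>k\<close>-th crossing met along \<open>\<gamma>\<close>. Only the values at \<open>1, \<dots>, 2n\<close> are
  meaningful; there \<open>\<pi>\<close> is a permutation, by \<open>meandric_permutation_bij\<close> below.
\<close>

definition meandric_permutation :: "complex \<Rightarrow> complex \<Rightarrow> (real \<Rightarrow> complex) \<Rightarrow> nat \<Rightarrow> nat" where
  "meandric_permutation a b \<gamma> k =
     label a b \<gamma> (\<gamma> (sorted_list_of_set (crossing_times a b \<gamma>) ! (k - 1)))"

lemma bij_betw_crossing_times:
  assumes "open_meander n a b \<gamma>"
  shows "bij_betw \<gamma> (crossing_times a b \<gamma>) (crossings a b \<gamma>)"
  using assms
  by (fastforce simp: bij_betw_def open_meander_def arc_def crossings_def crossing_times_def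
      path_image_def inj_on_def)

lemma meandric_permutation_bij:
  assumes M: "open_meander n a b \<gamma>"
  shows "bij_betw (meandric_permutation a b \<gamma>) {1..2 * n} {1..2 * n}"
proof -
  let ?X = "crossings a b \<gamma>" and ?T = "crossing_times a b \<gamma>"
  let ?ts = "sorted_list_of_set ?T"
  have fin: "finite ?X" and card: "card ?X = 2 * n" and ab: "Im a = Im b"
    using M by (auto simp: open_meander_def)
  have bT: "bij_betw \<gamma> ?T ?X"
    by (rule bij_betw_crossing_times[OF M])
  have finT: "finite ?T" and cardT: "card ?T = 2 * n"
    using bij_betw_finite[OF bT] bij_betw_same_card[OF bT] fin card by auto
  have "bij_betw (\<lambda>k. k - 1) {1..2 * n} {..<2 * n}"
    by (rule bij_betw_byWitness[where f' = Suc]) auto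
  moreover have "bij_betw ((!) ?ts) {..<2 * n} ?T"
    using finT cardT by (intro bij_betw_nth) auto
  ultimately have bij1: "bij_betw (\<gamma> \<circ> (!) ?ts \<circ> (\<lambda>k. k - 1)) {1..2 * n} ?X"
    using bT by (auto intro!: bij_betw_trans)
  have Im_X: "Im q = Im a" if "q \<in> ?X" for q
  proof -
    obtain u where u: "q = (1 - u) *\<^sub>R a + u *\<^sub>R b"
      using \<open>q \<in> ?X\<close> unfolding crossings_def closed_segment_def by blast
    show ?thesis
      using ab unfolding u by (simp add: algebra_simps)
  qed
  have "p = q" if "p \<in> ?X" "q \<in> ?X" "label a b \<gamma> p = label a b \<gamma> q" "Re p \<le> Re q" for p q
  proof -
    have "{r \<in> ?X. Re r \<le> Re p} = {r \<in> ?X. Re r \<le> Re q}"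
      using that fin by (intro card_subset_eq) (auto simp: label_def)
    then have "Re q \<le> Re p"
      using that by blast
    then show ?thesis
      using that Im_X by (simp add: complex_eq_iff)
  qed
  then have inj: "inj_on (label a b \<gamma>) ?X"
    by (intro inj_onI) (metis linorder_le_cases)
  have "label a b \<gamma> ` ?X \<subseteq> {1..2 * n}"
  proof safe
    fix p assume p: "p \<in> ?X"
    have "label a b \<gamma> p \<le> card ?X"
      unfolding label_def using fin by (intro card_mono) auto
    moreover have "label a b \<gamma> p > 0"
      unfolding label_def using fin p by (subst card_gt_0_iff) auto
    ultimately show "label a b \<gamma> p \<in> {1..2 * n}"
      using card by auto
  qed
  then have "label a b \<gamma> ` ?X = {1..2 * n}"
    using inj card by (intro card_subset_eq) (auto simp: card_image)
  then have "bij_betw (label a b \<gamma>) ?X {1..2 * n}"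
    using inj by (simp add: bij_betw_def)
  from bij_betw_trans[OF bij1 this] show ?thesis
    by (simp add: comp_def meandric_permutation_def[abs_def])
qed

definition non_inversions :: "nat \<Rightarrow> (nat \<Rightarrow> nat) \<Rightarrow> (nat \<times> nat) set" where
  "non_inversions N \<pi> = {(i, j). 1 \<le> i \<and> i < j \<and> j \<le> N \<and> \<pi> i < \<pi> j}"

text \<open>
  A simple undirected graph on a set of natural numbers is given by its vertex set and its set of
  edges, the edge joining \<open>i\<close> and \<open>j\<close> being written once, as \<open>(i, j)\<close> with \<open>i < j\<close>.
\<close>

definition simple_graph :: "nat set \<Rightarrow> (nat \<times> nat) set \<Rightarrow> bool" where
  "simple_graph V E \<longleftrightarrow> finite V \<and> E \<subseteq> {(i, j). i \<in> V \<and> j \<in> V \<and> i < j}"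

definition meander_graph_edges ::
    "nat \<Rightarrow> complex \<Rightarrow> complex \<Rightarrow> (real \<Rightarrow> complex) \<Rightarrow> (nat \<times> nat) set" where
  "meander_graph_edges n a b \<gamma> =
     {(0, i) | i. 1 \<le> i \<and> i \<le> 2 * n} \<union> non_inversions (2 * n) (meandric_permutation a b \<gamma>)"

definition is_meander_graph :: "nat \<Rightarrow> nat set \<Rightarrow> (nat \<times> nat) set \<Rightarrow> bool" where
  "is_meander_graph n V E \<longleftrightarrow>
     (\<exists>a b \<gamma>. open_meander n a b \<gamma> \<and> closable a b \<gamma> \<and>
        V = {0..2 * n} \<and> E = meander_graph_edges n a b \<gamma>)"

text \<open>The field with two elements is \<^typ>\<open>bit\<close>.\<close>

definition adjacency_matrix :: "nat \<Rightarrow> (nat \<times> nat) set \<Rightarrow> bit mat" where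
  "adjacency_matrix N E =
     Matrix.mat N N (\<lambda>(i, j). if (i, j) \<in> E \<or> (j, i) \<in> E then 1 else 0)"

end

theory Submission
  imports Defs
begin

text \<open>
  Give the crossing of the closing arcs the label \<open>0\<close>, that is, extend \<open>\<pi>\<close> to \<open>\<sigma>\<close> on \<open>{0..2n}\<close> by
  \<open>\<sigma> 0 = 0\<close>. The adjacency matrix \<open>M\<close> then has entry 1 at \<open>(i, j)\<close> iff \<open>\<sigma>\<close> preserves the order of
  \<open>i\<close> and \<open>j\<close>. Modulo 2, the sum of the rows \<open>j\<close> and \<open>j + 1\<close> is the indicator of an interval of labels
  with ends \<open>\<sigma> j\<close> and \<open>\<sigma> (j + 1)\<close>, so the second differences of \<open>M\<^sup>2 - M\<close> are parities of intersections
  of intervals. They vanish iff \<open>\<sigma> k\<close> and \<open>k\<close> always have the same parity and the pairs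
  \<open>{\<sigma> i, \<sigma> (i + 1)}\<close> with \<open>i\<close> of a given parity do not cross one another.

  This is what the Jordan curve theorem gives for a meander: \<open>L\<close> and the parts of the closing arcs
  joining its ends to the crossing \<open>0\<close> form a Jordan curve \<open>C\<close>, and the strands of the curve between
  consecutive crossings lie alternately on the two sides of \<open>C\<close>; strands on one side do not cross, and
  the parity follows by counting. Conversely, conditions 2 and 3 say that the graph comes from a
  permutation, and the noncrossing pairs are realised by rectangular arches of height
  \<open>\<bar>\<sigma> (i + 1) - \<sigma> i\<bar>\<close>, alternately below and above the line.
\<close>

section \<open>Idempotency and noncrossing pairs\<close>

text \<open>Cyclically there is one more strand, from the crossing met last back to the crossing 0,
  and the pairs in \<open>meandric\<close> do not include it. Both directions need that no even pair
  encloses its label \<open>\<sigma> (2 * n)\<close>. In the algebra this is forced: the last row of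
  the matrix yields it from parity and noncrossing. For a meander it is wanted before the parity is
  known, because the even pairs leave one index over in the count. There it comes from topology, and
  its case \<open>\<sigma> 1 < \<sigma> (2 * n)\<close> is the one place where the noncrossing
  argument does not apply and the mutual crossing of the closing arcs is used. In the drawing the
  same facts let both ends of the curve run straight up past the arches and let the closing arcs
  cross.

  The curves are only continuous, so no tangents or angles are available. Everything local is read
  off from a chart at a crossing, and everything global from connected sets that miss a Jordan
  curve.\<close>

declare add_bit_eq_xor [simp del] mult_bit_eq_and [simp del]

lemma bit_add_self [simp]: "(x :: bit) + x = 0" "x + (x + y) = y"
  by (cases x; cases y; simp)+

lemma bit_add_eq_0_iff: "(x :: bit) + y = 0 \<longleftrightarrow> x = y"
  by (cases x; cases y) auto

text \<open>For distinct numbers: exactly one of \<open>x\<close> and \<open>y\<close> lies between \<open>u\<close> and \<open>v\<close>.\<close>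

definition interleaved :: "nat \<Rightarrow> nat \<Rightarrow> nat \<Rightarrow> nat \<Rightarrow> bool" where
  "interleaved u v x y \<longleftrightarrow> ((u < x) \<noteq> (v < x)) \<noteq> ((u < y) \<noteq> (v < y))"

definition concordance :: "(nat \<Rightarrow> nat) \<Rightarrow> nat \<Rightarrow> nat \<Rightarrow> bit" where
  "concordance \<sigma> i j = of_bool (i < j \<and> \<sigma> i < \<sigma> j \<or> j < i \<and> \<sigma> j < \<sigma> i)"

definition meandric :: "nat \<Rightarrow> (nat \<Rightarrow> nat) \<Rightarrow> bool" where
  "meandric n \<sigma> \<longleftrightarrow> (\<forall>k\<le>2 * n. even (\<sigma> k) = even k) \<and>
     (\<forall>i<2 * n. \<forall>j<2 * n. even i = even j \<longrightarrow> i \<noteq> j \<longrightarrow>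
        \<not> interleaved (\<sigma> i) (\<sigma> (Suc i)) (\<sigma> j) (\<sigma> (Suc j)))"

lemma concordance_commute: "concordance \<sigma> i j = concordance \<sigma> j i"
  by (auto simp: concordance_def)

section \<open>Inner products of rows modulo 2\<close>

lemma of_nat_bit: "(of_nat m :: bit) = of_bool (odd m)"
  by (cases "even m") (auto elim!: evenE oddE)

text \<open>Two initial segments meet in the shorter one. Modulo 2 an interval is a sum of two
  initial segments, so all the inner products below reduce to this. The bound is
  \<open>Suc N\<close> because a segment may contain all the labels.\<close>

lemma sum_of_bool_less_mult:
  assumes "p \<le> Suc N" "q \<le> Suc N"
  shows "(\<Sum>x\<le>N. of_bool (x < p) * of_bool (x < q) :: bit) = of_nat (min p q)"
proof -
  have "(\<Sum>x\<le>N. of_bool (x < p) * of_bool (x < q) :: bit) = (\<Sum>x\<in>{..N}. if x < min p q then 1 else 0)"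
    by (intro sum.cong) auto
  also have "\<dots> = of_nat (card ({..N} \<inter> {x. x < min p q}))"
    by (subst sum.If_cases) auto
  also have "{..N} \<inter> {x. x < min p q} = {..<min p q}"
    using assms by auto
  finally show ?thesis by simp
qed

context
  fixes N :: nat and \<sigma> :: "nat \<Rightarrow> nat"
  assumes bij: "bij_betw \<sigma> {..N} {..N}" and zero: "\<sigma> 0 = 0"
begin

lemma perm_eq_iff: "i \<le> N \<Longrightarrow> j \<le> N \<Longrightarrow> \<sigma> i = \<sigma> j \<longleftrightarrow> i = j"
  using bij by (auto simp: bij_betw_def inj_on_def)

lemma perm_le: "i \<le> N \<Longrightarrow> \<sigma> i \<le> N"
  using bij by (auto simp: bij_betw_def)

lemma sum_prefix_mult:
  assumes "p \<le> Suc N" "q \<le> Suc N"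
  shows "(\<Sum>k\<le>N. of_bool (\<sigma> k < p) * of_bool (\<sigma> k < q) :: bit) = of_nat (min p q)"
  using sum.reindex_bij_betw[OF bij, of "\<lambda>x. of_bool (x < p) * of_bool (x < q) :: bit"]
    sum_of_bool_less_mult[OF assms] by simp

text \<open>Moving \<open>k\<close> from one side of \<open>j\<close> and \<open>Suc j\<close> to
  the other complements both comparisons, and the two changes cancel modulo 2. The
  \<open>Suc\<close> on the right corrects for the zero diagonal at \<open>k = Suc j\<close>; at
  \<open>k = j\<close> the strict inequality does so.\<close>

lemma concordance_diff:
  assumes "j < N" "k \<le> N"
  shows "concordance \<sigma> j k + concordance \<sigma> (Suc j) k =
    of_bool (\<sigma> k < \<sigma> j) + of_bool (\<sigma> k < Suc (\<sigma> (Suc j)))"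
proof -
  have "\<sigma> k = \<sigma> j \<longleftrightarrow> k = j" "\<sigma> k = \<sigma> (Suc j) \<longleftrightarrow> k = Suc j" "\<sigma> j \<noteq> \<sigma> (Suc j)"
    using assms by (auto simp: perm_eq_iff)
  then show ?thesis
    by (cases "k < j"; cases "k = j"; cases "k = Suc j"; cases "\<sigma> k < \<sigma> j"; cases "\<sigma> k < \<sigma> (Suc j)")
      (auto simp: concordance_def)
qed

definition defect :: "nat \<Rightarrow> nat \<Rightarrow> bit" where
  "defect i j = (\<Sum>k\<le>N. concordance \<sigma> i k * concordance \<sigma> j k) + concordance \<sigma> i j"

text \<open>Row 0 has its ones exactly in the \<open>N\<close> positive columns.\<close>

lemma defect_0_0: "even N \<Longrightarrow> defect 0 0 = 0"
proof -
  assume N: "even N"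
  have "(\<Sum>k\<le>N. concordance \<sigma> 0 k * concordance \<sigma> 0 k) = (\<Sum>k\<le>N. if k = 0 then 0 else 1)"
    using perm_eq_iff[of _ 0] zero by (intro sum.cong) (auto simp: concordance_def zero neq0_conv[symmetric] simp del: neq0_conv)
  also have "\<dots> = of_nat N"
    by (subst sum.If_cases) (auto simp: Collect_neg_eq[symmetric] atMost_def[symmetric] Int_commute
      card_Diff_singleton_if Diff_eq[symmetric])
  finally show ?thesis using N by (simp add: defect_def concordance_def of_nat_bit)
qed

text \<open>This form presents row 0 as a sum of initial segments of labels, to which
  \<open>sum_prefix_mult\<close> applies.\<close>

lemma concordance_0: "k \<le> N \<Longrightarrow> concordance \<sigma> 0 k = 1 + of_bool (\<sigma> k < 1)"
  using perm_eq_iff[of k 0] zero by (auto simp: concordance_def)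

text \<open>Multiplying by row 0 counts the nonzero labels in the interval belonging to
  \<open>j\<close>, so the parity of its length appears. Vanishing forces consecutive labels to have
  opposite parity.\<close>

lemma defect_0_diff:
  assumes "j < N"
  shows "defect 0 j + defect 0 (Suc j) = of_bool (even (\<sigma> j + \<sigma> (Suc j)))"
proof -
  let ?p = "\<sigma> j" and ?q = "Suc (\<sigma> (Suc j))"
  have le: "?p \<le> Suc N" "?q \<le> Suc N"
    using perm_le[of j] perm_le[of "Suc j"] assms by auto
  have "defect 0 j + defect 0 (Suc j) =
      (\<Sum>k\<le>N. concordance \<sigma> 0 k * (concordance \<sigma> j k + concordance \<sigma> (Suc j) k)) +
      (concordance \<sigma> 0 j + concordance \<sigma> 0 (Suc j))"
    by (simp only: defect_def distrib_left sum.distrib ac_simps)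
  \<comment> \<open>The factor \<open>of_bool (\<sigma> k < Suc N)\<close> is always 1; it is
    inserted to give every summand the shape of a product of two initial segments.\<close>
  also have "(\<Sum>k\<le>N. concordance \<sigma> 0 k * (concordance \<sigma> j k + concordance \<sigma> (Suc j) k)) =
      (\<Sum>k\<le>N. of_bool (\<sigma> k < ?p) * of_bool (\<sigma> k < Suc N) + of_bool (\<sigma> k < ?q) * of_bool (\<sigma> k < Suc N) +
        of_bool (\<sigma> k < ?p) * of_bool (\<sigma> k < 1) + of_bool (\<sigma> k < ?q) * of_bool (\<sigma> k < 1))"
  proof (intro sum.cong refl)
    fix k assume "k \<in> {..N}"
    then have k: "k \<le> N" "\<sigma> k < Suc N" using perm_le[of k] by auto
    show "concordance \<sigma> 0 k * (concordance \<sigma> j k + concordance \<sigma> (Suc j) k) =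
        of_bool (\<sigma> k < ?p) * of_bool (\<sigma> k < Suc N) + of_bool (\<sigma> k < ?q) * of_bool (\<sigma> k < Suc N) +
        of_bool (\<sigma> k < ?p) * of_bool (\<sigma> k < 1) + of_bool (\<sigma> k < ?q) * of_bool (\<sigma> k < 1)"
      unfolding concordance_diff[OF assms k(1)] concordance_0[OF k(1)]
      using k(2) by (cases "\<sigma> k < ?p"; cases "\<sigma> k < ?q"; cases "\<sigma> k < 1") simp_all
  qed
  also have "\<dots> = of_nat (min ?p (Suc N)) + of_nat (min ?q (Suc N)) + of_nat (min ?p 1) + of_nat (min ?q 1)"
    using le by (simp only: sum.distrib sum_prefix_mult)
  also have "concordance \<sigma> 0 j + concordance \<sigma> 0 (Suc j) = of_bool (j = 0)"
    using assms perm_eq_iff[of j 0] perm_eq_iff[of "Suc j" 0] zero by (auto simp: concordance_0)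
  finally have eq: "defect 0 j + defect 0 (Suc j) = of_nat (min ?p (Suc N)) + of_nat (min ?q (Suc N)) +
      of_nat (min ?p 1) + of_nat (min ?q 1) + of_bool (j = 0)" .
  have mins: "min ?q 1 = 1" "min ?p (Suc N) = ?p" "min ?q (Suc N) = ?q" "min ?p 1 = of_bool (j \<noteq> 0)"
    using le assms perm_eq_iff[of j 0] zero by auto
  show ?thesis
    unfolding eq mins by (cases "j = 0") (auto simp: of_nat_bit zero)
qed

text \<open>The interval ends are \<open>u\<close>, \<open>Suc v\<close> and \<open>x\<close>,
  \<open>Suc y\<close>. If \<open>i\<close> and \<open>j\<close> have the same parity, all four are
  congruent modulo 2, so the four minima cancel and only the comparisons remain, which detect
  interleaving. If not, each \<open>min p q\<close> together with its comparison
  \<open>p < q\<close> is congruent to \<open>q\<close>, and the four values of \<open>q\<close>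
  cancel.\<close>

lemma defect_diff_diff:
  assumes "i < N" "j < N"
    and parity: "\<And>k. k \<le> N \<Longrightarrow> even (\<sigma> k) = even k"
  shows "defect i j + defect (Suc i) j + (defect i (Suc j) + defect (Suc i) (Suc j)) =
    of_bool (even i = even j \<and> i \<noteq> j \<and> interleaved (\<sigma> i) (\<sigma> (Suc i)) (\<sigma> j) (\<sigma> (Suc j)))"
proof -
  define u v x y where uv: "u = \<sigma> i" "v = \<sigma> (Suc i)" "x = \<sigma> j" "y = \<sigma> (Suc j)"
  have le: "u \<le> Suc N" "Suc v \<le> Suc N" "x \<le> Suc N" "Suc y \<le> Suc N"
    using perm_le[of j] perm_le[of "Suc j"] perm_le[of i] perm_le[of "Suc i"] assms(1,2)
    by (auto simp: uv)
  have "defect i j + defect (Suc i) j + (defect i (Suc j) + defect (Suc i) (Suc j)) =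
      (\<Sum>k\<le>N. (concordance \<sigma> i k + concordance \<sigma> (Suc i) k) * (concordance \<sigma> j k + concordance \<sigma> (Suc j) k)) +
      ((concordance \<sigma> j i + concordance \<sigma> (Suc j) i) + (concordance \<sigma> j (Suc i) + concordance \<sigma> (Suc j) (Suc i)))"
    by (simp only: defect_def distrib_left distrib_right sum.distrib ac_simps concordance_commute)
  also have "(\<Sum>k\<le>N. (concordance \<sigma> i k + concordance \<sigma> (Suc i) k) * (concordance \<sigma> j k + concordance \<sigma> (Suc j) k)) =
      (\<Sum>k\<le>N. (of_bool (\<sigma> k < u) + of_bool (\<sigma> k < Suc v)) * (of_bool (\<sigma> k < x) + of_bool (\<sigma> k < Suc y)))"
    using assms by (intro sum.cong) (simp_all add: concordance_diff uv)
  also have "\<dots> = of_nat (min u x) + of_nat (min u (Suc y)) + (of_nat (min (Suc v) x) + of_nat (min (Suc v) (Suc y)))"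
    using le by (simp only: sum.distrib sum_prefix_mult distrib_left distrib_right) simp
  also have "(concordance \<sigma> j i + concordance \<sigma> (Suc j) i) + (concordance \<sigma> j (Suc i) + concordance \<sigma> (Suc j) (Suc i)) =
     of_bool (u < x) + of_bool (u < Suc y) + (of_bool (v < x) + of_bool (v < Suc y))"
    using assms by (simp add: concordance_diff uv)
  finally have eq: "defect i j + defect (Suc i) j + (defect i (Suc j) + defect (Suc i) (Suc j)) =
     of_nat (min u x) + of_nat (min u (Suc y)) + (of_nat (min (Suc v) x) + of_nat (min (Suc v) (Suc y))) +
     (of_bool (u < x) + of_bool (u < Suc y) + (of_bool (v < x) + of_bool (v < Suc y)))" .
  have par: "even u = even i" "even v = odd i" "even x = even j" "even y = odd j"
    using parity[of i] parity[of j] parity[of "Suc i"] parity[of "Suc j"] assms(1,2) by (auto simp: uv)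
  have ne: "u \<noteq> v" "x \<noteq> y"
    using assms(1,2) by (auto simp: uv perm_eq_iff)
  show ?thesis
  proof (cases "even i = even j")
    case True
    then have par': "even x = even u" "even y = even v" "even v = odd u" using par by auto
    have min4: "of_nat (min u x) + of_nat (min u (Suc y)) + (of_nat (min (Suc v) x) + of_nat (min (Suc v) (Suc y))) = (0 :: bit)"
      using par' by (simp add: min_def of_nat_bit)
    show ?thesis
    proof (cases "i = j")
      case True
      then show ?thesis unfolding eq min4 using ne by (auto simp: uv)
    next
      case False
      \<comment> \<open>Indices of equal parity are not adjacent, so the two pairs share no label
        and \<open>Suc y\<close> may be replaced by \<open>y\<close> in the comparisons.\<close>
      then have "Suc i \<noteq> j" "i \<noteq> Suc j" using \<open>even i = even j\<close> by auto
      then have "u \<noteq> x" "u \<noteq> y" "v \<noteq> x" "v \<noteq> y"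
        using False assms(1,2) by (auto simp: uv perm_eq_iff)
      then show ?thesis unfolding eq min4 using False \<open>even i = even j\<close>
        by (cases "u < x"; cases "u < y"; cases "v < x"; cases "v < y")
          (simp_all add: uv[symmetric] interleaved_def less_Suc_eq)
    qed
  next
    case False
    then have "u \<noteq> x" "v \<noteq> y" "u \<noteq> Suc y" "Suc v \<noteq> x" "even x = odd u" "even y = odd v" "even v = odd u"
      using par by auto
    then show ?thesis unfolding eq using False
      by (cases "u < x"; cases "u < Suc y"; cases "v < x"; cases "v < Suc y"; cases "even u"; cases "even v")
        (simp_all add: min_def of_nat_bit)
  qed
qed

lemma defect_commute: "defect i j = defect j i"
  by (simp add: defect_def concordance_commute mult.commute)

text \<open>A symmetric array vanishes as soon as its corner, the differences along row 0 and all
  second differences vanish. The corner vanishes since \<open>N\<close> is even; the other two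
  conditions are parity and noncrossing.\<close>

lemma defect_zero_iff:
  assumes N: "N = 2 * n"
  shows "(\<forall>i\<le>N. \<forall>j\<le>N. defect i j = 0) \<longleftrightarrow> meandric n \<sigma>"
proof
  assume D: "\<forall>i\<le>N. \<forall>j\<le>N. defect i j = 0"
  have parity: "even (\<sigma> k) = even k" if "k \<le> N" for k
    using that
  proof (induction k)
    case (Suc k)
    then show ?case using defect_0_diff[of k] D by (auto split: if_splits simp: of_bool_def)
  qed (use zero in simp)
  show "meandric n \<sigma>"
    unfolding meandric_def
  proof (intro conjI allI impI)
    fix i j assume "i < 2 * n" "j < 2 * n" "even i = even j" "i \<noteq> j"
    then show "\<not> interleaved (\<sigma> i) (\<sigma> (Suc i)) (\<sigma> j) (\<sigma> (Suc j))"
      using defect_diff_diff[of i j, OF _ _ parity] D N by (auto split: if_splits simp: of_bool_def)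
  qed (use parity N in auto)
next
  assume m: "meandric n \<sigma>"
  have parity: "even (\<sigma> k) = even k" if "k \<le> N" for k
    using m that N by (auto simp: meandric_def)
  have D0: "defect 0 j = 0" if "j \<le> N" for j
    using that
  proof (induction j)
    case (Suc k)
    then show ?case using defect_0_diff[of k] parity[of k] parity[of "Suc k"] by auto
  qed (use N defect_0_0 in simp)
  have step: "defect i j + defect (Suc i) j = defect i (Suc j) + defect (Suc i) (Suc j)"
    if "i < N" "j < N" for i j
    using defect_diff_diff[OF that parity] m that N
    by (subst bit_add_eq_0_iff[symmetric]) (auto simp: meandric_def)
  have D1: "defect i j + defect (Suc i) j = 0" if "i < N" "j \<le> N" for i j
    using that(2)
  proof (induction j)
    case 0
    then show ?case using D0[of i] D0[of "Suc i"] that(1) by (simp add: defect_commute[of _ 0])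
  qed (use step that in auto)
  show "\<forall>i\<le>N. \<forall>j\<le>N. defect i j = 0"
  proof (intro allI impI)
    fix i j assume "i \<le> N" "j \<le> N"
    then show "defect i j = 0"
    proof (induction i)
      case (Suc i)
      then show ?case using D1[of i j] by auto
    qed (use D0 in auto)
  qed
qed

text \<open>The last row is the initial segment of labels below \<open>\<sigma> N\<close>. For even
  \<open>j\<close> the numbers \<open>\<sigma> N\<close>, \<open>\<sigma> j\<close> and
  \<open>Suc (\<sigma> (Suc j))\<close> are all even, so its product with the interval of
  \<open>j\<close> is 0. What is left of the difference of two vanishing defects is the
  claim.\<close>

lemma meandric_last_not_enclosed:
  assumes N: "N = 2 * n" and m: "meandric n \<sigma>" and j: "even j" "j < N"
  shows "(\<sigma> j < \<sigma> N) = (\<sigma> (Suc j) < \<sigma> N)"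
proof -
  have parity: "even (\<sigma> k) = even k" if "k \<le> N" for k
    using m that N by (auto simp: meandric_def)
  have "Suc j < N" using j N by presburger
  have D: "defect N j + defect N (Suc j) = 0"
    using defect_zero_iff[OF N] m j by auto
  let ?p = "\<sigma> N" and ?u = "\<sigma> j" and ?w = "Suc (\<sigma> (Suc j))"
  have le: "?p \<le> Suc N" "?u \<le> Suc N" "?w \<le> Suc N"
    using perm_le[of j] perm_le[of "Suc j"] perm_le[of N] j by auto
  have last: "concordance \<sigma> N k = of_bool (\<sigma> k < ?p)" if "k \<le> N" for k
    using that by (cases "k = N") (auto simp: concordance_def)
  have "defect N j + defect N (Suc j) =
      (\<Sum>k\<le>N. concordance \<sigma> N k * (concordance \<sigma> j k + concordance \<sigma> (Suc j) k)) +
      (concordance \<sigma> N j + concordance \<sigma> N (Suc j))"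
    by (simp only: defect_def distrib_left sum.distrib ac_simps)
  also have "(\<Sum>k\<le>N. concordance \<sigma> N k * (concordance \<sigma> j k + concordance \<sigma> (Suc j) k)) =
      (\<Sum>k\<le>N. of_bool (\<sigma> k < ?p) * (of_bool (\<sigma> k < ?u) + of_bool (\<sigma> k < ?w)))"
    using j by (intro sum.cong) (simp_all add: concordance_diff last)
  also have "\<dots> = of_nat (min ?p ?u) + of_nat (min ?p ?w)"
    using le by (simp only: sum.distrib sum_prefix_mult distrib_left)
  also have "\<dots> = 0"
    using parity[of N] parity[of j] parity[of "Suc j"] j N by (auto simp: min_def of_nat_bit)
  finally show ?thesis using D last[of j] last[of "Suc j"] j by (auto split: if_splits simp: of_bool_def)
qed

end

section \<open>Parity of the labels from noncrossing\<close>

lemma of_bool_interleaved: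
  "(of_bool (interleaved u v x y) :: bit) =
     (of_bool (u < x) + of_bool (v < x)) + (of_bool (u < y) + of_bool (v < y))"
  by (cases "u < x"; cases "u < y"; cases "v < x"; cases "v < y") (simp_all add: interleaved_def)

text \<open>The two ways of pairing consecutive indices belong to the two sides of the line: the
  even strands leave the last index over, the odd ones leave 0.\<close>

lemma sum_pairs_even:
  fixes g :: "nat \<Rightarrow> 'a :: comm_monoid_add"
  shows "sum g {..2 * n} = (\<Sum>i<n. g (2 * i) + g (Suc (2 * i))) + g (2 * n)"
  by (induction n) (simp_all add: ac_simps)

lemma sum_pairs_odd:
  fixes g :: "nat \<Rightarrow> 'a :: comm_monoid_add"
  shows "sum g {..2 * n} = g 0 + (\<Sum>i<n. g (Suc (2 * i)) + g (Suc (Suc (2 * i))))"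
  by (induction n) (simp_all add: ac_simps)

text \<open>
  Modulo 2 the pairs on the side of \<open>j\<close> contribute nothing to the number of labels above exactly
  one of \<open>\<sigma> j\<close>, \<open>\<sigma> (j + 1)\<close>, except for the pair of \<open>j\<close> itself. Hence consecutive labels have
  opposite parity.
\<close>

lemma meandricI:
  assumes bij: "bij_betw \<sigma> {..2 * n} {..2 * n}" and zero: "\<sigma> 0 = 0"
    and noncrossing: "\<And>i j. i < 2 * n \<Longrightarrow> j < 2 * n \<Longrightarrow> even i = even j \<Longrightarrow> i \<noteq> j \<Longrightarrow>
      \<not> interleaved (\<sigma> i) (\<sigma> (Suc i)) (\<sigma> j) (\<sigma> (Suc j))"
    and last: "\<And>j. even j \<Longrightarrow> j < 2 * n \<Longrightarrow> (\<sigma> j < \<sigma> (2 * n)) = (\<sigma> (Suc j) < \<sigma> (2 * n))"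
  shows "meandric n \<sigma>"
proof -
  have alternate: "odd (\<sigma> j + \<sigma> (Suc j))" if j: "j < 2 * n" for j
  proof -
    let ?u = "\<sigma> j" and ?v = "\<sigma> (Suc j)"
    define f :: "nat \<Rightarrow> bit" where "f x = of_bool (?u < x) + of_bool (?v < x)" for x
    have ne: "?u \<noteq> ?v" and le: "?u \<le> 2 * n" "?v \<le> 2 * n"
      using perm_eq_iff[OF bij zero, of j "Suc j"] perm_le[OF bij zero, of j]
        perm_le[OF bij zero, of "Suc j"] j by auto
    have "(\<Sum>x\<le>2 * n. of_bool (p < x) :: bit) = of_nat (2 * n - p)" if "p \<le> 2 * n" for p
    proof -
      have "(\<Sum>x\<le>2 * n. of_bool (p < x) :: bit) = of_nat (card ({..2 * n} \<inter> {x. p < x}))"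
        unfolding of_bool_def by (subst sum.If_cases) auto
      also have "{..2 * n} \<inter> {x. p < x} = {p<..2 * n}" by auto
      finally show ?thesis by simp
    qed
    \<comment> \<open>The sum of \<open>f\<close> over all labels is evaluated twice: here by
      counting the labels above \<open>?u\<close> and above \<open>?v\<close>, below by grouping the
      labels into pairs.\<close>
    then have "(\<Sum>x\<le>2 * n. f x) = of_nat (2 * n - ?u) + of_nat (2 * n - ?v)"
      using le by (simp only: f_def sum.distrib)
    also have "\<dots> = of_bool (odd (?u + ?v))"
      using le by (cases "even ?u"; cases "even ?v") (simp_all add: of_nat_bit)
    finally have total: "(\<Sum>k\<le>2 * n. f (\<sigma> k)) = of_bool (odd (?u + ?v))"
      using sum.reindex_bij_betw[OF bij, of f] by simp
    have pair: "f (\<sigma> i) + f (\<sigma> (Suc i)) = of_bool (i = j)" if "i < 2 * n" "even i = even j" for i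
    proof (cases "i = j")
      case True
      then show ?thesis using ne by (cases "?u < ?v") (auto simp: f_def)
    next
      case False
      then show ?thesis
        using noncrossing[OF j that(1)] that(2)
        by (simp add: f_def of_bool_interleaved[symmetric])
    qed
    obtain m where m: "j = 2 * m \<or> j = Suc (2 * m)" by (metis evenE oddE Suc_eq_plus1)
    then have "m < n" using j by auto
    have "(\<Sum>k\<le>2 * n. f (\<sigma> k)) = 1"
      using m
    proof
      assume "j = 2 * m"
      then have "(\<Sum>k\<le>2 * n. f (\<sigma> k)) = (\<Sum>i<n. if i = m then 1 else 0) + f (\<sigma> (2 * n))"
        unfolding sum_pairs_even using pair
        by (intro arg_cong2[where f = "(+)"] sum.cong refl) auto
      \<comment> \<open>The index that remains unpaired on the even side is handled by
        \<open>last\<close>; on the odd side it is 0, whose label exceeds no other.\<close>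
      moreover have "f (\<sigma> (2 * n)) = 0"
        using last[of j] j \<open>j = 2 * m\<close> by (simp add: f_def)
      ultimately show ?thesis using \<open>m < n\<close> by simp
    next
      assume "j = Suc (2 * m)"
      then have "(\<Sum>k\<le>2 * n. f (\<sigma> k)) = f (\<sigma> 0) + (\<Sum>i<n. if i = m then 1 else 0)"
        unfolding sum_pairs_odd using pair
        by (intro arg_cong2[where f = "(+)"] sum.cong refl) auto
      moreover have "f (\<sigma> 0) = 0"
        by (simp add: f_def zero)
      ultimately show ?thesis using \<open>m < n\<close> by simp
    qed
    then show ?thesis using total by (simp split: if_splits add: of_bool_def)
  qed
  have "even (\<sigma> k) = even k" if "k \<le> 2 * n" for k
    using that
  proof (induction k)
    case (Suc k)
    then show ?case using alternate[of k] by auto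
  qed (simp add: zero)
  then show ?thesis
    using noncrossing by (auto simp: meandric_def)
qed

text \<open>Conditions 2 and 3 say that \<open>precedes\<close> is transitive; it is always total.\<close>

definition precedes :: "(nat \<times> nat) set \<Rightarrow> nat \<Rightarrow> nat \<Rightarrow> bool" where
  "precedes E i j \<longleftrightarrow> (i < j \<and> (i, j) \<in> E) \<or> (j < i \<and> (j, i) \<notin> E)"

lemma precedes_total: "i \<noteq> j \<Longrightarrow> precedes E i j \<noteq> precedes E j i"
  by (auto simp: precedes_def)

lemma precedes_irrefl: "\<not> precedes E i i"
  by (auto simp: precedes_def)

text \<open>By contraposition \<open>split\<close> is transitivity of non-edges. Of the six orders
  of \<open>i\<close>, \<open>j\<close>, \<open>k\<close>, three reduce to \<open>trans\<close> and
  three to \<open>split\<close>; the seventh case contradicts totality.\<close>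

lemma precedes_trans:
  assumes split: "\<And>i j k. (i, j) \<in> E \<Longrightarrow> i < k \<Longrightarrow> k < j \<Longrightarrow> (i, k) \<in> E \<or> (k, j) \<in> E"
    and trans: "\<And>i j k. i < j \<Longrightarrow> j < k \<Longrightarrow> k \<le> N \<Longrightarrow> (i, j) \<in> E \<Longrightarrow> (j, k) \<in> E \<Longrightarrow> (i, k) \<in> E"
    and le: "i \<le> N" "j \<le> N" "k \<le> N" and ij: "precedes E i j" and jk: "precedes E j k"
  shows "precedes E i k"
proof -
  consider "i < j" "j < k" | "i < k" "k < j" | "j < i" "i < k" | "j < k" "k < i" | "k < i" "i < j"
    | "k < j" "j < i" | "i = k"
    using ij jk by (metis linorder_neqE_nat precedes_irrefl)
  then show ?thesis
  proof cases
    case 1 then show ?thesis using ij jk trans[of i j k] le by (auto simp: precedes_def)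
  next
    case 2 then show ?thesis using ij jk split[of i j k] le by (auto simp: precedes_def)
  next
    case 3 then show ?thesis using ij jk split[of j k i] le by (auto simp: precedes_def)
  next
    case 4 then show ?thesis using ij jk trans[of j k i] le by (auto simp: precedes_def)
  next
    case 5 then show ?thesis using ij jk trans[of k i j] le by (auto simp: precedes_def)
  next
    case 6 then show ?thesis using ij jk split[of k i j] le by (auto simp: precedes_def)
  next
    case 7 then show ?thesis using ij jk precedes_total[of i j E] precedes_irrefl by metis
  qed
qed

text \<open>A transitive tournament is a linear order, and \<open>\<sigma> i\<close> is the number
  of elements before \<open>i\<close>. The cone condition makes 0 the least element.\<close>

lemma permutation_of_graph:
  fixes E :: "(nat \<times> nat) set"
  assumes split: "\<And>i j k. (i, j) \<in> E \<Longrightarrow> i < k \<Longrightarrow> k < j \<Longrightarrow> (i, k) \<in> E \<or> (k, j) \<in> E"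
    and trans: "\<And>i j k. i < j \<Longrightarrow> j < k \<Longrightarrow> k \<le> N \<Longrightarrow> (i, j) \<in> E \<Longrightarrow> (j, k) \<in> E \<Longrightarrow> (i, k) \<in> E"
    and zero: "\<And>i. 1 \<le> i \<Longrightarrow> i \<le> N \<Longrightarrow> (0, i) \<in> E"
  obtains \<sigma> where "bij_betw \<sigma> {..N} {..N}" "\<sigma> 0 = 0"
    "\<And>i j. i < j \<Longrightarrow> j \<le> N \<Longrightarrow> \<sigma> i < \<sigma> j \<longleftrightarrow> (i, j) \<in> E"
proof -
  define below where "below i = {k \<in> {..N}. precedes E k i}" for i
  define \<sigma> where "\<sigma> i = card (below i)" for i
  have fin: "finite (below i)" for i by (simp add: below_def)
  have tr: "precedes E i k" if "precedes E i j" "precedes E j k" "i \<le> N" "j \<le> N" "k \<le> N" for i j k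
    by (rule precedes_trans[of E N i j k]; (fact split | fact trans | fact that))
  have less: "\<sigma> i < \<sigma> j" if "precedes E i j" "i \<le> N" "j \<le> N" for i j
  proof -
    have "below i \<subseteq> below j"
      using tr that by (auto simp: below_def)
    moreover have "i \<in> below j" "i \<notin> below i"
      using that by (auto simp: below_def precedes_irrefl)
    ultimately show ?thesis
      unfolding \<sigma>_def by (intro psubset_card_mono fin) auto
  qed
  have iff: "\<sigma> i < \<sigma> j \<longleftrightarrow> precedes E i j" if "i \<le> N" "j \<le> N" for i j
    using less[of i j] less[of j i] that precedes_total[of i j E] by (cases "i = j") (auto simp: precedes_irrefl)
  have "inj_on \<sigma> {..N}"
  proof (rule inj_onI)
    fix i j assume "i \<in> {..N}" "j \<in> {..N}" "\<sigma> i = \<sigma> j"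
    then show "i = j"
      using precedes_total[of i j E] iff[of i j] iff[of j i] by auto
  qed
  moreover have "\<sigma> ` {..N} \<subseteq> {..N}"
  proof safe
    fix i assume "i \<le> N"
    have "below i \<subseteq> {..N} - {i}" by (auto simp: below_def precedes_irrefl)
    then have "\<sigma> i \<le> card ({..N} - {i})" unfolding \<sigma>_def by (intro card_mono) auto
    then show "\<sigma> i \<le> N" using \<open>i \<le> N\<close> by simp
  qed
  ultimately have "bij_betw \<sigma> {..N} {..N}"
    by (simp add: bij_betw_def endo_inj_surj)
  moreover have "below 0 = {}"
    using zero by (fastforce simp: below_def precedes_def)
  then have "\<sigma> 0 = 0" by (simp add: \<sigma>_def)
  moreover have "\<sigma> i < \<sigma> j \<longleftrightarrow> (i, j) \<in> E" if "i < j" "j \<le> N" for i j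
    using iff[of i j] that by (auto simp: precedes_def)
  ultimately show ?thesis using that by blast
qed

text \<open>As M is symmetric, the entries of \<open>M * M\<close> are the inner products of rows
  that occur in \<open>defect\<close>.\<close>

lemma adjacency_matrix_idempotent_iff:
  assumes bij: "bij_betw \<sigma> {..2 * n} {..2 * n}" and zero: "\<sigma> 0 = 0"
    and E: "\<And>i j. (i, j) \<in> E \<longleftrightarrow> i < j \<and> j \<le> 2 * n \<and> \<sigma> i < \<sigma> j"
  defines "M \<equiv> adjacency_matrix (2 * n + 1) E"
  shows "M * M = M \<longleftrightarrow> meandric n \<sigma>"
proof -
  have dim: "M \<in> carrier_mat (2 * n + 1) (2 * n + 1)"
    by (simp add: M_def adjacency_matrix_def)
  have M: "M $$ (i, j) = concordance \<sigma> i j" if "i \<le> 2 * n" "j \<le> 2 * n" for i j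
    using that by (auto simp: M_def adjacency_matrix_def concordance_def E)
  have MM: "(M * M) $$ (i, j) = (\<Sum>k\<le>2 * n. concordance \<sigma> i k * concordance \<sigma> j k)"
    if "i \<le> 2 * n" "j \<le> 2 * n" for i j
  proof -
    have "(M * M) $$ (i, j) = (\<Sum>k\<in>{0..<2 * n + 1}. M $$ (i, k) * M $$ (k, j))"
      using that dim by (simp add: times_mat_def scalar_prod_def)
    also have "\<dots> = (\<Sum>k\<le>2 * n. concordance \<sigma> i k * concordance \<sigma> j k)"
      using that by (intro sum.cong) (auto simp: M concordance_commute)
    finally show ?thesis .
  qed
  have "M * M = M \<longleftrightarrow> (\<forall>i\<le>2 * n. \<forall>j\<le>2 * n. (M * M) $$ (i, j) = M $$ (i, j))"
    using dim by (auto simp: mat_eq_iff less_Suc_eq_le)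
  also have "\<dots> \<longleftrightarrow> (\<forall>i\<le>2 * n. \<forall>j\<le>2 * n. defect (2 * n) \<sigma> i j = 0)"
    by (simp add: MM M defect_def[OF bij zero] bit_add_eq_0_iff)
  also have "\<dots> \<longleftrightarrow> meandric n \<sigma>"
    by (rule defect_zero_iff[OF bij zero refl])
  finally show ?thesis .
qed

section \<open>Sides of a Jordan curve\<close>

text \<open>Which of the two components is bounded is left open on purpose: a strand may start on
  either side, and the arguments are symmetric in \<open>S\<close> and \<open>T\<close>.\<close>

definition jordan_sides :: "complex set \<Rightarrow> complex set \<Rightarrow> complex set \<Rightarrow> bool" where
  "jordan_sides J S T \<longleftrightarrow> open S \<and> connected S \<and> open T \<and> connected T \<and> S \<inter> T = {} \<and>
     S \<union> T = - J \<and> frontier S = J \<and> frontier T = J"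

lemma jordan_sides_commute: "jordan_sides J S T \<Longrightarrow> jordan_sides J T S"
  by (auto simp: jordan_sides_def)

lemma jordan_sides_arcs:
  assumes "arc g" "arc h" "pathstart h = pathfinish g" "pathfinish h = pathstart g"
    and "path_image g \<inter> path_image h \<subseteq> {pathstart g, pathfinish g}"
  obtains S T where "jordan_sides (path_image g \<union> path_image h) S T"
proof -
  have "simple_path (g +++ h)"
    using assms by (intro simple_path_join_loop) auto
  moreover have "pathfinish (g +++ h) = pathstart (g +++ h)"
    using assms by simp
  moreover have "path_image (g +++ h) = path_image g \<union> path_image h"
    using assms by (simp add: path_image_join)
  ultimately have "jordan_sides (path_image g \<union> path_image h)
      (inside (path_image g \<union> path_image h)) (outside (path_image g \<union> path_image h))"
    using Jordan_inside_outside[of "g +++ h"] by (simp add: jordan_sides_def inside_Int_outside)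
  then show ?thesis using that by blast
qed

lemma connected_in_side:
  assumes "jordan_sides J S T" "connected K" "K \<inter> J = {}"
  shows "K \<subseteq> S \<or> K \<subseteq> T"
  using connectedD[OF assms(2), of S T] assms(1,3) unfolding jordan_sides_def by blast

text \<open>In the chart \<open>A\<close> is the real diameter, and the preimages of the two half
  discs are connected because half discs are convex. The curve runs on the imaginary axis there, so
  the imaginary part along it is continuous and injective, hence strictly monotone, and it changes
  sign at \<open>t\<close>. The closed set \<open>W\<close> stands for all that has to be kept away
  from the crossing.\<close>

lemma crossing_halves:
  assumes cross: "crosses_transversally_at A (path_image g) (g t)"
    and g: "arc g" "0 < t" "t < 1" and W: "closed W" "g t \<notin> W"
  obtains U D1 D2 where "open U" "g t \<in> U" "U \<inter> W = {}" "connected D1" "connected D2"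
    "U - A = D1 \<union> D2" "\<forall>\<^sub>F s in at_left t. g s \<in> D1" "\<forall>\<^sub>F s in at_right t. g s \<in> D2"
proof -
  obtain U0 h h' where U0: "open U0" "g t \<in> U0" and hom: "homeomorphism U0 (ball 0 1) h h'"
    and h0: "h (g t) = 0" and hA: "h ` (A \<inter> U0) = {z \<in> ball 0 1. Im z = 0}"
    and hB: "h ` (path_image g \<inter> U0) = {z \<in> ball 0 1. Re z = 0}"
    using cross unfolding crosses_transversally_at_def by blast
  have hh: "h' (h z) = z" "h z \<in> ball 0 1" if "z \<in> U0" for z
    using hom that by (auto simp: homeomorphism_def)
  have hh': "h (h' z) = z" "h' z \<in> U0" if "z \<in> ball 0 1" for z
    using hom that by (auto simp: homeomorphism_def)
  have conth: "continuous_on U0 h" and conth': "continuous_on (ball 0 1) h'"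
    using hom by (auto simp: homeomorphism_def)
  \<comment> \<open>The disc is shrunk to radius \<open>r\<close>, so that its preimage avoids
    \<open>W\<close> and is still described by the same chart.\<close>
  have "open (ball 0 1 \<inter> h' -` (U0 - W))"
    using U0 W by (intro continuous_open_preimage[OF conth']) auto
  moreover have "0 \<in> ball 0 1 \<inter> h' -` (U0 - W)"
    using hh(1)[OF U0(2)] h0 U0(2) W by auto
  ultimately obtain r where r: "r > 0" "ball 0 r \<subseteq> ball 0 1 \<inter> h' -` (U0 - W)"
    by (meson open_contains_ball)
  define U where "U = U0 \<inter> h -` ball 0 r"
  have "open U"
    unfolding U_def using U0 by (intro continuous_open_preimage[OF conth]) auto
  have "g t \<in> U" using U0 h0 r by (auto simp: U_def)
  have UW: "U \<inter> W = {}" using r hh by (force simp: U_def)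
  have U_h': "U \<inter> h -` X = h' ` (X \<inter> ball 0 r)" for X
  proof -
    have "h' z \<in> U0" "h (h' z) = z" if "z \<in> ball 0 r" for z
      using that r hh' by auto
    then show ?thesis using hh by (force simp: U_def)
  qed
  define D where "D X = U \<inter> h -` X" for X
  have conn: "connected (D X)" if "convex X" for X
  proof -
    have "connected (X \<inter> ball 0 r)"
      using that by (intro convex_connected convex_Int) auto
    moreover have "continuous_on (X \<inter> ball 0 r) h'"
      using r by (intro continuous_on_subset[OF conth']) auto
    ultimately show ?thesis
      unfolding D_def U_h' by (rule connected_continuous_image[rotated])
  qed
  let ?N = "D {z. Im z < 0}" and ?P = "D {z. Im z > 0}"
  have A_iff: "z \<in> A \<longleftrightarrow> Im (h z) = 0" if "z \<in> U" for z
  proof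
    assume "Im (h z) = 0"
    then have "h z \<in> h ` (A \<inter> U0)" unfolding hA using that hh by (auto simp: U_def)
    then obtain y where "y \<in> A" "y \<in> U0" "h z = h y" by blast
    then show "z \<in> A" using hh that by (metis IntD1 U_def)
  qed (use hA that in \<open>auto simp: U_def\<close>)
  have conn2: "connected ?N" "connected ?P"
    by (auto intro!: conn convex_halfspace_Im_lt convex_halfspace_Im_gt)
  have halves: "U - A = ?N \<union> ?P"
    using A_iff by (auto simp: D_def linorder_neq_iff)
  then have halves': "U - A = ?P \<union> ?N" by blast
  have "isCont g t"
    using arc_imp_path[OF g(1)] g(2,3) unfolding path_def
    by (intro continuous_on_interior[of "{0..1}"]) auto
  then have "\<forall>\<^sub>F s in at t. g s \<in> U"
    using \<open>open U\<close> \<open>g t \<in> U\<close> topological_tendstoD[of g "g t" "at t" U] by (auto simp: isCont_def)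
  then obtain d where d: "d > 0" "\<And>s. dist s t < d \<Longrightarrow> g s \<in> U"
    using \<open>g t \<in> U\<close> unfolding eventually_at by (metis UNIV_I)
  obtain e where "0 < e" "e < min d (min t (1 - t))"
    using d(1) g(2,3) dense[of 0 "min d (min t (1 - t))"] by auto
  then have e: "e > 0" "e < d" "e < t" "t + e < 1" by auto
  let ?I = "{t - e..t + e}"
  have gU: "g s \<in> U" if "s \<in> ?I" for s
    using that e by (intro d) (auto simp: dist_real_def)
  have I01: "?I \<subseteq> {0..1}" using e by auto
  define f where "f s = Im (h (g s))" for s
  have "continuous_on ?I (h \<circ> g)"
  proof (rule continuous_on_compose)
    show "continuous_on ?I g"
      using arc_imp_path[OF g(1)] I01 by (auto simp: path_def elim: continuous_on_subset)
    show "continuous_on (g ` ?I) h"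
      using gU by (intro continuous_on_subset[OF conth]) (auto simp: U_def)
  qed
  then have cont: "continuous_on ?I f"
    unfolding f_def by (auto intro!: continuous_intros simp: comp_def)
  have Re0: "Re (h (g s)) = 0" if "s \<in> ?I" for s
  proof -
    have "g s \<in> path_image g \<inter> U0" using that I01 gU by (auto simp: path_image_def U_def)
    then show ?thesis using hB by blast
  qed
  \<comment> \<open>The real part in the chart is 0 along the curve, so the imaginary part alone
    determines the point.\<close>
  have inj: "inj_on f ?I"
  proof (rule inj_onI)
    fix x y assume xy: "x \<in> ?I" "y \<in> ?I" "f x = f y"
    then have "h (g x) = h (g y)"
      using Re0 by (simp add: f_def complex_eq_iff)
    then have "g x = g y" using hh gU xy by (metis IntD1 U_def)
    then show "x = y" using g(1) xy I01 by (auto simp: arc_def inj_on_def)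
  qed
  have ft: "f t = 0" by (simp add: f_def h0)
  have mono: "f x < 0 \<and> 0 < f y \<or> f y < 0 \<and> 0 < f x" if "t - e \<le> x" "x < t" "t < y" "y \<le> t + e" for x y
    using continuous_inj_imp_mono[of x t y f] that ft
      continuous_on_subset[OF cont, of "{x..y}"] inj_on_subset[OF inj, of "{x..y}"] by auto
  have ev: "\<forall>\<^sub>F s in at_left t. s \<in> {t - e<..<t}" "\<forall>\<^sub>F s in at_right t. s \<in> {t<..<t + e}"
    using e by (auto intro!: eventually_at_leftI eventually_at_rightI simp del: greaterThanLessThan_iff)
  have inD: "g s \<in> D X \<longleftrightarrow> h (g s) \<in> X" if "s \<in> ?I" for s X
    using gU[OF that] by (auto simp: D_def)
  show ?thesis
  \<comment> \<open>The chart may send the curve upwards or downwards, so the two halves exchange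
    their roles between the cases.\<close>
  proof (cases "f (t + e) > 0")
    case True
    have "f s < 0" if "s \<in> {t - e<..<t}" for s
      using mono[of s "t + e"] True e that by auto
    moreover have "f s > 0" if "s \<in> {t<..<t + e}" for s
      using mono[of "t - e" s] mono[of "t - e" "t + e"] True e that by auto
    ultimately have l: "\<And>s. s \<in> {t - e<..<t} \<Longrightarrow> g s \<in> ?N"
      and r: "\<And>s. s \<in> {t<..<t + e} \<Longrightarrow> g s \<in> ?P"
      using inD by (simp_all add: f_def)
    show ?thesis
      by (rule that[OF \<open>open U\<close> \<open>g t \<in> U\<close> UW conn2 halves
            eventually_mono[OF ev(1) l] eventually_mono[OF ev(2) r]])
  next
    case False
    have "f s > 0" if "s \<in> {t - e<..<t}" for s
      using mono[of s "t + e"] False e that by auto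
    moreover have "f s < 0" if "s \<in> {t<..<t + e}" for s
      using mono[of "t - e" s] mono[of "t - e" "t + e"] False e that by auto
    ultimately have l: "\<And>s. s \<in> {t - e<..<t} \<Longrightarrow> g s \<in> ?P"
      and r: "\<And>s. s \<in> {t<..<t + e} \<Longrightarrow> g s \<in> ?N"
      using inD by (simp_all add: f_def)
    show ?thesis
      by (rule that[OF \<open>open U\<close> \<open>g t \<in> U\<close> UW conn2(2,1) halves'
            eventually_mono[OF ev(1) l] eventually_mono[OF ev(2) r]])
  qed
qed

text \<open>Both sides accumulate at \<open>p\<close>, since \<open>J\<close> is the frontier of
  each. But \<open>U\<close> without \<open>J\<close> consists of only two connected pieces, each
  lying on a single side, so each side receives one of them.\<close>

lemma local_sides:
  assumes J: "jordan_sides J S T" and U: "open U" "p \<in> U" "p \<in> J" "J \<inter> U = A \<inter> U"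
    and D: "U - A = D1 \<union> D2" "connected D1" "connected D2"
  shows "D1 \<noteq> {} \<and> D2 \<noteq> {} \<and> (D1 \<subseteq> S \<and> D2 \<subseteq> T \<or> D1 \<subseteq> T \<and> D2 \<subseteq> S)"
proof -
  have UJ: "U - J = D1 \<union> D2" using U D by blast
  then have "D1 \<inter> J = {}" "D2 \<inter> J = {}" by blast+
  then have D12: "D1 \<subseteq> S \<or> D1 \<subseteq> T" "D2 \<subseteq> S \<or> D2 \<subseteq> T"
    using connected_in_side[OF J D(2)] connected_in_side[OF J D(3)] by auto
  have "p \<in> closure S" "p \<in> closure T"
    using J U(3) by (auto simp: jordan_sides_def frontier_def)
  then have "U \<inter> S \<noteq> {}" "U \<inter> T \<noteq> {}"
    using U(1,2) open_Int_closure_eq_empty[OF U(1)] by blast+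
  then obtain x y where x: "x \<in> U" "x \<in> S" and y: "y \<in> U" "y \<in> T" by blast
  have disj: "S \<inter> J = {}" "T \<inter> J = {}" "S \<inter> T = {}"
    using J by (auto simp: jordan_sides_def)
  have xD: "x \<in> D1 \<union> D2" "y \<in> D1 \<union> D2" using x y UJ disj by blast+
  then have "\<not> (D1 \<union> D2 \<subseteq> S)" "\<not> (D1 \<union> D2 \<subseteq> T)" using x y disj(3) by blast+
  then show ?thesis using D12 by auto
qed

text \<open>The condition \<open>J \<union> W = A \<union> W\<close> says that \<open>J\<close> and
  \<open>A\<close> differ only inside \<open>W\<close>. Near the crossing \<open>J\<close> is
  therefore the curve \<open>A\<close>, and the two halves lie on different sides of
  \<open>J\<close>.\<close>

lemma crossing_switches_side:
  assumes J: "jordan_sides J S T"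
    and cross: "crosses_transversally_at A (path_image g) (g t)"
    and g: "arc g" "0 < t" "t < 1" "g t \<in> J" and W: "closed W" "g t \<notin> W" "J \<union> W = A \<union> W"
  shows "(\<forall>\<^sub>F s in at_left t. g s \<in> S) \<and> (\<forall>\<^sub>F s in at_right t. g s \<in> T) \<or>
    (\<forall>\<^sub>F s in at_left t. g s \<in> T) \<and> (\<forall>\<^sub>F s in at_right t. g s \<in> S)"
proof -
  obtain U D1 D2 where U: "open U" "g t \<in> U" "U \<inter> W = {}" and D: "connected D1" "connected D2"
    "U - A = D1 \<union> D2" and ev: "\<forall>\<^sub>F s in at_left t. g s \<in> D1" "\<forall>\<^sub>F s in at_right t. g s \<in> D2"
    using crossing_halves[OF cross g(1-3) W(1,2)] .
  have "J \<inter> U = A \<inter> U" using U(3) W(3) by blast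
  then consider "D1 \<subseteq> S" "D2 \<subseteq> T" | "D1 \<subseteq> T" "D2 \<subseteq> S"
    using local_sides[OF J U(1,2) g(4) _ D(3,1,2)] by blast
  then show ?thesis
  proof cases
    case 1
    then have "\<forall>\<^sub>F s in at_left t. g s \<in> S" "\<forall>\<^sub>F s in at_right t. g s \<in> T"
      by (auto intro: eventually_mono[OF ev(1)] eventually_mono[OF ev(2)])
    then show ?thesis by simp
  next
    case 2
    then have "\<forall>\<^sub>F s in at_left t. g s \<in> T" "\<forall>\<^sub>F s in at_right t. g s \<in> S"
      by (auto intro: eventually_mono[OF ev(1)] eventually_mono[OF ev(2)])
    then show ?thesis by simp
  qed
qed

text \<open>
  \<open>J\<close> is a part of \<open>C\<close> together with a chord in \<open>S\<close>. The other side \<open>T\<close> of \<open>C\<close> and the rest of \<open>C\<close>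
  lie on one side of \<open>J\<close>, so near \<open>u\<close> the chord \<open>K\<close> is on the opposite side, yet it ends at \<open>v\<close>.
\<close>

lemma chords_noncrossing:
  assumes C: "jordan_sides C S T" and J: "jordan_sides J P Q" and JT: "J \<inter> T = {}"
    and K: "connected (insert v K)" "K \<subseteq> S" "K \<inter> J = {}" "v \<in> C - J" "u \<in> closure K"
    and U: "open U" "u \<in> U" "u \<in> C" "u \<in> J" "C \<inter> U = A \<inter> U" "J \<inter> U = A \<inter> U"
    and D: "U - A = D1 \<union> D2" "connected D1" "connected D2"
  shows False
proof -
  \<comment> \<open>\<open>C\<close> is the frontier of \<open>T\<close>, so the end
    \<open>v\<close> of the chord can be added to \<open>T\<close> without losing connectedness. It
    links \<open>T\<close> to \<open>K\<close> outside \<open>J\<close>.\<close>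
  have "v \<in> closure T" using C K(4) by (auto simp: jordan_sides_def frontier_def)
  then have "connected (insert v T)"
    using C by (intro connected_intermediate_closure[of T "insert v T"])
      (auto simp: jordan_sides_def closure_subset)
  then have "connected (insert v T \<union> insert v K)"
    using K(1) by (intro connected_Un) auto
  then have *: "insert v T \<union> insert v K \<subseteq> P \<or> insert v T \<union> insert v K \<subseteq> Q"
    using JT K by (intro connected_in_side[OF J]) auto
  have "U \<inter> K \<noteq> {}"
    using K(5) U(1,2) open_Int_closure_eq_empty[OF U(1)] by blast
  then obtain z where z: "z \<in> U" "z \<in> K" by blast
  then have zD: "z \<in> D1 \<or> z \<in> D2" using D(1) U(6) K(3) by blast
  have "z \<in> S" using z K(2) by blast
  have disj: "S \<inter> T = {}" "P \<inter> Q = {}" using C J by (auto simp: jordan_sides_def)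
  have ne: "D1 \<noteq> {}" "D2 \<noteq> {}"
    and "D1 \<subseteq> S \<and> D2 \<subseteq> T \<or> D1 \<subseteq> T \<and> D2 \<subseteq> S"
    and sides: "D1 \<subseteq> P \<and> D2 \<subseteq> Q \<or> D1 \<subseteq> Q \<and> D2 \<subseteq> P"
    using local_sides[OF C U(1,2,3,5) D] local_sides[OF J U(1,2,4,6) D] by auto
  \<comment> \<open>Relative to \<open>C\<close>, the chord occupies the half in \<open>S\<close>
    and \<open>T\<close> contains the other half. Relative to \<open>J\<close> these halves are
    separated, although \<open>T\<close> and \<open>K\<close> were shown to lie on one side of
    it.\<close>
  then have C_sides: "z \<in> D1 \<and> D2 \<subseteq> T \<or> z \<in> D2 \<and> D1 \<subseteq> T"
    using zD \<open>z \<in> S\<close> disj(1) by blast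
  have disj': False if "x \<in> P" "x \<in> Q" for x using disj(2) that by blast
  obtain x y where xy: "x \<in> D1" "y \<in> D2" using ne by blast
  from C_sides show False
  proof
    assume "z \<in> D1 \<and> D2 \<subseteq> T"
    then have "z \<in> P \<and> y \<in> Q \<or> z \<in> Q \<and> y \<in> P" "y \<in> T" using sides xy by auto
    then show False using * z disj' by auto
  next
    assume "z \<in> D2 \<and> D1 \<subseteq> T"
    then have "z \<in> P \<and> x \<in> Q \<or> z \<in> Q \<and> x \<in> P" "x \<in> T" using sides xy by auto
    then show False using * z disj' by auto
  qed
qed

section \<open>The permutation of a meander\<close>

lemma horizontal_segment:
  assumes "Im p = Im q" "Re p \<le> Re q"
  shows "closed_segment p q = {z. Im z = Im p \<and> Re p \<le> Re z \<and> Re z \<le> Re q}"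
  unfolding closed_segment_same_Im[OF assms(1)] using assms(2)
  by (auto simp: closed_segment_eq_real_ivl)

lemma connected_insert_closure:
  assumes "connected K" "v \<in> closure K"
  shows "connected (insert v K)"
proof (rule connected_intermediate_closure[OF assms(1)])
  show "insert v K \<subseteq> closure K" using assms(2) closure_subset by auto
qed auto

lemma arc_eq_iff: "arc g \<Longrightarrow> s \<in> {0..1} \<Longrightarrow> t \<in> {0..1} \<Longrightarrow> g s = g t \<longleftrightarrow> s = t"
  by (auto simp: arc_def inj_on_def)

lemma arc_continuous_on: "arc g \<Longrightarrow> S \<subseteq> {0..1} \<Longrightarrow> continuous_on S g"
  by (auto simp: arc_def path_def elim: continuous_on_subset)

lemma connected_arc_image:
  assumes "arc g" "S \<subseteq> {0..1}" "connected S"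
  shows "connected (g ` S)"
  using assms by (intro connected_continuous_image arc_continuous_on) auto

lemma closed_arc_image:
  assumes "arc (g :: real \<Rightarrow> complex)" "S \<subseteq> {0..1}" "compact S"
  shows "closed (g ` S)"
  using assms by (intro compact_imp_closed compact_continuous_image arc_continuous_on) auto

lemma arc_image_subset: "S \<subseteq> {0..1} \<Longrightarrow> g ` S \<subseteq> path_image g"
  by (auto simp: path_image_def)

locale closed_meander =
  fixes n :: nat and a b c :: complex and \<gamma> \<alpha> \<beta> :: "real \<Rightarrow> complex"
  assumes n: "n > 0" and meander: "open_meander n a b \<gamma>"
    and \<alpha>: "arc \<alpha>" "\<alpha> 0 = b" "\<alpha> 1 = \<gamma> 0"
    and \<beta>: "arc \<beta>" "\<beta> 0 = \<gamma> 1" "\<beta> 1 = a"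
    and \<alpha>_Int: "path_image \<alpha> \<inter> (closed_segment a b \<union> path_image \<gamma>) = {b, \<gamma> 0}"
    and \<beta>_Int: "path_image \<beta> \<inter> (closed_segment a b \<union> path_image \<gamma>) = {\<gamma> 1, a}"
    and c: "path_image \<alpha> \<inter> path_image \<beta> = {c}"
    and c_cross: "crosses_transversally_at (path_image \<alpha>) (path_image \<beta>) c"
begin

abbreviation "L \<equiv> closed_segment a b"

abbreviation "N \<equiv> 2 * n"

definition time :: "nat \<Rightarrow> real" where
  "time k = sorted_list_of_set (crossing_times a b \<gamma>) ! (k - 1)"

definition point :: "nat \<Rightarrow> complex" where
  "point k = \<gamma> (time k)"

definition perm :: "nat \<Rightarrow> nat" where
  "perm = (meandric_permutation a b \<gamma>)(0 := 0)"

lemma \<gamma>: "arc \<gamma>" "\<gamma> 0 \<notin> L" "\<gamma> 1 \<notin> L" "a \<notin> path_image \<gamma>" "b \<notin> path_image \<gamma>"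
  and ab: "Im a = Im b" "Re a < Re b"
  and crossings: "finite (crossings a b \<gamma>)" "card (crossings a b \<gamma>) = N"
  and transversal: "z \<in> crossings a b \<gamma> \<Longrightarrow> crosses_transversally_at L (path_image \<gamma>) z"
  using meander by (auto simp: open_meander_def pathstart_def pathfinish_def)

lemma L_eq: "L = {z. Im z = Im a \<and> Re a \<le> Re z \<and> Re z \<le> Re b}"
  using ab by (intro horizontal_segment) auto

lemma times: "finite (crossing_times a b \<gamma>)" "card (crossing_times a b \<gamma>) = N"
  using bij_betw_crossing_times[OF meander] crossings
  by (auto simp: bij_betw_finite bij_betw_same_card)

lemma time_image: "crossing_times a b \<gamma> = time ` {1..N}"
proof -
  let ?ts = "sorted_list_of_set (crossing_times a b \<gamma>)"
  have len: "length ?ts = N" and set: "set ?ts = crossing_times a b \<gamma>"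
    using times by auto
  show ?thesis
  proof
    show "crossing_times a b \<gamma> \<subseteq> time ` {1..N}"
    proof
      fix t assume "t \<in> crossing_times a b \<gamma>"
      then obtain i where "i < N" "t = ?ts ! i"
        using len set by (metis in_set_conv_nth)
      then show "t \<in> time ` {1..N}"
        by (intro image_eqI[of _ _ "Suc i"]) (auto simp: time_def)
    qed
    have "?ts ! (k - 1) \<in> set ?ts" if "k \<in> {1..N}" for k
      using that len by (intro nth_mem) auto
    then show "time ` {1..N} \<subseteq> crossing_times a b \<gamma>"
      unfolding set by (auto simp: time_def)
  qed
qed

lemma time_less: "1 \<le> i \<Longrightarrow> i < j \<Longrightarrow> j \<le> N \<Longrightarrow> time i < time j"
  unfolding time_def using times
  by (intro sorted_wrt_nth_less[OF strict_sorted_list_of_set]) auto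

lemma time_mem: "1 \<le> k \<Longrightarrow> k \<le> N \<Longrightarrow> time k \<in> crossing_times a b \<gamma>"
  using time_image by auto

lemma time_in: "1 \<le> k \<Longrightarrow> k \<le> N \<Longrightarrow> 0 < time k \<and> time k < 1"
  using time_mem[of k] \<gamma> by (auto simp: crossing_times_def less_le)

lemma mem_L_iff: "s \<in> {0..1} \<Longrightarrow> \<gamma> s \<in> L \<longleftrightarrow> s \<in> time ` {1..N}"
  using time_image by (auto simp: crossing_times_def)

lemma time_between:
  assumes "1 \<le> k" "k \<le> N" "1 \<le> j" "j < N" "time j \<le> time k" "time k \<le> time (Suc j)"
  shows "k = j \<or> k = Suc j"
  using time_less[of k j] time_less[of "Suc j" k] assms by (cases "k < j"; cases "Suc j < k") auto

lemma point_in: "1 \<le> k \<Longrightarrow> k \<le> N \<Longrightarrow> point k \<in> crossings a b \<gamma>"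
  using time_mem[of k] by (auto simp: point_def crossing_times_def crossings_def path_image_def)

lemma point_in_L: "1 \<le> k \<Longrightarrow> k \<le> N \<Longrightarrow> point k \<in> L" "1 \<le> k \<Longrightarrow> k \<le> N \<Longrightarrow> point k \<in> path_image \<gamma>"
  using point_in[of k] by (auto simp: crossings_def)

lemma Im_point: "1 \<le> k \<Longrightarrow> k \<le> N \<Longrightarrow> Im (point k) = Im a"
  using point_in_L(1)[of k] L_eq by auto

lemma Re_point:
  assumes "1 \<le> k" "k \<le> N"
  shows "Re a < Re (point k)" "Re (point k) < Re b"
proof -
  have "point k \<noteq> a" "point k \<noteq> b" using point_in_L(2)[OF assms] \<gamma> by auto
  then show "Re a < Re (point k)" "Re (point k) < Re b"
    using point_in_L(1)[OF assms] ab L_eq by (auto simp: complex_eq_iff less_le)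
qed

text \<open>A label counts the crossings that are not further right. This turns comparisons of
  labels into statements about positions on the line.\<close>

lemma perm_less_iff:
  assumes "1 \<le> i" "i \<le> N" "1 \<le> j" "j \<le> N"
  shows "perm i < perm j \<longleftrightarrow> Re (point i) < Re (point j)"
proof -
  have perm: "perm k = label a b \<gamma> (point k)" if "1 \<le> k" for k
    using that by (simp add: perm_def meandric_permutation_def point_def time_def)
  have mono: "label a b \<gamma> p \<le> label a b \<gamma> q" if "Re p \<le> Re q" for p q
    unfolding label_def using that crossings by (intro card_mono) auto
  have "label a b \<gamma> (point i) < label a b \<gamma> (point j)" if "Re (point i) < Re (point j)"
    unfolding label_def
  proof (rule psubset_card_mono)
    have "point j \<in> {q \<in> crossings a b \<gamma>. Re q \<le> Re (point j)}"
      "point j \<notin> {q \<in> crossings a b \<gamma>. Re q \<le> Re (point i)}"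
      using that point_in[OF assms(3,4)] by auto
    then show "{q \<in> crossings a b \<gamma>. Re q \<le> Re (point i)} \<subset> {q \<in> crossings a b \<gamma>. Re q \<le> Re (point j)}"
      using that by fastforce
  qed (use crossings in simp)
  then show ?thesis
    using mono[of "point j" "point i"] perm assms by force
qed

lemma perm_bij: "bij_betw perm {..N} {..N}"
proof -
  have "bij_betw perm {1..N} {1..N}"
    using meandric_permutation_bij[OF meander]
    by (rule bij_betw_cong[THEN iffD1, rotated]) (auto simp: perm_def)
  moreover have "bij_betw perm {0} {0}" by (simp add: perm_def)
  ultimately have "bij_betw perm ({0} \<union> {1..N}) ({0} \<union> {1..N})"
    by (intro bij_betw_combine) auto
  moreover have "{0} \<union> {1..N} = {..N}" by auto
  ultimately show ?thesis by simp
qed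

lemma perm_0: "perm 0 = 0"
  by (simp add: perm_def)

section \<open>The closing arcs and the crossing 0\<close>

lemma mem_simps: "s \<in> {0..1} \<Longrightarrow> \<gamma> s \<in> path_image \<gamma>" "s \<in> {0..1} \<Longrightarrow> \<alpha> s \<in> path_image \<alpha>"
  "s \<in> {0..1} \<Longrightarrow> \<beta> s \<in> path_image \<beta>"
  by (auto simp: path_image_def)

lemma ends_distinct: "\<gamma> 0 \<noteq> \<gamma> 1" "a \<noteq> b" "\<gamma> 0 \<noteq> a" "\<gamma> 0 \<noteq> b" "\<gamma> 1 \<noteq> a" "\<gamma> 1 \<noteq> b"
  using \<gamma> ab arc_eq_iff[OF \<gamma>(1), of 0 1] by auto

lemma \<alpha>_meets: "s \<in> {0..1} \<Longrightarrow> \<alpha> s \<in> L \<longleftrightarrow> s = 0" "s \<in> {0..1} \<Longrightarrow> \<alpha> s \<in> path_image \<gamma> \<longleftrightarrow> s = 1"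
proof -
  assume s: "s \<in> {0..1}"
  have "s = 0 \<or> s = 1" if "\<alpha> s \<in> L \<union> path_image \<gamma>"
  proof -
    have "\<alpha> s \<in> {b, \<gamma> 0}" unfolding \<alpha>_Int[symmetric] using that mem_simps(2)[OF s] by simp
    then have "\<alpha> s = \<alpha> 0 \<or> \<alpha> s = \<alpha> 1" by (simp add: \<alpha>)
    then show ?thesis using arc_eq_iff[OF \<alpha>(1) s, of 0] arc_eq_iff[OF \<alpha>(1) s, of 1] by auto
  qed
  moreover have "b \<in> L" "\<gamma> 0 \<in> path_image \<gamma>" by (auto simp: path_image_def)
  ultimately show "\<alpha> s \<in> L \<longleftrightarrow> s = 0" "\<alpha> s \<in> path_image \<gamma> \<longleftrightarrow> s = 1"
    using \<alpha>(2,3) \<gamma> by auto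
qed

lemma \<beta>_meets: "s \<in> {0..1} \<Longrightarrow> \<beta> s \<in> L \<longleftrightarrow> s = 1" "s \<in> {0..1} \<Longrightarrow> \<beta> s \<in> path_image \<gamma> \<longleftrightarrow> s = 0"
proof -
  assume s: "s \<in> {0..1}"
  have "s = 0 \<or> s = 1" if "\<beta> s \<in> L \<union> path_image \<gamma>"
  proof -
    have "\<beta> s \<in> {\<gamma> 1, a}" unfolding \<beta>_Int[symmetric] using that mem_simps(3)[OF s] by simp
    then have "\<beta> s = \<beta> 0 \<or> \<beta> s = \<beta> 1" by (simp add: \<beta>)
    then show ?thesis using arc_eq_iff[OF \<beta>(1) s, of 0] arc_eq_iff[OF \<beta>(1) s, of 1] by auto
  qed
  moreover have "a \<in> L" "\<gamma> 1 \<in> path_image \<gamma>" by (auto simp: path_image_def)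
  ultimately show "\<beta> s \<in> L \<longleftrightarrow> s = 1" "\<beta> s \<in> path_image \<gamma> \<longleftrightarrow> s = 0"
    using \<beta>(2,3) \<gamma> by auto
qed

definition tc :: real where "tc = (SOME s. s \<in> {0..1} \<and> \<alpha> s = c)"
definition uc :: real where "uc = (SOME s. s \<in> {0..1} \<and> \<beta> s = c)"

text \<open>Otherwise \<open>c\<close> would belong to the contact sets of both closing arcs,
  \<open>{b, \<gamma> 0}\<close> and \<open>{\<gamma> 1, a}\<close>, which are disjoint.\<close>

lemma c_notin: "c \<notin> L" "c \<notin> path_image \<gamma>"
proof -
  have "c \<in> {b, \<gamma> 0} \<inter> {\<gamma> 1, a}" if "c \<in> L \<union> path_image \<gamma>"
    using that c unfolding \<alpha>_Int[symmetric] \<beta>_Int[symmetric] by blast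
  then show "c \<notin> L" "c \<notin> path_image \<gamma>" using ends_distinct by auto
qed

lemma tc: "\<alpha> tc = c" "0 < tc" "tc < 1" and uc: "\<beta> uc = c" "0 < uc" "uc < 1"
proof -
  have "c \<in> path_image \<alpha>" "c \<in> path_image \<beta>" using c by blast+
  then have ex: "\<exists>s. s \<in> {0..1} \<and> \<alpha> s = c" "\<exists>s. s \<in> {0..1} \<and> \<beta> s = c"
    unfolding path_image_def by (elim imageE, metis)+
  have "tc \<in> {0..1}" "\<alpha> tc = c" "uc \<in> {0..1}" "\<beta> uc = c"
    using someI_ex[OF ex(1)] someI_ex[OF ex(2)] unfolding tc_def uc_def by auto
  moreover from this have "tc \<noteq> 0" "tc \<noteq> 1" "uc \<noteq> 0" "uc \<noteq> 1"
    using \<alpha>_meets[of tc] \<beta>_meets[of uc] c_notin by auto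
  ultimately show "\<alpha> tc = c" "0 < tc" "tc < 1" "\<beta> uc = c" "0 < uc" "uc < 1" by auto
qed

lemma \<alpha>_eq_\<beta>: "s \<in> {0..1} \<Longrightarrow> t \<in> {0..1} \<Longrightarrow> \<alpha> s = \<beta> t \<Longrightarrow> s = tc \<and> t = uc"
proof -
  assume st: "s \<in> {0..1}" "t \<in> {0..1}" "\<alpha> s = \<beta> t"
  then have "\<alpha> s = \<alpha> tc" "\<beta> t = \<beta> uc"
    using c mem_simps(2)[of s] mem_simps(3)[of t] tc uc by auto
  then show ?thesis
    using arc_eq_iff[OF \<alpha>(1), of s tc] arc_eq_iff[OF \<beta>(1), of t uc] st tc uc by auto
qed

text \<open>The pieces of the closing arcs between the ends of \<open>L\<close> and
  \<open>c\<close>. The remaining pieces, between \<open>c\<close> and the ends of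
  \<open>\<gamma>\<close>, are assigned to the strands 0 and \<open>N\<close>.\<close>

definition W :: "complex set" where "W = \<alpha> ` {0..tc} \<union> \<beta> ` {uc..1}"

abbreviation "C \<equiv> L \<union> W"

lemma closed_W: "closed W"
  unfolding W_def using tc uc by (intro closed_Un closed_arc_image \<alpha> \<beta>) auto

lemma \<gamma>_notin_W: "s \<in> {0..1} \<Longrightarrow> \<gamma> s \<notin> W"
proof
  assume s: "s \<in> {0..1}" "\<gamma> s \<in> W"
  then consider t where "t \<in> {0..tc}" "\<gamma> s = \<alpha> t" | t where "t \<in> {uc..1}" "\<gamma> s = \<beta> t"
    by (auto simp: W_def)
  then show False
    using \<alpha>_meets(2) \<beta>_meets(2) mem_simps(1)[OF s(1)] tc uc by cases auto
qed

lemma \<gamma>_in_C_iff: "s \<in> {0..1} \<Longrightarrow> \<gamma> s \<in> C \<longleftrightarrow> s \<in> time ` {1..N}"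
  using \<gamma>_notin_W mem_L_iff by auto

lemma \<alpha>_notin_C: "tc < s \<Longrightarrow> s \<le> 1 \<Longrightarrow> \<alpha> s \<notin> C"
proof
  assume s: "tc < s" "s \<le> 1" "\<alpha> s \<in> C"
  then have s01: "s \<in> {0..1}" using tc by auto
  consider "\<alpha> s \<in> L" | t where "t \<in> {0..tc}" "\<alpha> s = \<alpha> t" | t where "t \<in> {uc..1}" "\<alpha> s = \<beta> t"
    using s(3) by (auto simp: W_def)
  then show False
  proof cases
    case 1 then show ?thesis using \<alpha>_meets(1)[OF s01] s tc by auto
  next
    case 2 then show ?thesis using arc_eq_iff[OF \<alpha>(1) s01, of t] s tc by auto
  next
    case 3 then show ?thesis using \<alpha>_eq_\<beta>[OF s01, of t] s uc by auto
  qed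
qed

lemma \<beta>_notin_C: "0 \<le> s \<Longrightarrow> s < uc \<Longrightarrow> \<beta> s \<notin> C"
proof
  assume s: "0 \<le> s" "s < uc" "\<beta> s \<in> C"
  then have s01: "s \<in> {0..1}" using uc by auto
  consider "\<beta> s \<in> L" | t where "t \<in> {0..tc}" "\<beta> s = \<alpha> t" | t where "t \<in> {uc..1}" "\<beta> s = \<beta> t"
    using s(3) by (auto simp: W_def)
  then show False
  proof cases
    case 1 then show ?thesis using \<beta>_meets(1)[OF s01] s uc by auto
  next
    case 2 then show ?thesis using \<alpha>_eq_\<beta>[OF _ s01, of t] s tc by auto
  next
    case 3 then show ?thesis using arc_eq_iff[OF \<beta>(1) s01, of t] s uc by auto
  qed
qed

lemma c_in_C: "c \<in> C"
  using tc by (auto simp: W_def intro!: image_eqI[of c \<alpha> tc])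

text \<open>As the closing arcs meet only at \<open>c\<close>, their two pieces join to an arc from
  \<open>b\<close> to \<open>a\<close>, and this arc touches \<open>L\<close> only at its
  ends.\<close>

lemma jordan_C: obtains S T where "jordan_sides C S T"
proof -
  let ?h = "subpath 0 tc \<alpha> +++ subpath uc 1 \<beta>"
  have images: "path_image (subpath 0 tc \<alpha>) = \<alpha> ` {0..tc}" "path_image (subpath uc 1 \<beta>) = \<beta> ` {uc..1}"
    using tc uc by (auto simp: path_image_subpath)
  have "arc ?h"
  proof (rule arc_join)
    show "arc (subpath 0 tc \<alpha>)" "arc (subpath uc 1 \<beta>)"
      using tc uc by (auto intro!: arc_subpath_arc \<alpha> \<beta>)
    show "pathfinish (subpath 0 tc \<alpha>) = pathstart (subpath uc 1 \<beta>)"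
      using tc uc by simp
    show "path_image (subpath 0 tc \<alpha>) \<inter> path_image (subpath uc 1 \<beta>) \<subseteq> {pathstart (subpath uc 1 \<beta>)}"
    proof
      fix z assume "z \<in> path_image (subpath 0 tc \<alpha>) \<inter> path_image (subpath uc 1 \<beta>)"
      then obtain s t where st: "s \<in> {0..tc}" "t \<in> {uc..1}" "z = \<alpha> s" "z = \<beta> t"
        unfolding images by blast
      then have "t = uc" using \<alpha>_eq_\<beta>[of s t] tc uc by auto
      then show "z \<in> {pathstart (subpath uc 1 \<beta>)}" using st by simp
    qed
  qed
  moreover have "path_image ?h = W"
    using tc uc by (subst path_image_join) (auto simp: images W_def)
  moreover have "L \<inter> W \<subseteq> {a, b}"
  proof
    fix z assume z: "z \<in> L \<inter> W"
    then consider s where "s \<in> {0..tc}" "z = \<alpha> s" | s where "s \<in> {uc..1}" "z = \<beta> s"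
      by (auto simp: W_def)
    then show "z \<in> {a, b}"
    proof cases
      case 1 then show ?thesis using z \<alpha>_meets(1)[of s] \<alpha>(2) tc by auto
    next
      case 2 then show ?thesis using z \<beta>_meets(1)[of s] \<beta>(3) uc by auto
    qed
  qed
  ultimately show ?thesis
    using jordan_sides_arcs[of "linepath a b" ?h] that ends_distinct \<alpha> \<beta> by auto
qed

text \<open>The strands 0 and \<open>N\<close> continue beyond the ends of \<open>\<gamma>\<close>
  along the closing arcs up to \<open>c\<close>, so that every strand runs from one point of
  \<open>C\<close> to another. The end points on \<open>C\<close> are left out, so that a strand
  lies on one side of \<open>C\<close>; they are recovered as limit points.\<close>

definition strand :: "nat \<Rightarrow> complex set" where
  "strand k = (if k = 0 then \<alpha> ` {tc<..1} \<union> \<gamma> ` {0..<time 1}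
     else if k = N then \<gamma> ` {time N<..1} \<union> \<beta> ` {0..<uc}
     else \<gamma> ` {time k<..<time (Suc k)})"

lemma strand_mid: "1 \<le> k \<Longrightarrow> k < N \<Longrightarrow> strand k = \<gamma> ` {time k<..<time (Suc k)}"
  by (simp add: strand_def)

lemma connected_strand:
  assumes "k \<le> N" shows "connected (strand k)"
proof -
  consider "k = 0" | "k = N" "k \<noteq> 0" | "1 \<le> k" "k < N" using assms by linarith
  then show ?thesis
  proof cases
    case 1
    have "connected (\<alpha> ` {tc<..1} \<union> \<gamma> ` {0..<time 1})"
    proof (rule connected_Un)
      show "connected (\<alpha> ` {tc<..1})" "connected (\<gamma> ` {0..<time 1})"
        using tc time_in[of 1] n by (auto intro!: connected_arc_image \<alpha> \<gamma>)
      have "\<gamma> 0 \<in> \<alpha> ` {tc<..1}" "\<gamma> 0 \<in> \<gamma> ` {0..<time 1}"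
        using tc \<alpha>(3) time_in[of 1] n by (auto intro!: image_eqI[of _ \<alpha> 1])
      then show "\<alpha> ` {tc<..1} \<inter> \<gamma> ` {0..<time 1} \<noteq> {}" by blast
    qed
    then show ?thesis by (simp add: strand_def 1)
  next
    case 2
    have "connected (\<gamma> ` {time N<..1} \<union> \<beta> ` {0..<uc})"
    proof (rule connected_Un)
      show "connected (\<gamma> ` {time N<..1})" "connected (\<beta> ` {0..<uc})"
        using uc time_in[of N] n by (auto intro!: connected_arc_image \<beta> \<gamma>)
      have "\<gamma> 1 \<in> \<gamma> ` {time N<..1}" "\<gamma> 1 \<in> \<beta> ` {0..<uc}"
        using uc \<beta>(2) time_in[of N] n by (auto intro!: image_eqI[of _ \<beta> 0])
      then show "\<gamma> ` {time N<..1} \<inter> \<beta> ` {0..<uc} \<noteq> {}" by blast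
    qed
    then show ?thesis using 2 n by (simp add: strand_def)
  next
    case 3
    then show ?thesis
      using time_in[of k] time_in[of "Suc k"] by (auto simp: strand_mid intro!: connected_arc_image \<gamma>)
  qed
qed

lemma \<gamma>_between_notin_C:
  assumes "s \<in> {0..1}" "\<And>k. 1 \<le> k \<Longrightarrow> k \<le> N \<Longrightarrow> s \<noteq> time k"
  shows "\<gamma> s \<notin> C"
proof
  assume "\<gamma> s \<in> C"
  then have "s \<in> time ` {1..N}" unfolding \<gamma>_in_C_iff[OF assms(1)] .
  then obtain k where "k \<in> {1..N}" "s = time k" by (rule imageE)
  then show False using assms(2)[of k] by simp
qed

lemma strand_Int_C:
  assumes "k \<le> N" shows "strand k \<inter> C = {}"
proof -
  consider "k = 0" | "k = N" "k \<noteq> 0" | "1 \<le> k" "k < N" using assms by linarith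
  then show ?thesis
  proof cases
    case 1
    have "\<gamma> s \<notin> C" if s: "s \<in> {0..<time 1}" for s
    proof (rule \<gamma>_between_notin_C)
      show "s \<in> {0..1}" using s time_in[of 1] n by auto
      fix k assume "1 \<le> k" "k \<le> N"
      then show "s \<noteq> time k" using time_less[of 1 k] s by (cases "k = 1") auto
    qed
    then show ?thesis using \<alpha>_notin_C 1 by (auto simp: strand_def)
  next
    case 2
    have "\<gamma> s \<notin> C" if s: "s \<in> {time N<..1}" for s
    proof (rule \<gamma>_between_notin_C)
      show "s \<in> {0..1}" using s time_in[of N] n by auto
      fix k assume "1 \<le> k" "k \<le> N"
      then show "s \<noteq> time k" using time_less[of k N] s by (cases "k = N") auto
    qed
    then show ?thesis using \<beta>_notin_C 2 by (auto simp: strand_def)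
  next
    case 3
    have "\<gamma> s \<notin> C" if s: "s \<in> {time k<..<time (Suc k)}" for s
    proof (rule \<gamma>_between_notin_C)
      show "s \<in> {0..1}" using s time_in[of k] time_in[of "Suc k"] 3 by auto
      fix l assume "1 \<le> l" "l \<le> N"
      then show "s \<noteq> time l" using time_between[of l k] 3 s by auto
    qed
    then show ?thesis using 3 by (auto simp: strand_mid)
  qed
qed

lemma strand_near_start:
  assumes "1 \<le> k" "k \<le> N" shows "\<forall>\<^sub>F s in at_right (time k). \<gamma> s \<in> strand k"
proof (cases "k = N")
  case True
  have "\<forall>\<^sub>F s in at_right (time N). s \<in> {time N<..<1}"
    using time_in[of N] n by (intro eventually_at_rightI[of _ 1]) auto
  then show ?thesis
    using True n by (auto simp: strand_def elim!: eventually_mono)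
next
  case False
  have "\<forall>\<^sub>F s in at_right (time k). s \<in> {time k<..<time (Suc k)}"
    using time_less[of k "Suc k"] assms False by (intro eventually_at_rightI[of _ "time (Suc k)"]) auto
  then show ?thesis
    using False assms by (auto simp: strand_mid elim!: eventually_mono)
qed

lemma strand_near_end:
  assumes "k < N" shows "\<forall>\<^sub>F s in at_left (time (Suc k)). \<gamma> s \<in> strand k"
proof (cases "k = 0")
  case True
  have "\<forall>\<^sub>F s in at_left (time 1). s \<in> {0<..<time 1}"
    using time_in[of 1] n by (intro eventually_at_leftI[of 0]) auto
  then show ?thesis
    using True by (auto simp: strand_def elim!: eventually_mono)
next
  case False
  have "\<forall>\<^sub>F s in at_left (time (Suc k)). s \<in> {time k<..<time (Suc k)}"
    using time_less[of k "Suc k"] assms False by (intro eventually_at_leftI[of "time k"]) auto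
  then show ?thesis
    using False assms by (auto simp: strand_mid elim!: eventually_mono)
qed

lemma \<gamma>_tendsto: "1 \<le> k \<Longrightarrow> k \<le> N \<Longrightarrow> (\<gamma> \<longlongrightarrow> point k) (at (time k))"
  using time_in[of k] arc_imp_path[OF \<gamma>(1)] continuous_on_interior[of "{0..1}" \<gamma> "time k"]
  by (auto simp: path_def point_def isCont_def)

lemma point_in_closure_strand:
  assumes "1 \<le> k" "k \<le> N" shows "point k \<in> closure (strand k)"
proof (rule Lim_in_closed_set[OF closed_closure])
  show "\<forall>\<^sub>F s in at_right (time k). \<gamma> s \<in> closure (strand k)"
    by (rule eventually_mono[OF strand_near_start[OF assms]]) (use closure_subset in auto)
  show "(\<gamma> \<longlongrightarrow> point k) (at_right (time k))"
    using \<gamma>_tendsto[OF assms] by (simp add: filterlim_at_split)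
qed auto

lemma Suc_point_in_closure_strand:
  assumes "k < N" shows "point (Suc k) \<in> closure (strand k)"
proof (rule Lim_in_closed_set[OF closed_closure])
  show "\<forall>\<^sub>F s in at_left (time (Suc k)). \<gamma> s \<in> closure (strand k)"
    by (rule eventually_mono[OF strand_near_end[OF assms]]) (use closure_subset in auto)
  show "(\<gamma> \<longlongrightarrow> point (Suc k)) (at_left (time (Suc k)))"
    using \<gamma>_tendsto[of "Suc k"] assms by (simp add: filterlim_at_split)
qed auto

lemma c_in_closure_strand: "c \<in> closure (strand 0)" "c \<in> closure (strand N)"
proof -
  have cont: "isCont \<alpha> tc" "isCont \<beta> uc"
    using arc_imp_path[OF \<alpha>(1)] arc_imp_path[OF \<beta>(1)] tc uc unfolding path_def
    by (auto intro!: continuous_on_interior[of "{0..1}"])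
  show "c \<in> closure (strand 0)"
  proof (rule Lim_in_closed_set[OF closed_closure])
    have "\<forall>\<^sub>F s in at_right tc. s \<in> {tc<..<1}"
      using tc by (intro eventually_at_rightI[of _ 1]) auto
    then show "\<forall>\<^sub>F s in at_right tc. \<alpha> s \<in> closure (strand 0)"
    proof (rule eventually_mono)
      fix s assume "s \<in> {tc<..<1}"
      then have "\<alpha> s \<in> strand 0" by (simp add: strand_def)
      then show "\<alpha> s \<in> closure (strand 0)" using closure_subset by blast
    qed
    show "(\<alpha> \<longlongrightarrow> c) (at_right tc)"
      using cont(1) tc by (simp add: isCont_def filterlim_at_split)
  qed auto
  show "c \<in> closure (strand N)"
  proof (rule Lim_in_closed_set[OF closed_closure])
    have "\<forall>\<^sub>F s in at_left uc. s \<in> {0<..<uc}"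
      using uc by (intro eventually_at_leftI[of 0]) auto
    then show "\<forall>\<^sub>F s in at_left uc. \<beta> s \<in> closure (strand N)"
    proof (rule eventually_mono)
      fix s assume "s \<in> {0<..<uc}"
      then have "\<beta> s \<in> strand N" using n by (simp add: strand_def)
      then show "\<beta> s \<in> closure (strand N)" using closure_subset by blast
    qed
    show "(\<beta> \<longlongrightarrow> c) (at_left uc)"
      using cont(2) uc by (simp add: isCont_def filterlim_at_split)
  qed auto
qed

text \<open>At the crossing between the two strands \<open>\<gamma>\<close> changes the side of
  \<open>C\<close>, because \<open>C\<close> and \<open>L\<close> differ only in the closed set
  \<open>W\<close>, which \<open>\<gamma>\<close> does not meet. The incoming end lies on the strand
  \<open>k\<close>, so it is the outgoing end that lies in \<open>T\<close>.\<close>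

lemma strands_alternate:
  assumes J: "jordan_sides C S T" and k: "k < N" "strand k \<subseteq> S"
  shows "strand (Suc k) \<subseteq> T"
proof -
  let ?t = "time (Suc k)"
  have disj: "S \<inter> T = {}" using J by (auto simp: jordan_sides_def)
  have pt: "\<gamma> ?t = point (Suc k)" by (simp add: point_def)
  have "?t \<in> {0..1}" using time_in[of "Suc k"] k by auto
  then have "crosses_transversally_at L (path_image \<gamma>) (\<gamma> ?t)" "\<gamma> ?t \<in> C" "\<gamma> ?t \<notin> W"
    using transversal[OF point_in, of "Suc k"] point_in_L[of "Suc k"] k \<gamma>_notin_W[of ?t]
    by (auto simp: pt)
  then consider "\<forall>\<^sub>F s in at_left ?t. \<gamma> s \<in> T" | "\<forall>\<^sub>F s in at_right ?t. \<gamma> s \<in> T"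
    using crossing_switches_side[OF J, of L \<gamma> ?t W] \<gamma>(1) time_in[of "Suc k"] k closed_W by auto
  then show ?thesis
  proof cases
    case 1
    have "\<exists>s. \<gamma> s \<in> T \<and> \<gamma> s \<in> strand k"
      using eventually_happens'[OF _ eventually_conj[OF 1 strand_near_end[OF k(1)]]] by simp
    then show ?thesis using k(2) disj by auto
  next
    case 2
    have "\<exists>s. \<gamma> s \<in> T \<and> \<gamma> s \<in> strand (Suc k)"
      using eventually_happens'[OF _ eventually_conj[OF 2 strand_near_start[of "Suc k"]]] k by simp
    then have "\<not> strand (Suc k) \<subseteq> S" using disj by auto
    then show ?thesis
      using connected_in_side[OF J connected_strand strand_Int_C, of "Suc k"] k(1) by auto
  qed
qed

lemma strand_sides:
  obtains S T where "jordan_sides C S T" "\<And>k. k \<le> N \<Longrightarrow> strand k \<subseteq> (if even k then S else T)"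
proof -
  obtain S T where "jordan_sides C S T" "strand 0 \<subseteq> S"
    using jordan_C connected_in_side[OF _ connected_strand strand_Int_C, of _ _ 0] jordan_sides_commute
    by (metis le0)
  note ST = this
  have "strand k \<subseteq> (if even k then S else T)" if "k \<le> N" for k
    using that
  proof (induction k)
    case (Suc k)
    then show ?case
      using strands_alternate[OF ST(1), of k] strands_alternate[OF jordan_sides_commute[OF ST(1)], of k]
      by (auto split: if_splits)
  qed (use ST in simp)
  then show ?thesis using that ST by blast
qed

lemma time_mono: "1 \<le> i \<Longrightarrow> i \<le> j \<Longrightarrow> j \<le> N \<Longrightarrow> time i \<le> time j"
  using time_less[of i j] by (cases "i = j") auto

lemma disjoint_mono: "A \<subseteq> B \<Longrightarrow> B \<inter> D = {} \<Longrightarrow> A \<inter> D = {}"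
  by blast

lemma image_disjointI: "(\<And>s. s \<in> A \<Longrightarrow> f s \<notin> B) \<Longrightarrow> f ` A \<inter> B = {}"
  by blast

lemma strand_Int_arch:
  assumes "i \<le> N" "1 \<le> j" "j < N" "i \<noteq> j"
  shows "strand i \<inter> \<gamma> ` {time j..time (Suc j)} = {}"
proof -
  have t: "0 < time j" "time (Suc j) < 1" using time_in[of j] time_in[of "Suc j"] assms by auto
  have far: "\<gamma> s \<notin> \<gamma> ` {time j..time (Suc j)}" if "s \<in> {0..1}" "s < time j \<or> time (Suc j) < s" for s
  proof
    assume "\<gamma> s \<in> \<gamma> ` {time j..time (Suc j)}"
    then obtain x where "x \<in> {time j..time (Suc j)}" "\<gamma> s = \<gamma> x" by (rule imageE)
    then show False using arc_eq_iff[OF \<gamma>(1) that(1), of x] that(2) t by auto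
  qed
  consider "i = 0" | "i = N" "i \<noteq> 0" | "1 \<le> i" "i < N" using assms by linarith
  then show ?thesis
  proof cases
    case 1
    have *: "\<gamma> s \<notin> \<gamma> ` {time j..time (Suc j)}" if "s \<in> {0..<time 1}" for s
      using that time_mono[of 1 j] time_in[of 1] assms by (intro far) auto
    have **: "\<alpha> s \<notin> \<gamma> ` {time j..time (Suc j)}" if "s \<in> {tc<..1}" for s
    proof
      assume *: "\<alpha> s \<in> \<gamma> ` {time j..time (Suc j)}"
      then have "\<alpha> s \<in> path_image \<gamma>" using t by (auto simp: path_image_def)
      then have "s = 1" using \<alpha>_meets(2)[of s] that tc by auto
      then show False using far[of 0] * \<alpha>(3) t by auto
    qed
    have "strand i = \<alpha> ` {tc<..1} \<union> \<gamma> ` {0..<time 1}" using 1 by (simp add: strand_def)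
    then show ?thesis
      by (simp only: Int_Un_distrib2 image_disjointI[OF *] image_disjointI[OF **] Un_empty_left)
  next
    case 2
    have *: "\<gamma> s \<notin> \<gamma> ` {time j..time (Suc j)}" if "s \<in> {time N<..1}" for s
      using that time_mono[of "Suc j" N] time_in[of N] assms by (intro far) auto
    have **: "\<beta> s \<notin> \<gamma> ` {time j..time (Suc j)}" if "s \<in> {0..<uc}" for s
    proof
      assume *: "\<beta> s \<in> \<gamma> ` {time j..time (Suc j)}"
      then have "\<beta> s \<in> path_image \<gamma>" using t by (auto simp: path_image_def)
      then have "s = 0" using \<beta>_meets(2)[of s] that uc by auto
      then show False using far[of 1] * \<beta>(2) t by auto
    qed
    have "strand i = \<gamma> ` {time N<..1} \<union> \<beta> ` {0..<uc}" using 2 by (simp add: strand_def)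
    then show ?thesis
      by (simp only: Int_Un_distrib2 image_disjointI[OF *] image_disjointI[OF **] Un_empty_left)
  next
    case 3
    have "\<gamma> s \<notin> \<gamma> ` {time j..time (Suc j)}" if "s \<in> {time i<..<time (Suc i)}" for s
    proof (rule far)
      show "s \<in> {0..1}" using that time_in[of i] time_in[of "Suc i"] 3 by auto
      show "s < time j \<or> time (Suc j) < s"
        using that time_mono[of "Suc i" j] time_mono[of "Suc j" i] 3 assms by (cases "i < j") auto
    qed
    then show ?thesis unfolding strand_mid[OF 3] by (rule image_disjointI)
  qed
qed

section \<open>Crossings enclosed by an arch\<close>

abbreviation "base j \<equiv> closed_segment (point j) (point (Suc j))"

abbreviation "arch j \<equiv> \<gamma> ` {time j..time (Suc j)}"

lemma mem_base_iff:
  assumes "1 \<le> j" "j < N"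
  shows "z \<in> base j \<longleftrightarrow> Im z = Im a \<and>
    min (Re (point j)) (Re (point (Suc j))) \<le> Re z \<and> Re z \<le> max (Re (point j)) (Re (point (Suc j)))"
  using Im_point[of j] Im_point[of "Suc j"] assms
  by (subst closed_segment_same_Im) (auto simp: closed_segment_eq_real_ivl)

lemma base_subset: "1 \<le> j \<Longrightarrow> j < N \<Longrightarrow> base j \<subseteq> L"
  by (intro closed_segment_subset point_in_L convex_closed_segment) auto

lemma Re_point_eq_iff:
  assumes "1 \<le> i" "i \<le> N" "1 \<le> j" "j \<le> N"
  shows "Re (point i) = Re (point j) \<longleftrightarrow> i = j"
proof
  assume "Re (point i) = Re (point j)"
  then have "perm i = perm j"
    using perm_less_iff[OF assms] perm_less_iff[OF assms(3,4,1,2)] by simp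
  then show "i = j" using perm_eq_iff[OF perm_bij perm_0, of i j] assms by simp
qed simp

lemma point_in_base_iff:
  assumes "1 \<le> j" "j < N" "1 \<le> k" "k \<le> N" "k \<noteq> j" "k \<noteq> Suc j"
  shows "point k \<in> base j \<longleftrightarrow> (perm j < perm k) \<noteq> (perm (Suc j) < perm k)"
  using perm_less_iff[of j k] perm_less_iff[of "Suc j" k] Im_point[of k] assms
    Re_point_eq_iff[of k j] Re_point_eq_iff[of k "Suc j"]
  by (auto simp: mem_base_iff)

lemma arch_Int_L:
  assumes "1 \<le> j" "j < N" shows "arch j \<inter> C \<subseteq> {point j, point (Suc j)}"
proof
  fix z assume "z \<in> arch j \<inter> C"
  then obtain s where s: "s \<in> {time j..time (Suc j)}" "z = \<gamma> s" "\<gamma> s \<in> C" by blast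
  then have "s \<in> {0..1}" using time_in[of j] time_in[of "Suc j"] assms by auto
  then have "s \<in> time ` {1..N}" using \<gamma>_in_C_iff s(3) by blast
  then obtain k where "k \<in> {1..N}" "s = time k" by (rule imageE)
  then show "z \<in> {point j, point (Suc j)}"
    using time_between[of k j] s assms by (auto simp: point_def)
qed

lemma jordan_arch:
  assumes "1 \<le> j" "j < N"
  obtains P Q where "jordan_sides (base j \<union> arch j) P Q"
proof -
  let ?h = "subpath (time (Suc j)) (time j) \<gamma>"
  have t: "0 < time j" "time j < time (Suc j)" "time (Suc j) < 1"
    using time_in[of j] time_in[of "Suc j"] time_less[of j "Suc j"] assms by auto
  have im: "path_image ?h = arch j" using t by (simp add: path_image_subpath)
  have "base j \<inter> arch j \<subseteq> {point j, point (Suc j)}"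
    using arch_Int_L[OF assms] base_subset[OF assms] by blast
  moreover have "arc ?h" using t by (intro arc_subpath_arc \<gamma>) auto
  moreover have "point j \<noteq> point (Suc j)"
    using t arc_eq_iff[OF \<gamma>(1), of "time j" "time (Suc j)"] by (auto simp: point_def)
  ultimately show ?thesis
    using jordan_sides_arcs[of "linepath (point j) (point (Suc j))" ?h] that im
    by (auto simp: point_def)
qed

text \<open>\<open>chords_noncrossing\<close> is applied to the strand \<open>i\<close> as a chord
  of \<open>C\<close> and to the closed curve formed by the arch over \<open>j\<close> and its base.
  The far end \<open>v\<close> is left general because for the strands 0 and \<open>N\<close> it is
  \<open>c\<close>, which is not a crossing on the line.\<close>

lemma not_enclosed:
  assumes j: "1 \<le> j" "j < N" and i: "i \<le> N" "i \<noteq> j" "even i = even j"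
    and k: "1 \<le> k" "k \<le> N" "k \<noteq> j" "k \<noteq> Suc j" "point k \<in> closure (strand i)" "point k \<in> base j"
    and v: "v \<in> closure (strand i)" "v \<in> C" "v \<notin> base j"
  shows False
proof -
  obtain S0 T0 where ST0: "jordan_sides C S0 T0"
    "\<And>k. k \<le> N \<Longrightarrow> strand k \<subseteq> (if even k then S0 else T0)"
    using strand_sides by blast
  define S T where "S = (if even j then S0 else T0)" and "T = (if even j then T0 else S0)"
  have C: "jordan_sides C S T" using ST0(1) by (auto simp: S_def T_def jordan_sides_commute)
  have strands: "strand j \<subseteq> S" "strand i \<subseteq> S" using ST0(2)[of j] ST0(2)[of i] i j by (auto simp: S_def)
  obtain P Q where J: "jordan_sides (base j \<union> arch j) P Q" using jordan_arch[OF j] .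
  have t: "0 < time j" "time (Suc j) < 1" "time k \<in> {0..1}"
    using time_in[of j] time_in[of "Suc j"] time_in[of k] j k by auto
  have arch_sub: "arch j \<subseteq> {point j, point (Suc j)} \<union> strand j"
    using j by (auto simp: strand_mid point_def image_iff less_le)
  have ends: "point j \<in> C" "point (Suc j) \<in> C" using point_in_L[of j] point_in_L[of "Suc j"] j by auto
  have "{point j, point (Suc j)} \<union> strand j \<subseteq> C \<union> S" using ends strands(1) by auto
  then have "base j \<union> arch j \<subseteq> C \<union> S"
    using base_subset[OF j] order_trans[OF arch_sub] by auto
  moreover have "(C \<union> S) \<inter> T = {}" using C by (auto simp: jordan_sides_def)
  ultimately have JT: "(base j \<union> arch j) \<inter> T = {}" by (rule disjoint_mono)
  have "base j \<subseteq> C" using base_subset[OF j] by (rule le_supI1)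
  moreover have "C \<inter> strand i = {}" using strand_Int_C[OF i(1)] by (subst Int_commute)
  ultimately have "base j \<inter> strand i = {}" by (rule disjoint_mono)
  then have KJ: "strand i \<inter> (base j \<union> arch j) = {}"
    using strand_Int_arch[OF i(1) j i(2)] unfolding Int_Un_distrib by (simp only: Int_commute Un_empty_left)
  have base_ends: "point j \<in> base j" "point (Suc j) \<in> base j" by simp_all
  have "v \<notin> arch j"
  proof
    assume "v \<in> arch j"
    then have "v \<in> {point j, point (Suc j)}" using arch_Int_L[OF j] v(2) by (meson IntI subsetD)
    then show False using base_ends v(3) by auto
  qed
  then have vJ: "v \<in> C - (base j \<union> arch j)" using v by simp
  define lo hi where "lo = min (Re (point j)) (Re (point (Suc j)))"
    and "hi = max (Re (point j)) (Re (point (Suc j)))"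
  have between: "lo < Re (point k)" "Re (point k) < hi"
    using k j Re_point_eq_iff[of k j] Re_point_eq_iff[of k "Suc j"]
    by (auto simp: mem_base_iff lo_def hi_def less_le min_def max_def split: if_splits)
  \<comment> \<open>Off \<open>W'\<close> both \<open>C\<close> and the closed curve of the arch
    coincide with \<open>L\<close>: besides \<open>W\<close> and the arch, the parts of the line
    outside the open base are removed.\<close>
  define W' where "W' = W \<union> arch j \<union> (L \<inter> ({z. Re z \<le> lo} \<union> {z. Re z \<ge> hi}))"
  have "closed W'"
    unfolding W'_def using t
    by (intro closed_Un closed_Int closed_W closed_arc_image \<gamma> closed_halfspace_Re_le closed_halfspace_Re_ge)
       auto
  have pk: "point k = \<gamma> (time k)" by (simp add: point_def)
  have "point k \<notin> arch j"
    using arch_Int_L[OF j] point_in_L(1)[of k] k Re_point_eq_iff[of k j] Re_point_eq_iff[of k "Suc j"] j by auto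
  then have "\<gamma> (time k) \<notin> W'"
    using \<gamma>_notin_W[OF t(3)] between by (auto simp: W'_def pk)
  have cross: "crosses_transversally_at L (path_image \<gamma>) (\<gamma> (time k))"
    using transversal[OF point_in, of k] k by (simp add: pk)
  have tk: "0 < time k" "time k < 1" using time_in[of k] k by auto
  obtain U D1 D2 where U: "open U" "point k \<in> U" "U \<inter> W' = {}"
    and D: "connected D1" "connected D2" "U - L = D1 \<union> D2"
    unfolding pk by (rule crossing_halves[OF cross \<gamma>(1) tk \<open>closed W'\<close> \<open>\<gamma> (time k) \<notin> W'\<close>])
  have CU: "C \<inter> U = L \<inter> U" using U(3) by (auto simp: W'_def)
  have "z \<in> base j" if "z \<in> L \<inter> U" for z
  proof -
    have "z \<notin> W'" using that U(3) by blast
    then show ?thesis using that j by (auto simp: W'_def mem_base_iff L_eq lo_def hi_def)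
  qed
  then have JU: "(base j \<union> arch j) \<inter> U = L \<inter> U"
    using U(3) base_subset[OF j] by (auto simp: W'_def)
  show False
    using chords_noncrossing[OF C J JT connected_insert_closure[OF connected_strand[OF i(1)] v(1)]
        strands(2) KJ vJ k(5) U(1,2) _ _ CU JU D(3,1,2)] k(6) base_subset[OF j] by auto
qed

text \<open>The closed curve is built over \<open>j\<close>, a strand contained in
  \<open>\<gamma>\<close>. If \<open>i > 0\<close>, the base contains both ends of the strand
  \<open>i\<close> or neither. If \<open>i = 0\<close>, one end is \<open>c\<close>, off the line,
  and its label 0 is below all others, so interleaving would mean exactly that the base contains
  \<open>point 1\<close>.\<close>

lemma not_interleaved_arch:
  assumes "1 \<le> j" "j < N" "i < N" "i \<noteq> j" "even i = even j"
  shows "\<not> interleaved (perm j) (perm (Suc j)) (perm i) (perm (Suc i))"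
proof (cases "i = 0")
  case True
  have "j \<noteq> 1" using assms True by auto
  then have "\<not> (point 1 \<in> base j)"
    using not_enclosed[of j 0 1 c] assms True Suc_point_in_closure_strand[of 0] c_in_closure_strand
      c_in_C c_notin(1) base_subset[of j] by auto
  then show ?thesis
    using point_in_base_iff[of j 1] assms True \<open>j \<noteq> 1\<close> by (auto simp: interleaved_def perm_0)
next
  case False
  have i: "1 \<le> i" "Suc i \<le> N" "i \<noteq> Suc j" "Suc i \<noteq> j" using assms False by auto
  have "point i \<in> base j \<longleftrightarrow> point (Suc i) \<in> base j"
    using not_enclosed[of j i i "point (Suc i)"] not_enclosed[of j i "Suc i" "point i"] assms i
      Suc_point_in_closure_strand[of i] point_in_closure_strand[of i] point_in_L[of i] point_in_L[of "Suc i"]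
    by auto
  then show ?thesis
    using point_in_base_iff[of j i] point_in_base_iff[of j "Suc i"] assms i by (auto simp: interleaved_def)
qed

lemma interleaved_commute:
  "u \<noteq> x \<Longrightarrow> u \<noteq> y \<Longrightarrow> v \<noteq> x \<Longrightarrow> v \<noteq> y \<Longrightarrow> interleaved u v x y \<longleftrightarrow> interleaved x y u v"
  by (auto simp: interleaved_def)

text \<open>At most one of the two strands is the strand 0, and by symmetry the other one can serve
  as the arch.\<close>

lemma not_interleaved:
  assumes "i < N" "j < N" "even i = even j" "i \<noteq> j"
  shows "\<not> interleaved (perm i) (perm (Suc i)) (perm j) (perm (Suc j))"
proof (cases "i = 0")
  case True
  have "Suc i \<noteq> j" "i \<noteq> Suc j" using assms(3) by auto
  then have "\<not> interleaved (perm j) (perm (Suc j)) (perm i) (perm (Suc i))"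
    using not_interleaved_arch[of j i] assms True by auto
  then show ?thesis
    using perm_eq_iff[OF perm_bij perm_0] assms \<open>Suc i \<noteq> j\<close> \<open>i \<noteq> Suc j\<close>
    by (subst interleaved_commute) auto
next
  case False
  then show ?thesis using not_interleaved_arch[of i j] assms by auto
qed

text \<open>
  Here the transversality of the closing arcs at \<open>c\<close> enters: \<open>\<beta>\<close> changes the side of the closed
  curve formed by \<open>\<alpha>\<close>, the start of \<open>\<gamma>\<close> and the part of \<open>L\<close> right of the first crossing.
\<close>

lemma perm_first_less_last: "perm 1 < perm N"
proof (rule ccontr)
  assume "\<not> perm 1 < perm N"
  \<comment> \<open>With the last crossing to the left of the first one, the segment from
    \<open>a\<close> to \<open>point N\<close> misses the part \<open>?R\<close> of the line, so it
    can be used to pass around \<open>?J\<close>.\<close>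
  then have less: "Re (point N) < Re (point 1)"
    using perm_less_iff[of 1 N] Re_point_eq_iff[of 1 N] n by auto
  let ?R = "closed_segment (point 1) b"
  let ?J = "?R \<union> (path_image \<alpha> \<union> \<gamma> ` {0..time 1})"
  have t: "0 < time 1" "time 1 < time N" "time N < 1"
    using time_in[of 1] time_in[of N] time_less[of 1 N] n by auto
  have R_eq: "?R = {z. Im z = Im a \<and> Re (point 1) \<le> Re z \<and> Re z \<le> Re b}"
    using Im_point[of 1] ab Re_point[of 1] n by (subst horizontal_segment) auto
  have R_sub: "?R \<subseteq> L" using R_eq L_eq Re_point[of 1] n by auto
  have \<alpha>L: "z = b" if "z \<in> path_image \<alpha>" "z \<in> L" for z
  proof -
    from that(1) obtain s where s: "z = \<alpha> s" "s \<in> {0..1}" unfolding path_image_def by (rule imageE)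
    then show ?thesis using that(2) \<alpha>_meets(1)[OF s(2)] s(1) \<alpha>(2) by simp
  qed
  have \<alpha>\<gamma>: "z = \<gamma> 0" if "z \<in> path_image \<alpha>" "z \<in> path_image \<gamma>" for z
  proof -
    from that(1) obtain s where s: "z = \<alpha> s" "s \<in> {0..1}" unfolding path_image_def by (rule imageE)
    then show ?thesis using that(2) \<alpha>_meets(2)[OF s(2)] s(1) \<alpha>(3) by simp
  qed
  have \<gamma>_first: "s = time 1" if "s \<in> {0..time 1}" "\<gamma> s \<in> L" for s
  proof -
    have "s \<in> time ` {1..N}" using mem_L_iff[of s] that t by auto
    then obtain k where "k \<in> {1..N}" "s = time k" by (rule imageE)
    then show ?thesis using time_mono[of 1 k] that n by auto
  qed
  have \<gamma>_last: "s = time N" if "s \<in> {time N..1}" "\<gamma> s \<in> L" for s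
  proof -
    have "s \<in> time ` {1..N}" using mem_L_iff[of s] that t by auto
    then obtain k where "k \<in> {1..N}" "s = time k" by (rule imageE)
    then show ?thesis using time_mono[of k N] that n by auto
  qed
  obtain P Q where J: "jordan_sides ?J P Q"
  proof -
    let ?g = "subpath 0 (time 1) \<gamma>" and ?h = "\<alpha> +++ subpath 0 (time 1) \<gamma>"
    have im: "path_image ?g = \<gamma> ` {0..time 1}" using t by (simp add: path_image_subpath)
    have sub: "\<gamma> ` {0..time 1} \<subseteq> path_image \<gamma>" using t by (intro arc_image_subset) auto
    have join: "pathfinish \<alpha> = pathstart ?g" "pathstart ?g = \<gamma> 0"
      using \<alpha>(3) by (simp_all add: pathfinish_def)
    have arc_g: "arc ?g" using t by (intro arc_subpath_arc \<gamma>) auto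
    have arc_h: "arc ?h"
    proof (rule arc_join[OF \<alpha>(1) arc_g join(1)])
      show "path_image \<alpha> \<inter> path_image ?g \<subseteq> {pathstart ?g}"
        unfolding im join(2) using \<alpha>\<gamma> sub by blast
    qed
    have im_h: "path_image ?h = path_image \<alpha> \<union> \<gamma> ` {0..time 1}"
      unfolding path_image_join[OF join(1)] im ..
    have "?R \<inter> path_image ?h \<subseteq> {point 1, b}"
    proof
      fix z assume z: "z \<in> ?R \<inter> path_image ?h"
      then have "z \<in> L" using R_sub by blast
      consider "z \<in> path_image \<alpha>" | s where "s \<in> {0..time 1}" "z = \<gamma> s"
        using z unfolding im_h by blast
      then show "z \<in> {point 1, b}"
        using \<alpha>L[OF _ \<open>z \<in> L\<close>] \<gamma>_first \<open>z \<in> L\<close> by cases (auto simp: point_def)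
    qed
    moreover have "pathstart ?h = b" "pathfinish ?h = point 1"
      using \<alpha>(2) by (simp_all add: point_def pathstart_def[of \<alpha>])
    moreover have "point 1 \<noteq> b" using Re_point[of 1] n by auto
    ultimately obtain P Q
      where "jordan_sides (path_image (linepath (point 1) b) \<union> path_image ?h) P Q"
      using jordan_sides_arcs[of "linepath (point 1) b" ?h] arc_h by auto
    then show ?thesis
      using that unfolding path_image_linepath im_h by blast
  qed
  \<comment> \<open>The parts of \<open>?J\<close> outside \<open>path_image \<alpha>\<close> lie in
    this closed set, which misses \<open>c\<close>; so near \<open>c\<close> the curve
    \<open>?J\<close> is just \<open>\<alpha>\<close>.\<close>
  have "closed (L \<union> path_image \<gamma>)"
    using closed_arc_image[OF \<gamma>(1), of "{0..1}"] by (auto simp: path_image_def)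
  moreover have "c \<in> path_image \<alpha>" using c by blast
  moreover have "\<gamma> ` {0..time 1} \<subseteq> path_image \<gamma>" using t by (intro arc_image_subset) auto
  ultimately consider "\<forall>\<^sub>F s in at_left uc. \<beta> s \<in> P" "\<forall>\<^sub>F s in at_right uc. \<beta> s \<in> Q"
    | "\<forall>\<^sub>F s in at_left uc. \<beta> s \<in> Q" "\<forall>\<^sub>F s in at_right uc. \<beta> s \<in> P"
    using crossing_switches_side[OF J, of "path_image \<alpha>" \<beta> uc "L \<union> path_image \<gamma>"] c_cross c_notin uc \<beta>(1) R_sub
    by auto
  note switch = this
  \<comment> \<open>Without \<open>c\<close> the arc \<open>\<beta>\<close> falls into two pieces.
    They are reconnected through the end of \<open>\<gamma>\<close>, the last crossing and the left
    part of the line, with \<open>point N\<close> common to \<open>?X\<close> and \<open>?Y\<close>.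
    The union misses \<open>?J\<close>, whereas the two pieces of \<open>\<beta>\<close> near
    \<open>c\<close> are on different sides of it.\<close>
  let ?X = "\<gamma> ` {time N..1} \<union> \<beta> ` {0..<uc}" and ?Y = "\<beta> ` {uc<..1} \<union> closed_segment a (point N)"
  have \<beta>\<alpha>: "\<beta> s \<notin> path_image \<alpha>" if "s \<in> {0..1}" "s \<noteq> uc" for s
  proof
    assume "\<beta> s \<in> path_image \<alpha>"
    then obtain r where "\<beta> s = \<alpha> r" "r \<in> {0..1}" unfolding path_image_def by (rule imageE)
    then show False using \<alpha>_eq_\<beta>[of r s] that by simp
  qed
  have \<gamma>N: "\<gamma> s \<notin> ?J" if "s \<in> {time N..1}" for s
  proof -
    have s: "s \<in> {0..1}" "s \<noteq> 0" using that t by auto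
    have "\<gamma> s \<notin> path_image \<alpha>"
      using \<alpha>\<gamma> mem_simps(1)[OF s(1)] arc_eq_iff[OF \<gamma>(1) s(1), of 0] s(2) by auto
    moreover have "\<gamma> s \<notin> \<gamma> ` {0..time 1}"
    proof
      assume "\<gamma> s \<in> \<gamma> ` {0..time 1}"
      then obtain r where "\<gamma> s = \<gamma> r" "r \<in> {0..time 1}" by (rule imageE)
      then show False using arc_eq_iff[OF \<gamma>(1) s(1), of r] t that by auto
    qed
    moreover have "\<gamma> s \<notin> ?R"
      using \<gamma>_last[OF that] R_sub less R_eq by (auto simp: point_def)
    ultimately show ?thesis by blast
  qed
  have \<beta>J: "\<beta> s \<notin> ?J" if s: "s \<in> {0..1}" "s \<noteq> uc" for s
  proof
    assume *: "\<beta> s \<in> ?J"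
    consider "s = 0" | "s = 1" | "\<beta> s \<notin> L" "\<beta> s \<notin> path_image \<gamma>"
      using \<beta>_meets[OF s(1)] by blast
    then show False
    proof cases
      case 1
      then show ?thesis using \<gamma>N[of 1] * \<beta>(2) t by auto
    next
      case 2
      have "a \<notin> ?R" unfolding R_eq using Re_point(1)[of 1] n by simp
      moreover have "a \<notin> \<gamma> ` {0..time 1}"
        using \<gamma>(4) arc_image_subset[of "{0..time 1}" \<gamma>] t by auto
      ultimately show ?thesis using 2 * \<beta>(3) \<beta>\<alpha>[OF s] by auto
    next
      case 3
      then show ?thesis using * R_sub \<beta>\<alpha>[OF s] arc_image_subset[of "{0..time 1}" \<gamma>] t by auto
    qed
  qed
  have seg_eq: "closed_segment a (point N) = {z. Im z = Im a \<and> Re a \<le> Re z \<and> Re z \<le> Re (point N)}"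
    using Im_point[of N] Re_point[of N] n by (intro horizontal_segment) auto
  have seg: "z \<notin> ?J" if z: "z \<in> closed_segment a (point N)" for z
  proof -
    have "z \<in> L" using z seg_eq L_eq Re_point[of N] n by auto
    moreover have "Re z < Re (point 1)" "Re z < Re b" using z seg_eq less Re_point(2)[of 1] n by auto
    moreover have "z \<notin> \<gamma> ` {0..time 1}"
    proof
      assume "z \<in> \<gamma> ` {0..time 1}"
      then obtain s where s: "z = \<gamma> s" "s \<in> {0..time 1}" by (rule imageE)
      then have "z = point 1" using \<gamma>_first[OF s(2)] \<open>z \<in> L\<close> by (simp add: point_def)
      then show False using \<open>Re z < Re (point 1)\<close> by simp
    qed
    moreover have "z \<notin> ?R" unfolding R_eq using \<open>Re z < Re (point 1)\<close> by simp
    ultimately show ?thesis using \<alpha>L[of z] by auto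
  qed
  have X: "connected ?X"
  proof (rule connected_Un)
    show "connected (\<gamma> ` {time N..1})" "connected (\<beta> ` {0..<uc})"
      using t uc by (auto intro!: connected_arc_image \<beta> \<gamma>)
    have "\<gamma> 1 \<in> \<gamma> ` {time N..1}" "\<gamma> 1 \<in> \<beta> ` {0..<uc}"
      using uc \<beta>(2) t by (auto intro!: image_eqI[of _ \<beta> 0])
    then show "\<gamma> ` {time N..1} \<inter> \<beta> ` {0..<uc} \<noteq> {}" by blast
  qed
  have Y: "connected ?Y"
  proof (rule connected_Un)
    show "connected (\<beta> ` {uc<..1})"
      using uc by (auto intro!: connected_arc_image \<beta>)
    have "a \<in> \<beta> ` {uc<..1}" using uc \<beta>(3) by (auto intro!: image_eqI[of _ \<beta> 1])
    then show "\<beta> ` {uc<..1} \<inter> closed_segment a (point N) \<noteq> {}" by auto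
  qed auto
  have "point N \<in> ?X" "point N \<in> ?Y" using t by (simp_all add: point_def)
  then have "?X \<inter> ?Y \<noteq> {}" by (meson disjoint_iff)
  from connected_Un[OF X Y this] have "connected (?X \<union> ?Y)" .
  moreover have "(?X \<union> ?Y) \<inter> ?J = {}"
  proof -
    have "\<beta> s \<notin> ?J" if "s \<in> {0..<uc} \<or> s \<in> {uc<..1}" for s
      using that uc by (intro \<beta>J) auto
    then have "\<beta> ` {0..<uc} \<inter> ?J = {}" "\<beta> ` {uc<..1} \<inter> ?J = {}"
      by (meson image_disjointI)+
    moreover have "\<gamma> ` {time N..1} \<inter> ?J = {}" by (rule image_disjointI) (rule \<gamma>N)
    moreover have "closed_segment a (point N) \<inter> ?J = {}" using seg by (meson disjoint_iff)
    ultimately show ?thesis by (simp only: Int_Un_distrib2 Un_empty_left)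
  qed
  ultimately have XY: "?X \<union> ?Y \<subseteq> P \<or> ?X \<union> ?Y \<subseteq> Q"
    by (rule connected_in_side[OF J])
  have left: "\<forall>\<^sub>F s in at_left uc. \<beta> s \<in> ?X \<union> ?Y"
  proof -
    have "\<forall>\<^sub>F s in at_left uc. s \<in> {0<..<uc}" using uc by (intro eventually_at_leftI[of 0]) auto
    then show ?thesis by (rule eventually_mono) auto
  qed
  have right: "\<forall>\<^sub>F s in at_right uc. \<beta> s \<in> ?X \<union> ?Y"
  proof -
    have "\<forall>\<^sub>F s in at_right uc. s \<in> {uc<..<1}" using uc by (intro eventually_at_rightI[of _ 1]) auto
    then show ?thesis by (rule eventually_mono) auto
  qed
  have disj: "P \<inter> Q = {}" using J by (simp add: jordan_sides_def)
  have meets: "\<exists>z\<in>?X \<union> ?Y. z \<in> B"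
    if "(\<forall>\<^sub>F s in at_left uc. \<beta> s \<in> B) \<or> (\<forall>\<^sub>F s in at_right uc. \<beta> s \<in> B)" for B
    using that
  proof
    assume "\<forall>\<^sub>F s in at_left uc. \<beta> s \<in> B"
    from eventually_happens'[OF _ eventually_conj[OF this left]] show ?thesis by (simp only: trivial_limit_at_left_real) blast
  next
    assume "\<forall>\<^sub>F s in at_right uc. \<beta> s \<in> B"
    from eventually_happens'[OF _ eventually_conj[OF this right]] show ?thesis by (simp only: trivial_limit_at_right_real) blast
  qed
  have "\<exists>z\<in>?X \<union> ?Y. z \<in> P" "\<exists>z\<in>?X \<union> ?Y. z \<in> Q"
    using switch by (metis meets)+
  then show False using XY disj by (meson disjoint_iff subsetD)
qed

text \<open>For \<open>j = 0\<close> the claim is \<open>perm_first_less_last\<close>, as the label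
  0 is below all others. For \<open>j > 0\<close> the strand \<open>N\<close> has the same parity as
  \<open>j\<close> and leads from \<open>point N\<close> to \<open>c\<close>, off the line, so the
  base of \<open>j\<close> cannot contain \<open>point N\<close>.\<close>

lemma last_not_enclosed:
  assumes "even j" "j < N"
  shows "(perm j < perm N) = (perm (Suc j) < perm N)"
proof (cases "j = 0")
  case True
  then show ?thesis using perm_first_less_last by (auto simp: perm_0)
next
  case False
  have "Suc j \<noteq> N"
  proof
    assume "Suc j = N"
    then have "even (Suc j)" by simp
    then show False using assms(1) by simp
  qed
  then have j: "1 \<le> j" "Suc j \<noteq> N" using False by auto
  then have "point N \<notin> base j"
    using not_enclosed[of j N N c] assms point_in_closure_strand[of N] c_in_closure_strand
      c_in_C c_notin(1) base_subset[of j] by auto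
  then show ?thesis using point_in_base_iff[of j N] assms j by auto
qed

lemma meandric_perm: "meandric n perm"
  using meandricI[OF perm_bij perm_0] not_interleaved last_not_enclosed by blast

end

section \<open>Drawing a meander\<close>

text \<open>The chart is the similarity that moves \<open>p\<close> to 0, rescales by
  \<open>r\<close> and rotates by \<open>\<omega>\<close>. The rotation makes \<open>A\<close>
  horizontal: it is 1 on the line and \<open>- \<i>\<close> at the crossing of the closing arcs,
  where \<open>\<alpha>\<close> is vertical.\<close>

lemma crosses_transversally_axes:
  fixes \<omega> p :: complex
  assumes r: "r > 0" and \<omega>: "norm \<omega> = 1"
    and A: "\<And>z. z \<in> ball p r \<Longrightarrow> z \<in> A \<longleftrightarrow> Im (\<omega> * (z - p)) = 0"
    and B: "\<And>z. z \<in> ball p r \<Longrightarrow> z \<in> B \<longleftrightarrow> Re (\<omega> * (z - p)) = 0"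
  shows "crosses_transversally_at A B p"
proof -
  define h where "h z = \<omega> * (z - p) / of_real r" for z
  define h' where "h' w = p + of_real r * w / \<omega>" for w
  have nz: "\<omega> \<noteq> 0" "complex_of_real r \<noteq> 0" using r \<omega> by auto
  have inv: "h' (h z) = z" "h (h' z) = z" for z
    using nz by (simp_all add: h_def h'_def)
  have h_ball: "h z \<in> ball 0 1 \<longleftrightarrow> z \<in> ball p r" for z
    using r \<omega> by (simp add: h_def norm_mult norm_divide dist_norm norm_minus_commute)
  have h'_ball: "h' z \<in> ball p r \<longleftrightarrow> z \<in> ball 0 1" for z
    using h_ball[of "h' z"] inv by simp
  have ReIm: "Re (h z) = Re (\<omega> * (z - p)) / r" "Im (h z) = Im (\<omega> * (z - p)) / r" for z
    by (simp_all only: h_def Re_divide_of_real Im_divide_of_real)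
  have image: "h ` (X \<inter> ball p r) = {z \<in> ball 0 1. P z}"
    if X: "\<And>z. z \<in> ball p r \<Longrightarrow> z \<in> X \<longleftrightarrow> P (h z)" for X P
  proof
    show "h ` (X \<inter> ball p r) \<subseteq> {z \<in> ball 0 1. P z}"
      using X h_ball by blast
    show "{z \<in> ball 0 1. P z} \<subseteq> h ` (X \<inter> ball p r)"
    proof
      fix z assume z: "z \<in> {z \<in> ball 0 1. P z}"
      then have "h' z \<in> X \<inter> ball p r" using X[of "h' z"] h'_ball[of z] inv by auto
      then show "z \<in> h ` (X \<inter> ball p r)" using inv(2)[of z] by (metis image_eqI)
    qed
  qed
  have "homeomorphism (ball p r) (ball 0 1) h h'"
  proof (rule homeomorphismI)
    show "continuous_on (ball p r) h" "continuous_on (ball 0 1) h'"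
      using nz unfolding h_def h'_def by (auto intro!: continuous_intros)
    show "h ` ball p r \<subseteq> ball 0 1" "h' ` ball 0 1 \<subseteq> ball p r" using h_ball h'_ball by blast+
  qed (use inv in auto)
  moreover have "h ` (A \<inter> ball p r) = {z \<in> ball 0 1. Im z = 0}"
    using r A by (intro image) (simp add: ReIm)
  moreover have "h ` (B \<inter> ball p r) = {z \<in> ball 0 1. Re z = 0}"
    using r B by (intro image) (simp add: ReIm)
  moreover have "h p = 0" by (simp add: h_def)
  ultimately show ?thesis
    unfolding crosses_transversally_at_def using r
    by (intro exI[of _ "ball p r"] exI[of _ h] exI[of _ h']) auto
qed

section \<open>Rectangular arcs and their coordinate profiles\<close>

lemma vertical_segment:
  assumes "y0 \<le> y1"
  shows "closed_segment (Complex x y0) (Complex x y1) = {z. Re z = x \<and> y0 \<le> Im z \<and> Im z \<le> y1}"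
  using assms by (subst closed_segment_same_Re) (auto simp: closed_segment_eq_real_ivl)

lemma horizontal_segment':
  "closed_segment (Complex x0 y) (Complex x1 y) = {z. Im z = y \<and> min x0 x1 \<le> Re z \<and> Re z \<le> max x0 x1}"
  by (subst closed_segment_same_Im) (auto simp: closed_segment_eq_real_ivl)

lemma rectangular_arc:
  assumes "x0 \<noteq> x1" "y0 < h" "y1 < h"
  obtains g where "arc g" "pathstart g = Complex x0 y0" "pathfinish g = Complex x1 y1"
    "path_image g = {z. Re z = x0 \<and> y0 \<le> Im z \<and> Im z \<le> h} \<union>
       ({z. Im z = h \<and> min x0 x1 \<le> Re z \<and> Re z \<le> max x0 x1} \<union> {z. Re z = x1 \<and> y1 \<le> Im z \<and> Im z \<le> h})"
proof -
  let ?a = "linepath (Complex x0 y0) (Complex x0 h)"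
  let ?b = "linepath (Complex x0 h) (Complex x1 h)"
  let ?c = "linepath (Complex x1 h) (Complex x1 y1)"
  have im: "path_image ?a = {z. Re z = x0 \<and> y0 \<le> Im z \<and> Im z \<le> h}"
    "path_image ?b = {z. Im z = h \<and> min x0 x1 \<le> Re z \<and> Re z \<le> max x0 x1}"
    "path_image ?c = {z. Re z = x1 \<and> y1 \<le> Im z \<and> Im z \<le> h}"
    using assms vertical_segment[of y0 h x0] vertical_segment[of y1 h x1] horizontal_segment'
    by (simp_all add: closed_segment_commute[of "Complex x1 h"])
  have "arc (?b +++ ?c)"
    using assms by (intro arc_join) (auto simp: im[simplified] complex_eq_iff)
  moreover have im2: "path_image (?b +++ ?c) = path_image ?b \<union> path_image ?c"
    by (rule path_image_join) simp
  ultimately have "arc (?a +++ (?b +++ ?c))"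
    using assms by (intro arc_join) (auto simp: im2 im[simplified] complex_eq_iff)
  moreover have "path_image (?a +++ (?b +++ ?c)) = path_image ?a \<union> (path_image ?b \<union> path_image ?c)"
    by (simp add: path_image_join)
  ultimately show ?thesis
    using that[of "?a +++ (?b +++ ?c)"] unfolding im by auto
qed

text \<open>On the unit interval \<open>ramp\<close> and \<open>plateau\<close> are the coordinates
  of a rectangular arch: up in the first third, across in the second, down in the last. Outside they
  are constant, which allows a whole curve to be written as a sum of shifted copies and makes its
  continuity immediate.\<close>

definition ramp :: "real \<Rightarrow> real" where "ramp s = max 0 (min 1 (3 * s - 1))"

definition plateau :: "real \<Rightarrow> real" where "plateau s = max 0 (min 1 (min (3 * s) (3 - 3 * s)))"

lemma ramp_simps: "s \<le> 1/3 \<Longrightarrow> ramp s = 0" "s \<ge> 2/3 \<Longrightarrow> ramp s = 1"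
  "1/3 \<le> s \<Longrightarrow> s \<le> 2/3 \<Longrightarrow> ramp s = 3 * s - 1"
  by (auto simp: ramp_def)

lemma plateau_simps: "s \<le> 0 \<Longrightarrow> plateau s = 0" "s \<ge> 1 \<Longrightarrow> plateau s = 0"
  "0 \<le> s \<Longrightarrow> s \<le> 1/3 \<Longrightarrow> plateau s = 3 * s" "1/3 \<le> s \<Longrightarrow> s \<le> 2/3 \<Longrightarrow> plateau s = 1"
  "2/3 \<le> s \<Longrightarrow> s \<le> 1 \<Longrightarrow> plateau s = 3 - 3 * s"
  by (auto simp: plateau_def)

lemma ramp_bounds: "0 \<le> ramp s" "ramp s \<le> 1" and plateau_bounds: "0 \<le> plateau s" "plateau s \<le> 1"
  by (auto simp: ramp_def plateau_def)

lemma ramp_or_plateau: "0 \<le> s \<Longrightarrow> s \<le> 1 \<Longrightarrow> ramp s = 0 \<or> ramp s = 1 \<or> plateau s = 1"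
  using ramp_simps(1,2)[of s] plateau_simps(4)[of s] by argo

lemma plateau_pos: "0 < s \<Longrightarrow> s < 1 \<Longrightarrow> plateau s > 0"
  by (auto simp: plateau_def)

text \<open>The pair runs once along three sides of the unit square.\<close>

lemma ramp_plateau_inj:
  assumes "0 \<le> s" "s \<le> 1" "0 \<le> t" "t \<le> 1" "ramp s = ramp t" "plateau s = plateau t"
  shows "s = t"
  using assms by (auto simp: ramp_def plateau_def max_def min_def split: if_splits)

lemma continuous_on_ramp: "continuous_on UNIV ramp" and continuous_on_plateau: "continuous_on UNIV plateau"
  unfolding ramp_def plateau_def by (auto intro!: continuous_intros)

text \<open>During piece \<open>k\<close> the earlier ramps are complete and the later ones have not
  begun.\<close>

lemma sum_steps:
  fixes a w :: "nat \<Rightarrow> real"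
  assumes "1 \<le> k" "k < N" "\<And>j. j < k \<Longrightarrow> w j = 1" "\<And>j. k < j \<Longrightarrow> w j = 0"
  shows "(\<Sum>j=1..<N. a j * w j) = (\<Sum>j=1..<k. a j) + a k * w k"
proof -
  have "(\<Sum>j=1..<N. a j * w j) = (\<Sum>j=1..<k. a j * w j) + (\<Sum>j=k..<N. a j * w j)"
    using assms sum.atLeastLessThan_concat[of 1 k N "\<lambda>j. a j * w j"] by simp
  also have "(\<Sum>j=1..<k. a j * w j) = (\<Sum>j=1..<k. a j)"
    using assms by (intro sum.cong) auto
  also have "(\<Sum>j=k..<N. a j * w j) = a k * w k + (\<Sum>j=Suc k..<N. a j * w j)"
    using assms by (simp add: sum.atLeast_Suc_lessThan)
  also have "(\<Sum>j=Suc k..<N. a j * w j) = 0"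
    using assms by (intro sum.neutral) auto
  finally show ?thesis by simp
qed

lemma sum_single:
  fixes a w :: "nat \<Rightarrow> real"
  assumes "1 \<le> k" "k < N" "\<And>j. j \<noteq> k \<Longrightarrow> w j = 0"
  shows "(\<Sum>j=1..<N. a j * w j) = a k * w k"
  using assms sum.remove[of "{1..<N}" k "\<lambda>j. a j * w j"] by (simp add: sum.neutral)

locale meandric_curve =
  fixes n :: nat and \<sigma> :: "nat \<Rightarrow> nat"
  assumes n: "n > 0" and bij: "bij_betw \<sigma> {..2 * n} {..2 * n}" and zero: "\<sigma> 0 = 0"
    and meandric: "meandric n \<sigma>"
begin

abbreviation "N \<equiv> 2 * n"

text \<open>One number serves three purposes. It exceeds the height of every arch, which is at most
  \<open>N - 1\<close>, so the ends of the curve lie above everything else; it is the right end of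
  the line; and it is the length of the interval on which \<open>X\<close> and \<open>Y\<close> are
  used.\<close>

definition height :: real where "height = real N + 1"

definition X :: "real \<Rightarrow> real" where
  "X t = real (\<sigma> 1) + (\<Sum>k=1..<N. (real (\<sigma> (Suc k)) - real (\<sigma> k)) * ramp (t - real k))"

text \<open>The two \<open>max\<close> terms are vertical stems: the curve comes down from
  \<open>height\<close> to the crossing at time 1 and goes up again after time \<open>N\<close>.
  Making each arch as high as it is wide keeps nested arches apart, since the inner one is strictly
  lower.\<close>

definition Y :: "real \<Rightarrow> real" where
  "Y t = height * max 0 (1 - t) + height * max 0 (t - real N) +
     (\<Sum>k=1..<N. ((-1) ^ k * \<bar>real (\<sigma> (Suc k)) - real (\<sigma> k)\<bar>) * plateau (t - real k))"

lemma height_pos: "height > 0" by (simp add: height_def)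

lemma \<sigma>_eq_iff: "i \<le> N \<Longrightarrow> j \<le> N \<Longrightarrow> \<sigma> i = \<sigma> j \<longleftrightarrow> i = j"
  by (rule perm_eq_iff[OF bij zero])

lemma \<sigma>_le: "i \<le> N \<Longrightarrow> \<sigma> i \<le> N"
  by (rule perm_le[OF bij zero])

lemma \<sigma>_pos: "1 \<le> i \<Longrightarrow> i \<le> N \<Longrightarrow> 1 \<le> \<sigma> i"
  using \<sigma>_eq_iff[of i 0] zero by (cases "\<sigma> i") auto

lemma \<sigma>_image: "\<sigma> ` {1..N} = {1..N}"
proof -
  have "\<sigma> ` ({..N} - {0}) = {..N} - {\<sigma> 0}"
    using bij by (subst inj_on_image_set_diff[of _ "{..N}"]) (auto simp: bij_betw_def)
  moreover have "{..N} - {0} = {1..N}" by auto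
  ultimately show ?thesis by (simp add: zero)
qed

lemma parity: "k \<le> N \<Longrightarrow> even (\<sigma> k) = even k"
  using meandric by (auto simp: meandric_def)

text \<open>The case \<open>j = 0\<close> of the fact that no even pair encloses the last label. It
  is what makes the drawn closing arcs cross.\<close>

lemma first_less_last: "\<sigma> 1 < \<sigma> N"
  using meandric_last_not_enclosed[OF bij zero refl meandric, of 0] n \<sigma>_pos[of N] zero by auto

text \<open>The pair \<open>{0, \<sigma> 1}\<close> is one of the even pairs, and 0 is below all
  other labels. Hence no even arch passes over \<open>\<sigma> 1\<close>, and the initial stem is
  unobstructed.\<close>

lemma first_exposed:
  assumes "even j" "1 \<le> j" "j < N"
  shows "(\<sigma> j < \<sigma> 1) = (\<sigma> (Suc j) < \<sigma> 1)"
proof -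
  have "\<not> interleaved (\<sigma> 0) (\<sigma> (Suc 0)) (\<sigma> j) (\<sigma> (Suc j))"
    using meandric assms n by (auto simp: meandric_def)
  moreover have "\<sigma> j \<noteq> \<sigma> 1" "\<sigma> (Suc j) \<noteq> \<sigma> 1" "0 < \<sigma> j" "0 < \<sigma> (Suc j)"
    using \<sigma>_eq_iff[of j 1] \<sigma>_eq_iff[of "Suc j" 1] \<sigma>_pos[of j] \<sigma>_pos[of "Suc j"] assms by auto
  ultimately show ?thesis by (auto simp: interleaved_def zero)
qed

lemma last_exposed: "even j \<Longrightarrow> j < N \<Longrightarrow> (\<sigma> j < \<sigma> N) = (\<sigma> (Suc j) < \<sigma> N)"
  by (rule meandric_last_not_enclosed[OF bij zero refl meandric])

section \<open>The pieces of the drawn curve\<close>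

lemma curve_start:
  assumes "0 \<le> t" "t \<le> 1" shows "X t = \<sigma> 1" "Y t = height * (1 - t)"
proof -
  have "(\<Sum>k=1..<N. (real (\<sigma> (Suc k)) - real (\<sigma> k)) * ramp (t - real k)) = 0"
    using assms by (intro sum.neutral) (auto simp: ramp_simps)
  then show "X t = \<sigma> 1" by (simp add: X_def)
  have "(\<Sum>k=1..<N. ((-1) ^ k * \<bar>real (\<sigma> (Suc k)) - real (\<sigma> k)\<bar>) * plateau (t - real k)) = 0"
    using assms by (intro sum.neutral) (auto simp: plateau_simps)
  then show "Y t = height * (1 - t)" using assms n by (simp add: Y_def max_def)
qed

lemma curve_end:
  assumes "real N \<le> t" shows "X t = \<sigma> N" "Y t = height * (t - N)"
proof -
  have "(\<Sum>k=1..<N. (real (\<sigma> (Suc k)) - real (\<sigma> k)) * ramp (t - real k)) =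
      (\<Sum>k=1..<N. real (\<sigma> (Suc k)) - real (\<sigma> k))"
    using assms by (intro sum.cong) (auto simp: ramp_simps)
  also have "\<dots> = real (\<sigma> N) - real (\<sigma> 1)"
    using n by (intro sum_Suc_diff') auto
  finally show "X t = \<sigma> N" by (simp add: X_def)
  have "(\<Sum>k=1..<N. ((-1) ^ k * \<bar>real (\<sigma> (Suc k)) - real (\<sigma> k)\<bar>) * plateau (t - real k)) = 0"
    using assms by (intro sum.neutral) (auto simp: plateau_simps)
  then show "Y t = height * (t - N)" using assms n by (simp add: Y_def max_def)
qed

lemma curve_arch:
  assumes k: "1 \<le> k" "k < N" and t: "real k \<le> t" "t \<le> real k + 1"
  shows "X t = real (\<sigma> k) + (real (\<sigma> (Suc k)) - real (\<sigma> k)) * ramp (t - k)"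
    and "Y t = (-1) ^ k * \<bar>real (\<sigma> (Suc k)) - real (\<sigma> k)\<bar> * plateau (t - k)"
proof -
  have "(\<Sum>j=1..<N. (real (\<sigma> (Suc j)) - real (\<sigma> j)) * ramp (t - real j)) =
      (\<Sum>j=1..<k. real (\<sigma> (Suc j)) - real (\<sigma> j)) + (real (\<sigma> (Suc k)) - real (\<sigma> k)) * ramp (t - k)"
    using k t by (intro sum_steps) (auto simp: ramp_simps)
  also have "(\<Sum>j=1..<k. real (\<sigma> (Suc j)) - real (\<sigma> j)) = real (\<sigma> k) - real (\<sigma> 1)"
    using k by (intro sum_Suc_diff') auto
  finally show "X t = real (\<sigma> k) + (real (\<sigma> (Suc k)) - real (\<sigma> k)) * ramp (t - k)" by (simp add: X_def)
  have "plateau (t - real j) = 0" if "j \<noteq> k" for j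
    using that t by (cases "j < k") (auto simp: plateau_simps)
  then have "(\<Sum>j=1..<N. ((-1) ^ j * \<bar>real (\<sigma> (Suc j)) - real (\<sigma> j)\<bar>) * plateau (t - real j)) =
      ((-1) ^ k * \<bar>real (\<sigma> (Suc k)) - real (\<sigma> k)\<bar>) * plateau (t - k)"
    by (intro sum_single k)
  moreover have "real k + 1 \<le> real N" "1 \<le> real k" using k by linarith+
  then have "max 0 (1 - t) = 0" "max 0 (t - real N) = 0" using t by linarith+
  ultimately show "Y t = (-1) ^ k * \<bar>real (\<sigma> (Suc k)) - real (\<sigma> k)\<bar> * plateau (t - k)"
    by (simp add: Y_def)
qed

lemma piece_cases:
  assumes "0 \<le> t" "t \<le> real N + 1"
  obtains "t \<le> 1" | k where "1 \<le> k" "k < N" "real k \<le> t" "t \<le> real k + 1" | "real N \<le> t"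
proof (cases "t \<le> 1 \<or> real N \<le> t")
  case False
  define k where "k = nat \<lfloor>t\<rfloor>"
  have "real k \<le> t" "t < real k + 1"
    using False unfolding k_def by linarith+
  moreover from this have "1 \<le> k" "k < N" using False by linarith+
  ultimately show ?thesis using that(2)[of k] by simp
qed (use that in auto)

lemma X_nat: "1 \<le> k \<Longrightarrow> k \<le> N \<Longrightarrow> X (real k) = \<sigma> k" and Y_nat: "1 \<le> k \<Longrightarrow> k \<le> N \<Longrightarrow> Y (real k) = 0"
proof -
  assume k: "1 \<le> k" "k \<le> N"
  have "X (real k) = \<sigma> k \<and> Y (real k) = 0"
  proof (cases "k = N")
    case True
    then show ?thesis using curve_end[of "real k"] by simp_all
  next
    case False
    then show ?thesis
      using curve_arch[of k "real k"] k by (simp add: ramp_simps plateau_simps)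
  qed
  then show "X (real k) = \<sigma> k" "Y (real k) = 0" by simp_all
qed

text \<open>The arch follows three sides of a rectangle over \<open>[lo, hi]\<close> whose height
  equals its width: every point is on a vertical side or at full height. Disjointness of arches then
  becomes linear arithmetic.\<close>

lemma arch_facts:
  assumes k: "1 \<le> k" "k < N" and t: "real k \<le> t" "t \<le> real k + 1"
  defines "lo \<equiv> real (min (\<sigma> k) (\<sigma> (Suc k)))" and "hi \<equiv> real (max (\<sigma> k) (\<sigma> (Suc k)))"
  shows "lo \<le> X t" "X t \<le> hi" "\<bar>Y t\<bar> \<le> hi - lo" "X t = lo \<or> X t = hi \<or> \<bar>Y t\<bar> = hi - lo"
    "lo + 1 \<le> hi" "1 \<le> lo" "hi \<le> N"
proof -
  let ?u = "real (\<sigma> k)" and ?v = "real (\<sigma> (Suc k))"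
  have X: "X t = ?u + (?v - ?u) * ramp (t - k)" and Y: "\<bar>Y t\<bar> = \<bar>?v - ?u\<bar> * plateau (t - k)"
    using curve_arch[OF k t] plateau_bounds(1)[of "t - k"] by (auto simp: abs_mult power_abs)
  have "\<sigma> k \<noteq> \<sigma> (Suc k)" using \<sigma>_eq_iff[of k "Suc k"] k by auto
  then show "lo + 1 \<le> hi" by (auto simp: lo_def hi_def)
  show "1 \<le> lo" "hi \<le> N"
    using \<sigma>_pos[of k] \<sigma>_pos[of "Suc k"] \<sigma>_le[of k] \<sigma>_le[of "Suc k"] k by (auto simp: lo_def hi_def)
  have len: "\<bar>?v - ?u\<bar> = hi - lo" by (auto simp: lo_def hi_def)
  show "\<bar>Y t\<bar> \<le> hi - lo"
    unfolding Y len[symmetric] using plateau_bounds[of "t - k"] by (intro mult_left_le) auto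
  have r: "0 \<le> ramp (t - k)" "ramp (t - k) \<le> 1" by (rule ramp_bounds)+
  have X': "X t = (1 - ramp (t - k)) * ?u + ramp (t - k) * ?v" by (simp add: X algebra_simps)
  have "lo \<le> ?u" "lo \<le> ?v" "?u \<le> hi" "?v \<le> hi" by (auto simp: lo_def hi_def)
  then show "lo \<le> X t" "X t \<le> hi"
    unfolding X' using r convex_bound_le[of ?u hi ?v "1 - ramp (t - k)" "ramp (t - k)"]
      convex_bound_le[of "- ?u" "- lo" "- ?v" "1 - ramp (t - k)" "ramp (t - k)"] by auto
  have "?u = lo \<and> ?v = hi \<or> ?u = hi \<and> ?v = lo" by (auto simp: lo_def hi_def min_def max_def)
  moreover consider "ramp (t - k) = 0" | "ramp (t - k) = 1" | "plateau (t - k) = 1"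
    using ramp_or_plateau[of "t - k"] t by auto
  then have "X t = ?u \<or> X t = ?v \<or> \<bar>Y t\<bar> = hi - lo"
    by cases (simp_all add: X Y len)
  ultimately show "X t = lo \<or> X t = hi \<or> \<bar>Y t\<bar> = hi - lo" by metis
qed

lemma Y_sign:
  assumes "k \<le> N" "real k < t" "t < real k + 1"
  shows "0 < (-1) ^ k * Y t"
proof -
  consider "k = 0" | "k = N" "k \<noteq> 0" | "1 \<le> k" "k < N" using assms by linarith
  then show ?thesis
  proof cases
    case 1
    then show ?thesis using assms curve_start[of t] height_pos by simp
  next
    case 2
    then show ?thesis using assms curve_end[of t] height_pos by simp
  next
    case 3
    have "\<sigma> (Suc k) \<noteq> \<sigma> k" using \<sigma>_eq_iff[of "Suc k" k] 3 by auto
    then have "0 < \<bar>real (\<sigma> (Suc k)) - real (\<sigma> k)\<bar> * plateau (t - k)"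
      using assms by (intro mult_pos_pos plateau_pos) auto
    moreover have "(-1) ^ k * Y t = ((-1) ^ k * (-1) ^ k) * (\<bar>real (\<sigma> (Suc k)) - real (\<sigma> k)\<bar> * plateau (t - k))"
      using curve_arch(2)[OF 3] assms by simp
    moreover have "(-1 :: real) ^ k * (-1) ^ k = 1" by (simp flip: power_mult_distrib)
    ultimately show ?thesis by simp
  qed
qed

lemma open_piece_cases:
  assumes "0 \<le> t" "t \<le> real N + 1" "t \<noteq> 0" "t \<noteq> real N + 1"
  obtains k where "1 \<le> k" "k \<le> N" "t = real k" | k where "k \<le> N" "real k < t" "t < real k + 1"
proof -
  define k where "k = nat \<lfloor>t\<rfloor>"
  have k: "real k \<le> t" "t < real k + 1" using assms unfolding k_def by linarith+
  then have "k \<le> N" using assms by linarith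
  show ?thesis
  proof (cases "t = real k")
    case True
    then show ?thesis using that(1)[of k] assms \<open>k \<le> N\<close> by (cases k) auto
  next
    case False
    then show ?thesis using that(2)[of k] k \<open>k \<le> N\<close> by auto
  qed
qed

lemma Y_eq_0_iff:
  assumes "0 \<le> t" "t \<le> real N + 1"
  shows "Y t = 0 \<longleftrightarrow> t \<in> real ` {1..N}"
proof
  assume Y: "Y t = 0"
  have "t \<noteq> 0" "t \<noteq> real N + 1"
    using Y curve_start(2)[of 0] curve_end(2)[of "real N + 1"] height_pos by auto
  from assms this show "t \<in> real ` {1..N}"
  proof (cases rule: open_piece_cases)
    case (2 k)
    then show ?thesis using Y_sign[of k t] Y by simp
  qed auto
qed (use Y_nat in auto)

text \<open>The ends of the curve are put into the adjacent vertical pieces.\<close>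

lemma half_open_piece:
  assumes "0 \<le> t" "t \<le> real N + 1" "Y t \<noteq> 0"
  obtains k where "k \<le> N" "real k \<le> t" "t \<le> real k + 1" "0 < (-1) ^ k * Y t"
    "k = 0 \<Longrightarrow> t < 1" "k = N \<Longrightarrow> real N < t" "k \<noteq> 0 \<Longrightarrow> k \<noteq> N \<Longrightarrow> real k < t \<and> t < real k + 1"
proof -
  consider "t = 0" | "t = real N + 1" | "t \<noteq> 0" "t \<noteq> real N + 1" by blast
  then show ?thesis
  proof cases
    case 1
    then show ?thesis using that[of 0] curve_start(2)[of 0] height_pos n by simp
  next
    case 2
    then show ?thesis using that[of N] curve_end(2)[of t] height_pos n by simp
  next
    case 3
    from assms(1,2) this show ?thesis
    proof (cases rule: open_piece_cases)
      case (1 k)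
      then show ?thesis using Y_nat assms by simp
    next
      case (2 k)
      then show ?thesis using that[of k] Y_sign[of k t] by auto
    qed
  qed
qed

lemma arch_avoids:
  assumes k: "1 \<le> k" "k < N" and t: "real k \<le> t" "t \<le> real k + 1"
    and x: "(\<sigma> k < x) = (\<sigma> (Suc k) < x)" "x \<noteq> \<sigma> k" "x \<noteq> \<sigma> (Suc k)"
  shows "X t \<noteq> real x"
  using arch_facts(1,2)[OF k t] x by (auto simp: min_def max_def split: if_splits)

text \<open>Noncrossing bases are disjoint or strictly nested. In the nested case a point of the
  inner arch is strictly between the vertical sides of the outer one and strictly below its
  top.\<close>

lemma arches_disjoint:
  assumes j: "1 \<le> j" "j < N" "real j \<le> t" "t \<le> real j + 1"
    and k: "1 \<le> k" "k < N" "real k \<le> s" "s \<le> real k + 1"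
    and jk: "j \<noteq> k" "even j = even k"
  shows "\<not> (X t = X s \<and> Y t = Y s)"
proof
  assume eq: "X t = X s \<and> Y t = Y s"
  let ?lo = "\<lambda>i. min (\<sigma> i) (\<sigma> (Suc i))" and ?hi = "\<lambda>i. max (\<sigma> i) (\<sigma> (Suc i))"
  have "j \<noteq> Suc k" "Suc j \<noteq> k" using jk by auto
  then have "\<sigma> j \<noteq> \<sigma> k" "\<sigma> j \<noteq> \<sigma> (Suc k)" "\<sigma> (Suc j) \<noteq> \<sigma> k" "\<sigma> (Suc j) \<noteq> \<sigma> (Suc k)"
    using \<sigma>_eq_iff j k jk by auto
  moreover have "\<not> interleaved (\<sigma> j) (\<sigma> (Suc j)) (\<sigma> k) (\<sigma> (Suc k))"
    using meandric j k jk by (auto simp: meandric_def)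
  ultimately have "?hi j < ?lo k \<or> ?hi k < ?lo j \<or> (?lo j < ?lo k \<and> ?hi k < ?hi j) \<or> (?lo k < ?lo j \<and> ?hi j < ?hi k)"
    unfolding interleaved_def by linarith
  then show False
    using arch_facts(1-4)[OF j] arch_facts(1-4)[OF k] eq
    unfolding of_nat_less_iff[where 'a = real, symmetric] by linarith
qed

text \<open>Off the axis the sign of \<open>Y\<close> gives the parity of the piece, different
  pieces of equal parity are disjoint, and each piece is traversed injectively. On the axis the
  points are the crossings, which are distinct because \<open>\<sigma>\<close> is injective.\<close>

lemma curve_inj:
  assumes s: "0 \<le> s" "s \<le> real N + 1" and t: "0 \<le> t" "t \<le> real N + 1" and eq: "X s = X t" "Y s = Y t"
  shows "s = t"
proof (cases "Y s = 0")
  case True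
  then obtain j k where "j \<in> {1..N}" "k \<in> {1..N}" "s = real j" "t = real k"
    using Y_eq_0_iff[OF s] Y_eq_0_iff[OF t] eq by auto
  then show ?thesis using X_nat[of j] X_nat[of k] eq \<sigma>_eq_iff[of j k] by auto
next
  case False
  obtain j where j: "j \<le> N" "real j \<le> s" "s \<le> real j + 1" "0 < (-1) ^ j * Y s"
    using half_open_piece[OF s False] by metis
  obtain k where k: "k \<le> N" "real k \<le> t" "t \<le> real k + 1" "0 < (-1) ^ k * Y t"
    using half_open_piece[OF t] False eq by metis
  have even: "even j = even k"
    using j(4) k(4) eq(2) by (cases "even j"; cases "even k") auto
  \<comment> \<open>The initial stem is met by no other piece on the upper side: the final stem
    stands over a larger label, and no even arch passes over \<open>\<sigma> 1\<close>.\<close>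
  have first: False if "k' \<noteq> 0" "k' \<le> N" "even k'" "real k' \<le> t'" "t' \<le> real k' + 1" "X t' = \<sigma> 1" for k' t'
  proof (cases "k' = N")
    case True
    then show False using that curve_end(1)[of t'] first_less_last by simp
  next
    case False
    have "k' \<noteq> 1" using that by auto
    then show False
      using arch_avoids[of k' t' "\<sigma> 1"] first_exposed[of k'] \<sigma>_eq_iff[of k' 1] \<sigma>_eq_iff[of "Suc k'" 1] that False by auto
  qed
  have last: False if "k' \<noteq> 0" "k' < N" "even k'" "real k' \<le> t'" "t' \<le> real k' + 1" "X t' = \<sigma> N" for k' t'
  proof -
    have "Suc k' \<noteq> N" using that(3) by (metis even_Suc dvd_triv_left)
    then show False
      using arch_avoids[of k' t' "\<sigma> N"] last_exposed[of k'] \<sigma>_eq_iff[of k' N] \<sigma>_eq_iff[of "Suc k'" N] that by auto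
  qed
  have "j = k"
  proof (rule ccontr)
    assume "j \<noteq> k"
    consider "j = 0" | "k = 0" | "j \<noteq> 0" "k \<noteq> 0" "j = N" | "j \<noteq> 0" "k \<noteq> 0" "k = N"
      | "1 \<le> j" "j < N" "1 \<le> k" "k < N" using j(1) k(1) by linarith
    then show False
    proof cases
      case 1
      then show False using first[of k t] curve_start(1)[of s] j k s even eq \<open>j \<noteq> k\<close> by auto
    next
      case 2
      then show False using first[of j s] curve_start(1)[of t] j k t even eq \<open>j \<noteq> k\<close> by auto
    next
      case 3
      then show False using last[of k t] curve_end(1)[of s] j k even eq \<open>j \<noteq> k\<close> by auto
    next
      case 4
      then show False using last[of j s] curve_end(1)[of t] j k even eq \<open>j \<noteq> k\<close> by auto
    next
      case 5
      then show False using arches_disjoint[of j s k t] j k eq even \<open>j \<noteq> k\<close> by auto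
    qed
  qed
  consider "j = 0" | "j = N" "j \<noteq> 0" | "1 \<le> j" "j < N" using j(1) by linarith
  then show ?thesis
  proof cases
    case 1
    then have "s \<le> 1" "t \<le> 1" using j(3) k(3) \<open>j = k\<close> by simp_all
    then have "height * (1 - s) = height * (1 - t)"
      using curve_start(2)[OF s(1)] curve_start(2)[OF t(1)] eq(2) by metis
    then show ?thesis using height_pos unfolding mult_cancel_left by linarith
  next
    case 2
    then have "real N \<le> s" "real N \<le> t" using j(2) k(2) \<open>j = k\<close> by simp_all
    then have "height * (s - N) = height * (t - N)"
      using curve_end(2)[of s] curve_end(2)[of t] eq(2) by metis
    then show ?thesis using height_pos unfolding mult_cancel_left by linarith
  next
    case 3
    have "real (\<sigma> (Suc j)) \<noteq> real (\<sigma> j)" using \<sigma>_eq_iff[of "Suc j" j] 3 by auto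
    moreover have "real j \<le> t" "t \<le> real j + 1" using k \<open>j = k\<close> by simp_all
    note curve_arch[OF 3 this] curve_arch[OF 3 j(2,3)]
    ultimately have "ramp (s - j) = ramp (t - j)" "plateau (s - j) = plateau (t - j)"
      using eq by simp_all
    moreover have "0 \<le> s - j" "s - j \<le> 1" "0 \<le> t - j" "t - j \<le> 1"
      using j(2,3) k(2,3) \<open>j = k\<close> by simp_all
    ultimately have "s - j = t - j" by (metis ramp_plateau_inj)
    then show ?thesis by simp
  qed
qed

definition \<gamma> :: "real \<Rightarrow> complex" where
  "\<gamma> s = Complex (X (height * s)) (Y (height * s))"

abbreviation "L \<equiv> closed_segment 0 (complex_of_real height)"

lemma height_eq: "height = real N + 1" by (rule height_def)

lemma L_eq: "L = {z. Im z = 0 \<and> 0 \<le> Re z \<and> Re z \<le> height}"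
  using height_pos by (subst horizontal_segment) auto

lemma scale_mem: "s \<in> {0..1} \<Longrightarrow> 0 \<le> height * s \<and> height * s \<le> real N + 1"
  using height_pos mult_left_le[of s height] by (auto simp: height_eq)

lemma continuous_on_X: "continuous_on UNIV X" and continuous_on_Y: "continuous_on UNIV Y"
  unfolding X_def Y_def
  by (intro continuous_intros continuous_on_compose2[OF continuous_on_ramp]
      continuous_on_compose2[OF continuous_on_plateau]; simp)+

lemma arc_\<gamma>: "arc \<gamma>"
  unfolding arc_def path_def
proof
  have "continuous_on {0..1} (\<lambda>s. complex_of_real (X (height * s)) + \<i> * complex_of_real (Y (height * s)))"
    by (intro continuous_intros continuous_on_compose2[OF continuous_on_X] continuous_on_compose2[OF continuous_on_Y]) auto
  then show "continuous_on {0..1} \<gamma>" by (simp add: \<gamma>_def[abs_def] Complex_eq)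
  show "inj_on \<gamma> {0..1}"
  proof (rule inj_onI)
    fix s t assume st: "s \<in> {0..1}" "t \<in> {0..1}" "\<gamma> s = \<gamma> t"
    then have "height * s = height * t"
      using curve_inj[of "height * s" "height * t"] scale_mem[of s] scale_mem[of t] by (simp add: \<gamma>_def)
    then show "s = t" using height_pos by simp
  qed
qed

lemma path_image_iff: "z \<in> path_image \<gamma> \<longleftrightarrow> (\<exists>t. 0 \<le> t \<and> t \<le> real N + 1 \<and> Re z = X t \<and> Im z = Y t)"
proof
  assume "z \<in> path_image \<gamma>"
  then obtain s where "z = \<gamma> s" "s \<in> {0..1}" unfolding path_image_def by (rule imageE)
  then show "\<exists>t. 0 \<le> t \<and> t \<le> real N + 1 \<and> Re z = X t \<and> Im z = Y t"
    using scale_mem[of s] by (intro exI[of _ "height * s"]) (simp add: \<gamma>_def)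
next
  assume "\<exists>t. 0 \<le> t \<and> t \<le> real N + 1 \<and> Re z = X t \<and> Im z = Y t"
  then obtain t where t: "0 \<le> t" "t \<le> height" "Re z = X t" "Im z = Y t" by (auto simp: height_eq)
  then have "t / height \<in> {0..1}" "z = \<gamma> (t / height)"
    using height_pos by (simp_all add: \<gamma>_def complex_eq_iff)
  then show "z \<in> path_image \<gamma>" unfolding path_image_def by (rule_tac image_eqI)
qed

text \<open>The drawn closing arcs run outside the strip from 1 to \<open>N\<close> or at level
  \<open>height\<close> and above. With these bounds they can touch the curve only at its two
  ends.\<close>

lemma curve_bounds:
  assumes "0 \<le> t" "t \<le> real N + 1"
  shows "1 \<le> X t" "X t \<le> N" "Y t \<le> height" "Y t = height \<Longrightarrow> t = 0 \<or> t = height"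
proof -
  have "1 \<le> X t \<and> X t \<le> N \<and> Y t \<le> height \<and> (Y t = height \<longrightarrow> t = 0 \<or> t = height)"
    using assms
  proof (cases rule: piece_cases)
    case 1
    then show ?thesis
      using curve_start[of t] assms height_pos \<sigma>_pos[of 1] \<sigma>_le[of 1] n by (auto simp: mult_le_cancel_left1)
  next
    case (2 k)
    then show ?thesis using arch_facts[OF 2] by (auto simp: height_eq)
  next
    case 3
    have "height * (t - N) = height \<longleftrightarrow> t - N = 1" "height * (t - N) \<le> height"
      using assms(2) height_pos by (simp_all add: mult_left_le)
    then have "height * (t - N) = height \<longleftrightarrow> t = height" "height * (t - N) \<le> height"
      by (auto simp: height_eq)
    then show ?thesis
      using curve_end[OF 3] \<sigma>_pos[of N] \<sigma>_le[of N] n by auto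
  qed
  then show "1 \<le> X t" "X t \<le> N" "Y t \<le> height" "Y t = height \<Longrightarrow> t = 0 \<or> t = height" by auto
qed

text \<open>Every arch has height at least 1, so at distance less than 1 from the axis the curve is
  on a vertical side or a stem, and these stand over integers.\<close>

lemma near_crossing:
  assumes t: "0 \<le> t" "t \<le> real N + 1" and near: "\<bar>X t - real m\<bar> < 1" "\<bar>Y t\<bar> < 1"
  shows "X t = real m"
  using t
proof (cases rule: piece_cases)
  case 1
  then show ?thesis using curve_start[of t] t near by auto
next
  case (2 k)
  then obtain l :: nat where "X t = real l"
    using arch_facts(4,5)[OF 2] near by auto
  then show ?thesis using near by auto
next
  case 3
  then show ?thesis using curve_end[of t] near by auto
qed

text \<open>Just before a crossing the curve is vertical up to distance 1: on the initial stem if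
  \<open>k = 1\<close>, and otherwise on the last side of an arch of height at least 1.\<close>

lemma stem_before:
  assumes k: "1 \<le> k" "k \<le> N" and y: "0 \<le> y" "y < 1"
  obtains t where "0 \<le> t" "t \<le> real N + 1" "X t = \<sigma> k" "Y t = - ((-1) ^ k * y)"
proof (cases "k = 1")
  case True
  have t: "0 \<le> 1 - y / height" "1 - y / height \<le> 1"
    using y height_pos by (auto simp: height_eq field_simps)
  then show ?thesis
    using that[of "1 - y / height"] curve_start[of "1 - y / height"] True height_pos n by simp
next
  case False
  define j where "j = k - 1"
  have j: "1 \<le> j" "j < N" "k = Suc j" using k False by (auto simp: j_def)
  define d where "d = \<bar>real (\<sigma> (Suc j)) - real (\<sigma> j)\<bar>"
  have d: "1 \<le> d" using \<sigma>_eq_iff[of "Suc j" j] j by (simp add: d_def)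
  \<comment> \<open>In its last third the arch approaches the axis at rate \<open>3 * d\<close>, so
    this is the time at distance \<open>y\<close> from the crossing; \<open>y < 1\<close> and
    \<open>1 \<le> d\<close> keep it within that third.\<close>
  define s where "s = 1 - y / (3 * d)"
  have "y / (3 * d) \<le> 1 / 3" using y d by (simp add: field_simps)
  then have s: "2/3 \<le> s" "s \<le> 1" using y d by (auto simp: s_def)
  have t: "real j \<le> real j + s" "real j + s \<le> real j + 1" using s by auto
  have "X (real j + s) = \<sigma> k" "Y (real j + s) = (-1) ^ j * (d * (3 - 3 * s))"
    using curve_arch[OF j(1,2) t] s by (simp_all add: ramp_simps plateau_simps d_def j)
  moreover have "d * (3 - 3 * s) = y" using d by (simp add: s_def field_simps)
  ultimately show ?thesis using that[of "real j + s"] j s by simp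
qed

lemma stem_after:
  assumes k: "1 \<le> k" "k \<le> N" and y: "0 \<le> y" "y < 1"
  obtains t where "0 \<le> t" "t \<le> real N + 1" "X t = \<sigma> k" "Y t = (-1) ^ k * y"
proof (cases "k = N")
  case True
  have "y / height \<le> 1" using y height_pos by (auto simp: height_eq field_simps)
  then show ?thesis
    using that[of "N + y / height"] curve_end[of "N + y / height"] True height_pos y by simp
next
  case False
  then have j: "1 \<le> k" "k < N" using k by auto
  define d where "d = \<bar>real (\<sigma> (Suc k)) - real (\<sigma> k)\<bar>"
  have d: "1 \<le> d" using \<sigma>_eq_iff[of "Suc k" k] j by (simp add: d_def)
  define s where "s = y / (3 * d)"
  have s: "0 \<le> s" "s \<le> 1/3" using y d by (auto simp: s_def field_simps)
  have t: "real k \<le> real k + s" "real k + s \<le> real k + 1" using s by auto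
  have "X (real k + s) = \<sigma> k" "Y (real k + s) = (-1) ^ k * (d * (3 * s))"
    using curve_arch[OF j t] s by (simp_all add: ramp_simps plateau_simps d_def)
  moreover have "d * (3 * s) = y" using d by (simp add: s_def)
  ultimately show ?thesis using that[of "real k + s"] j s by simp
qed

text \<open>The incoming and the outgoing strand reach the crossing from opposite sides of the axis,
  and the sign of \<open>(-1) ^ k * y\<close> decides which of them contains the point.\<close>

lemma stem:
  assumes k: "1 \<le> k" "k \<le> N" and y: "\<bar>y\<bar> < 1"
  shows "Complex (\<sigma> k) y \<in> path_image \<gamma>"
proof (cases "0 \<le> (-1) ^ k * y")
  case True
  obtain t where "0 \<le> t" "t \<le> real N + 1" "X t = \<sigma> k" "Y t = (-1) ^ k * \<bar>y\<bar>"
    using stem_after[OF k, of "\<bar>y\<bar>"] y by auto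
  moreover have "(-1) ^ k * \<bar>y\<bar> = y" using True by (cases "even k") auto
  ultimately show ?thesis by (auto simp: path_image_iff)
next
  case False
  obtain t where "0 \<le> t" "t \<le> real N + 1" "X t = \<sigma> k" "Y t = - ((-1) ^ k * \<bar>y\<bar>)"
    using stem_before[OF k, of "\<bar>y\<bar>"] y by auto
  moreover have "- ((-1) ^ k * \<bar>y\<bar>) = y" using False by (cases "even k") auto
  ultimately show ?thesis by (auto simp: path_image_iff)
qed

section \<open>The drawing is a closable open meander with permutation \<sigma>\<close>

lemma crossing_times_eq: "crossing_times 0 height \<gamma> = (\<lambda>k. real k / height) ` {1..N}"
proof -
  have on_L: "\<gamma> s \<in> L \<longleftrightarrow> height * s \<in> real ` {1..N}" if "s \<in> {0..1}" for s
  proof -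
    have "0 \<le> X (height * s)" "X (height * s) \<le> height"
      using curve_bounds(1,2)[of "height * s"] scale_mem[OF that] height_eq by auto
    then have "\<gamma> s \<in> L \<longleftrightarrow> Y (height * s) = 0" unfolding L_eq by (simp add: \<gamma>_def)
    then show ?thesis using Y_eq_0_iff[of "height * s"] scale_mem[OF that] by simp
  qed
  show ?thesis
  proof
    show "crossing_times 0 height \<gamma> \<subseteq> (\<lambda>k. real k / height) ` {1..N}"
    proof
      fix s assume "s \<in> crossing_times 0 height \<gamma>"
      then have "height * s \<in> real ` {1..N}" using on_L by (auto simp: crossing_times_def)
      then obtain k where "height * s = real k" "k \<in> {1..N}" by (rule imageE)
      then show "s \<in> (\<lambda>k. real k / height) ` {1..N}"
        using height_pos by (intro image_eqI[of _ _ k]) (simp_all add: field_simps)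
    qed
    show "(\<lambda>k. real k / height) ` {1..N} \<subseteq> crossing_times 0 height \<gamma>"
    proof
      fix s assume "s \<in> (\<lambda>k. real k / height) ` {1..N}"
      then obtain k where "s = real k / height" "k \<in> {1..N}" by (rule imageE)
      then have "s \<in> {0..1}" "height * s \<in> real ` {1..N}"
        using height_pos by (auto simp: height_eq)
      then show "s \<in> crossing_times 0 height \<gamma>" using on_L by (simp add: crossing_times_def)
    qed
  qed
qed

lemma \<gamma>_crossing: "1 \<le> k \<Longrightarrow> k \<le> N \<Longrightarrow> \<gamma> (real k / height) = complex_of_nat (\<sigma> k)"
  using X_nat[of k] Y_nat[of k] height_pos by (simp add: \<gamma>_def complex_eq_iff)

lemma crossings_eq: "crossings 0 height \<gamma> = complex_of_nat ` {1..N}"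
proof -
  have "crossings 0 height \<gamma> = \<gamma> ` crossing_times 0 height \<gamma>"
    by (auto simp: crossings_def crossing_times_def path_image_def)
  also have "\<dots> = complex_of_nat ` \<sigma> ` {1..N}"
    unfolding crossing_times_eq image_image by (intro image_cong) (auto simp: \<gamma>_crossing)
  finally show ?thesis by (simp only: \<sigma>_image)
qed

lemma label_eq: "m \<le> N \<Longrightarrow> label 0 height \<gamma> (complex_of_nat m) = m"
proof -
  assume "m \<le> N"
  then have "{q \<in> crossings 0 height \<gamma>. Re q \<le> Re (complex_of_nat m)} = complex_of_nat ` {1..m}"
    unfolding crossings_eq by auto
  then show ?thesis by (simp add: label_def card_image inj_on_def)
qed

lemma meandric_permutation_eq:
  assumes "1 \<le> k" "k \<le> N" shows "meandric_permutation 0 height \<gamma> k = \<sigma> k"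
proof -
  have "sorted_list_of_set (crossing_times 0 height \<gamma>) = map (\<lambda>k. real k / height) [1..<N + 1]"
  proof (rule sorted_distinct_set_unique)
    show "sorted (map (\<lambda>k. real k / height) [1..<N + 1])"
      unfolding sorted_map
      by (rule sorted_wrt_mono_rel[OF _ sorted_upt]) (use height_pos in \<open>simp add: divide_right_mono\<close>)
    show "distinct (map (\<lambda>k. real k / height) [1..<N + 1])"
      using height_pos by (auto simp: distinct_map inj_on_def)
    show "set (sorted_list_of_set (crossing_times 0 height \<gamma>)) = set (map (\<lambda>k. real k / height) [1..<N + 1])"
      by (simp add: crossing_times_eq atLeastLessThanSuc_atLeastAtMost del: upt_Suc)
  qed auto
  moreover have "[1..<N + 1] ! (k - 1) = k"
    using assms by (subst nth_upt) auto
  ultimately have "sorted_list_of_set (crossing_times 0 height \<gamma>) ! (k - 1) = real k / height"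
    using assms by (simp del: upt_Suc)
  then show ?thesis
    using assms label_eq[OF \<sigma>_le] by (simp add: meandric_permutation_def \<gamma>_crossing)
qed

lemma transversal_crossing:
  assumes "p \<in> crossings 0 height \<gamma>"
  shows "crosses_transversally_at L (path_image \<gamma>) p"
proof -
  have "p \<in> complex_of_nat ` \<sigma> ` {1..N}" using assms by (simp only: crossings_eq \<sigma>_image)
  then obtain k where k: "1 \<le> k" "k \<le> N" "p = complex_of_nat (\<sigma> k)" by auto
  have near: "\<bar>Re z - \<sigma> k\<bar> < 1/2" "\<bar>Im z\<bar> < 1/2" if "z \<in> ball p (1/2)" for z
    using that abs_Re_le_cmod[of "z - p"] abs_Im_le_cmod[of "z - p"]
    by (auto simp: k(3) dist_norm norm_minus_commute)
  show ?thesis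
  \<comment> \<open>Radius 1/2 stays clear of the tops of the arches, of the neighbouring integer
    columns and of the ends of the line.\<close>
  proof (rule crosses_transversally_axes[of "1/2" 1])
    fix z assume z: "z \<in> ball p (1/2)"
    have "1 \<le> real (\<sigma> k)" "real (\<sigma> k) + 1 \<le> height"
      using \<sigma>_pos[of k] \<sigma>_le[of k] k by (auto simp: height_eq)
    then have "0 \<le> Re z" "Re z \<le> height" using near(1)[OF z] by linarith+
    then show "z \<in> L \<longleftrightarrow> Im (1 * (z - p)) = 0" unfolding L_eq by (simp add: k(3))
    show "z \<in> path_image \<gamma> \<longleftrightarrow> Re (1 * (z - p)) = 0"
    proof
      assume "z \<in> path_image \<gamma>"
      then obtain t where "0 \<le> t" "t \<le> real N + 1" "Re z = X t" "Im z = Y t"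
        by (auto simp: path_image_iff)
      then show "Re (1 * (z - p)) = 0" using near_crossing[of t "\<sigma> k"] near[OF z] by (simp add: k(3))
    next
      assume "Re (1 * (z - p)) = 0"
      then have "z = Complex (\<sigma> k) (Im z)" by (simp add: k(3) complex_eq_iff)
      then show "z \<in> path_image \<gamma>" using stem[OF k(1,2), of "Im z"] near[OF z] by simp
    qed
  qed auto
qed

lemma ends: "\<gamma> 0 = Complex (\<sigma> 1) height" "\<gamma> 1 = Complex (\<sigma> N) height"
  using curve_start[of 0] curve_end[of height] by (simp_all add: \<gamma>_def height_eq)

lemma open_meander_\<gamma>: "open_meander n 0 height \<gamma>"
  unfolding open_meander_def
proof (intro conjI ballI impI)
  show "0 \<notin> path_image \<gamma>" "complex_of_real height \<notin> path_image \<gamma>"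
    using curve_bounds(1,2) by (force simp: path_image_iff height_eq)+
  show "pathstart \<gamma> \<notin> L" "pathfinish \<gamma> \<notin> L"
    using ends height_pos by (auto simp: pathstart_def pathfinish_def L_eq)
  show "finite (crossings 0 height \<gamma>)" "card (crossings 0 height \<gamma>) = 2 * n"
    by (simp_all add: crossings_eq card_image inj_on_def)
  fix t assume "t \<in> crossing_times 0 height \<gamma>" and label: "label 0 height \<gamma> (\<gamma> t) = 1"
  then obtain k where k: "1 \<le> k" "k \<le> N" "t = real k / height" by (auto simp: crossing_times_eq)
  then have "\<sigma> k = 1" using label label_eq[OF \<sigma>_le[of k]] \<gamma>_crossing by simp
  \<comment> \<open>Parity fixes the orientation: the label 1 is met at an odd time, so the strand
    before it is above the line and the strand after it is below.\<close>
  then have "odd k" using parity[of k] k by auto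
  have "k \<noteq> N" using \<open>odd k\<close> by auto
  have mem: "height * s \<in> {real j<..<real i}" if "s \<in> {real j / height<..<real i / height}" for s i j
    using that height_pos by (auto simp: field_simps)
  have "\<forall>\<^sub>F s in at_left t. s \<in> {real (k - 1) / height<..<t}"
    using k height_pos by (intro eventually_at_leftI[of "real (k - 1) / height"]) (auto simp: divide_strict_right_mono)
  then show "\<forall>\<^sub>F s in at_left t. Im (\<gamma> s) > Im 0"
  proof (rule eventually_mono)
    fix s assume "s \<in> {real (k - 1) / height<..<t}"
    then have "height * s \<in> {real (k - 1)<..<real k}" using mem[of s "k - 1" k] k by simp
    then show "Im (\<gamma> s) > Im 0"
      using Y_sign[of "k - 1" "height * s"] \<open>odd k\<close> k by (simp add: \<gamma>_def)
  qed
  have "\<forall>\<^sub>F s in at_right t. s \<in> {t<..<real (Suc k) / height}"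
    using k height_pos by (intro eventually_at_rightI[of _ "real (Suc k) / height"]) (auto simp: divide_strict_right_mono)
  then show "\<forall>\<^sub>F s in at_right t. Im (\<gamma> s) < Im 0"
  proof (rule eventually_mono)
    fix s assume "s \<in> {t<..<real (Suc k) / height}"
    then have "height * s \<in> {real k<..<real (Suc k)}" using mem[of s k "Suc k"] k by simp
    then show "Im (\<gamma> s) < Im 0"
      using Y_sign[of k "height * s"] \<open>odd k\<close> k by (simp add: \<gamma>_def)
  qed
qed (use height_pos arc_\<gamma> transversal_crossing in auto)

text \<open>The arc \<open>\<alpha>\<close> passes over the right end of the drawing at level
  \<open>height + 2\<close> and descends to the start of the curve; \<open>\<beta>\<close> rises
  from its finish to level \<open>height + 1\<close> and runs left to the column 0. Since
  \<open>\<sigma> 1 < \<sigma> N\<close>, the horizontal part of \<open>\<beta>\<close> crosses the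
  descending part of \<open>\<alpha>\<close>, and the different levels exclude any other common
  point.\<close>

lemma closable_\<gamma>: "closable 0 height \<gamma>"
proof -
  let ?x = "real (\<sigma> 1)" and ?y = "real (\<sigma> N)" and ?h = height
  have xy: "1 \<le> ?x" "?x + 1 \<le> ?y" "?y \<le> N" "real N + 1 = ?h" "?h > 0"
    using \<sigma>_pos[of 1] first_less_last \<sigma>_le[of N] n by (auto simp: height_eq)
  obtain \<alpha> where \<alpha>: "arc \<alpha>" "pathstart \<alpha> = Complex ?h 0" "pathfinish \<alpha> = Complex ?x ?h" and
    \<alpha>_im: "path_image \<alpha> = {z. Re z = ?h \<and> 0 \<le> Im z \<and> Im z \<le> ?h + 2} \<union>
       ({z. Im z = ?h + 2 \<and> min ?h ?x \<le> Re z \<and> Re z \<le> max ?h ?x} \<union> {z. Re z = ?x \<and> ?h \<le> Im z \<and> Im z \<le> ?h + 2})"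
    by (rule rectangular_arc[of ?h ?x 0 "?h + 2" ?h]) (use xy in auto)
  obtain \<beta> where \<beta>: "arc \<beta>" "pathstart \<beta> = Complex ?y ?h" "pathfinish \<beta> = Complex 0 0" and
    \<beta>_im: "path_image \<beta> = {z. Re z = ?y \<and> ?h \<le> Im z \<and> Im z \<le> ?h + 1} \<union>
       ({z. Im z = ?h + 1 \<and> min ?y 0 \<le> Re z \<and> Re z \<le> max ?y 0} \<union> {z. Re z = 0 \<and> 0 \<le> Im z \<and> Im z \<le> ?h + 1})"
    by (rule rectangular_arc[of ?y 0 ?h "?h + 1" 0]) (use xy in auto)
  define c where "c = Complex ?x (?h + 1)"
  have corners: "Complex ?h 0 = complex_of_real ?h" "Complex 0 0 = 0" by (simp_all add: complex_eq_iff)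
  have \<gamma>_bounds: "1 \<le> Re z" "Re z \<le> N" "Im z \<le> ?h" "Im z = ?h \<Longrightarrow> z = \<gamma> 0 \<or> z = \<gamma> 1"
    if z: "z \<in> path_image \<gamma>" for z
  proof -
    obtain t where t: "0 \<le> t" "t \<le> real N + 1" "Re z = X t" "Im z = Y t"
      using z unfolding path_image_iff by blast
    show "1 \<le> Re z" "Re z \<le> N" "Im z \<le> ?h" using curve_bounds(1-3)[OF t(1,2)] t(3,4) by simp_all
    assume "Im z = ?h"
    then have "t = 0 \<or> t = height" using curve_bounds(4)[OF t(1,2)] t(4) by simp
    moreover have "z = Complex (X t) (Y t)" using t(3,4) by (simp add: complex_eq_iff)
    ultimately show "z = \<gamma> 0 \<or> z = \<gamma> 1" by (auto simp: \<gamma>_def)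
  qed
  have mem: "\<gamma> 0 \<in> path_image \<gamma>" "\<gamma> 1 \<in> path_image \<gamma>" by (simp_all add: path_image_def)
  have "path_image \<alpha> \<inter> (L \<union> path_image \<gamma>) = {complex_of_real ?h, pathstart \<gamma>}"
  proof
    show "path_image \<alpha> \<inter> (L \<union> path_image \<gamma>) \<subseteq> {complex_of_real ?h, pathstart \<gamma>}"
    proof
      fix z assume z: "z \<in> path_image \<alpha> \<inter> (L \<union> path_image \<gamma>)"
      then consider "z \<in> L" | "z \<in> path_image \<gamma>" by blast
      then show "z \<in> {complex_of_real ?h, pathstart \<gamma>}"
      proof cases
        case 1
        then have "z = complex_of_real ?h" using z xy by (auto simp: L_eq \<alpha>_im complex_eq_iff)
        then show ?thesis by simp
      next
        case 2
        then have "Re z = ?x \<and> Im z = ?h" using z xy \<gamma>_bounds(1-3)[OF 2] by (auto simp: \<alpha>_im)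
        then show ?thesis by (simp add: complex_eq_iff ends pathstart_def)
      qed
    qed
    show "{complex_of_real ?h, pathstart \<gamma>} \<subseteq> path_image \<alpha> \<inter> (L \<union> path_image \<gamma>)"
      using mem xy by (auto simp: \<alpha>_im ends pathstart_def)
  qed
  moreover have "path_image \<beta> \<inter> (L \<union> path_image \<gamma>) = {pathfinish \<gamma>, 0}"
  proof
    show "path_image \<beta> \<inter> (L \<union> path_image \<gamma>) \<subseteq> {pathfinish \<gamma>, 0}"
    proof
      fix z assume z: "z \<in> path_image \<beta> \<inter> (L \<union> path_image \<gamma>)"
      then consider "z \<in> L" | "z \<in> path_image \<gamma>" by blast
      then show "z \<in> {pathfinish \<gamma>, 0}"
      proof cases
        case 1
        then have "z = 0" using z xy by (auto simp: L_eq \<beta>_im complex_eq_iff)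
        then show ?thesis by simp
      next
        case 2
        then have "Re z = ?y \<and> Im z = ?h" using z xy \<gamma>_bounds(1-3)[OF 2] by (auto simp: \<beta>_im)
        then show ?thesis by (simp add: complex_eq_iff ends pathfinish_def)
      qed
    qed
    show "{pathfinish \<gamma>, 0} \<subseteq> path_image \<beta> \<inter> (L \<union> path_image \<gamma>)"
      using mem xy by (auto simp: \<beta>_im ends pathfinish_def)
  qed
  moreover have "path_image \<alpha> \<inter> path_image \<beta> = {c}"
    using xy by (auto simp: \<alpha>_im \<beta>_im c_def complex_eq_iff)
  moreover have "crosses_transversally_at (path_image \<alpha>) (path_image \<beta>) c"
  proof (rule crosses_transversally_axes[of "1/2" "- \<i>"])
    fix z assume "z \<in> ball c (1/2)"
    then have "\<bar>Re z - ?x\<bar> < 1/2" "\<bar>Im z - (?h + 1)\<bar> < 1/2"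
      using abs_Re_le_cmod[of "z - c"] abs_Im_le_cmod[of "z - c"]
      by (auto simp: c_def dist_norm norm_minus_commute)
    then have "?x - 1/2 < Re z" "Re z < ?x + 1/2" "?h + 1/2 < Im z" "Im z < ?h + 3/2"
      by linarith+
    then show "z \<in> path_image \<alpha> \<longleftrightarrow> Im (- \<i> * (z - c)) = 0" "z \<in> path_image \<beta> \<longleftrightarrow> Re (- \<i> * (z - c)) = 0"
      using xy by (auto simp: \<alpha>_im \<beta>_im c_def)
  qed auto
  ultimately show ?thesis
    unfolding closable_def
    using \<alpha> \<beta> by (intro exI[of _ \<alpha>] exI[of _ \<beta>] exI[of _ c]) (simp add: ends pathstart_def[of \<gamma>] pathfinish_def[of \<gamma>] corners)
qed

end

section \<open>Meander graphs\<close>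

text \<open>Giving index 0 the label 0 turns the edges at the vertex 0 into ordinary non-inversions,
  so the whole graph has one uniform description.\<close>

lemma (in closed_meander) edges_eq:
  "meander_graph_edges n a b \<gamma> = {(i, j). i < j \<and> j \<le> 2 * n \<and> perm i < perm j}"
proof -
  have "0 < perm i" if "1 \<le> i" "i \<le> 2 * n" for i
    using perm_eq_iff[OF perm_bij perm_0, of i 0] that perm_0 by (metis gr0I le0 not_one_le_zero)
  then show ?thesis
    by (auto simp: meander_graph_edges_def non_inversions_def perm_def fun_upd_def)
qed

lemma (in meandric_curve) edges_eq:
  "meander_graph_edges n 0 height \<gamma> = {(i, j). i < j \<and> j \<le> 2 * n \<and> \<sigma> i < \<sigma> j}"
proof -
  have "0 < \<sigma> i" if "1 \<le> i" "i \<le> 2 * n" for i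
    using \<sigma>_pos[OF that] by simp
  then show ?thesis
    by (auto simp: meander_graph_edges_def non_inversions_def meandric_permutation_eq zero Suc_le_eq)
qed

lemma meander_graph_permutation:
  assumes "n > 0" and "is_meander_graph n V E"
  obtains \<sigma> where "bij_betw \<sigma> {..2 * n} {..2 * n}" "\<sigma> 0 = 0" "meandric n \<sigma>"
    "E = {(i, j). i < j \<and> j \<le> 2 * n \<and> \<sigma> i < \<sigma> j}"
proof -
  obtain a b \<gamma> where M: "open_meander n a b \<gamma>" "closable a b \<gamma>" and E: "E = meander_graph_edges n a b \<gamma>"
    using assms(2) by (auto simp: is_meander_graph_def)
  obtain \<alpha> \<beta> c where "closed_meander n a b c \<gamma> \<alpha> \<beta>"
    using M assms(1) unfolding closable_def closed_meander_def
    by (auto simp: pathstart_def pathfinish_def)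
  then interpret closed_meander n a b c \<gamma> \<alpha> \<beta> .
  show ?thesis
    using that[OF perm_bij perm_0 meandric_perm] E edges_eq by simp
qed

theorem theorem6:
  fixes n :: nat and V :: "nat set" and E :: "(nat \<times> nat) set"
  assumes "n > 0" and "V = {0..2 * n}" and "simple_graph V E"
  shows "is_meander_graph n V E \<longleftrightarrow>
    (\<forall>i. 1 \<le> i \<and> i \<le> 2 * n \<longrightarrow> (0, i) \<in> E) \<and>
    (\<forall>i j. (i, j) \<in> E \<longrightarrow> (\<forall>k. i < k \<and> k < j \<longrightarrow> (i, k) \<in> E \<or> (k, j) \<in> E)) \<and>
    (\<forall>i j k. i < j \<and> j < k \<and> k \<le> 2 * n \<longrightarrow> (i, j) \<in> E \<and> (j, k) \<in> E \<longrightarrow> (i, k) \<in> E) \<and>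
    adjacency_matrix (2 * n + 1) E * adjacency_matrix (2 * n + 1) E = adjacency_matrix (2 * n + 1) E"
    (is "_ \<longleftrightarrow> ?cone \<and> ?split \<and> ?trans \<and> ?idempotent")
proof (intro iffI conjI)
  assume "is_meander_graph n V E"
  then obtain \<sigma> where \<sigma>: "bij_betw \<sigma> {..2 * n} {..2 * n}" "\<sigma> 0 = 0" "meandric n \<sigma>"
    and E: "E = {(i, j). i < j \<and> j \<le> 2 * n \<and> \<sigma> i < \<sigma> j}"
    by (rule meander_graph_permutation[OF assms(1)])
  have pos: "0 < \<sigma> i" if "1 \<le> i" "i \<le> 2 * n" for i
    using perm_eq_iff[OF \<sigma>(1,2), of i 0] \<sigma>(2) that by (cases "\<sigma> i") auto
  show ?cone using pos by (auto simp: E \<sigma>(2))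
  show ?split by (fastforce simp: E)
  show ?trans by (auto simp: E)
  show ?idempotent
    using adjacency_matrix_idempotent_iff[OF \<sigma>(1,2), of E] \<sigma>(3) by (simp add: E)
next
  assume conds: "?cone \<and> ?split \<and> ?trans \<and> ?idempotent"
  obtain \<sigma> where \<sigma>: "bij_betw \<sigma> {..2 * n} {..2 * n}" "\<sigma> 0 = 0"
    and less: "\<And>i j. i < j \<Longrightarrow> j \<le> 2 * n \<Longrightarrow> \<sigma> i < \<sigma> j \<longleftrightarrow> (i, j) \<in> E"
    by (rule permutation_of_graph[of E "2 * n"]) (use conds in blast)+
  \<comment> \<open>An edge of a simple graph on these vertices is ordered and bounded by
    \<open>2 * n\<close>, so the description of \<open>E\<close> by \<open>\<sigma>\<close> holds
    for all pairs.\<close>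
  have E: "(i, j) \<in> E \<longleftrightarrow> i < j \<and> j \<le> 2 * n \<and> \<sigma> i < \<sigma> j" for i j
    using less[of i j] assms(2,3) by (auto simp: simple_graph_def)
  then have "meandric n \<sigma>"
    using adjacency_matrix_idempotent_iff[OF \<sigma>, of E] conds by blast
  then interpret meandric_curve n \<sigma>
    using assms(1) \<sigma> by unfold_locales
  have "E = meander_graph_edges n 0 height \<gamma>"
    unfolding edges_eq using E by auto
  then show "is_meander_graph n V E"
    using open_meander_\<gamma> closable_\<gamma> assms(2) by (auto simp: is_meander_graph_def)
qed

end
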